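(* Let $\varphi$ be a $G_2$-structure on a smooth 7-manifold $M$, with full torsion tensor $T=T[\varphi]$. The diffeomorphism invariance of $T$ as a function of the 3-form $\varphi$, namely $$\mathcal{L}_Y T = (DT)[\mathcal{L}_Y\varphi]\quad\text{for all smooth vector fields } Y \text{ on } M,$$ is equivalent to the following identity: $$\nabla_i T_{jl} - \nabla_j T_{il} = T_{ia}T_{jb}\,g^{am}g^{bn}\varphi_{mnl} + \tfrac12 R_{ijab}\,g^{am}g^{bn}\varphi_{mnl}.$$
   Context: Index notation in local coordinates $x^1,\dots,x^7$, with the summation convention; forms are written $\alpha=\frac{1}{k!}\alpha_{i_1\cdots i_k}dx^{i_1}\wedge\cdots\wedge dx^{i_k}$. A $G_2$-structure on a smooth 7-manifold $M$ is a smooth 3-form $\varphi$ which at each point is equivalent, under a linear isomorphism $T_xM\cong\mathbb{R}^7$, to $e^{123}+e^{145}+e^{167}+e^{246}-e^{257}-e^{347}-e^{356}$. It determines a unique Riemannian metric $g$ and orientation (volume form $\mathsf{vol}$) by the convention $(u\lrcorner\varphi)\wedge(v\lrcorner\varphi)\wedge\varphi=-6\,g(u,v)\,\mathsf{vol}$. Let $\psi=*\varphi$ (Hodge star) and $\nabla$ the Levi-Civita connection of $g$. The full torsion tensor $T_{lm}$ is the (unique) 2-tensor with $\nabla_l\varphi_{abc}=T_{lm}g^{mn}\psi_{nabc}$. Curvature convention: $R^m_{ijk}\frac{\partial}{\partial x^m}=(\nabla_i\nabla_j-\nabla_j\nabla_i)\frac{\partial}{\partial x^k}$ and $R_{ijkl}=R^m_{ijk}g_{ml}$.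 $DT$ denotes the linearization of $T$ as a function of $\varphi$: for a 3-form $\eta$, $(DT)[\eta]=\frac{\partial}{\partial t}\big|_{t=0}T[\varphi(t)]$ for any smooth family of $G_2$-structures $\varphi(t)$ with $\varphi(0)=\varphi$ and $\frac{\partial}{\partial t}\big|_{t=0}\varphi(t)=\eta$. $\mathcal{L}_Y$ is the Lie derivative. The displayed condition $\mathcal{L}_Y T=(DT)[\mathcal{L}_Y\varphi]$ is obtained by differentiating $f_t^*(T[\varphi])=T[f_t^*\varphi]$ at $t=0$, where $f_t$ is a one-parameter family of diffeomorphisms of $M$ with $f_0=\mathrm{id}$ and $\frac{\partial}{\partial t}f_t=Y$. *)

theory Defs
  imports "HOL-Analysis.Analysis"
begin

section \<open>Smooth functions on open sets of Euclidean spaces\<close>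

text \<open>Only used for open \<open>S\<close>.\<close>

primrec Ck_on :: "nat \<Rightarrow> 'a::euclidean_space set \<Rightarrow> ('a \<Rightarrow> 'b::real_normed_vector) \<Rightarrow> bool" where
  "Ck_on 0 S f \<longleftrightarrow> continuous_on S f"
| "Ck_on (Suc k) S f \<longleftrightarrow>
     (\<forall>x\<in>S. f differentiable (at x)) \<and>
     (\<forall>b\<in>Basis. Ck_on k S (\<lambda>x. frechet_derivative f (at x) b))"

definition smooth_on :: "'a::euclidean_space set \<Rightarrow> ('a \<Rightarrow> 'b::real_normed_vector) \<Rightarrow> bool" where
  "smooth_on S f \<longleftrightarrow> (\<forall>k. Ck_on k S f)"

definition pd :: "7 \<Rightarrow> (real^7 \<Rightarrow> real) \<Rightarrow> real^7 \<Rightarrow> real" where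
  "pd i f x = frechet_derivative f (at x) (axis i 1)"


section \<open>Smooth 7-manifolds\<close>

text \<open>
  The indices \<open>1, \<dots>, 7\<close> are the elements of the numeral type \<open>7\<close> (in which \<open>7 = 0\<close>).
  A chart is a pair of its domain and the coordinate map.
\<close>

type_synonym 'm chart = "'m set \<times> ('m \<Rightarrow> real^7)"

definition chart_img :: "'m chart \<Rightarrow> (real^7) set" where
  "chart_img \<kappa> = snd \<kappa> ` fst \<kappa>"

definition is_chart :: "'m::topological_space chart \<Rightarrow> bool" where
  "is_chart \<kappa> \<longleftrightarrow> open (fst \<kappa>) \<and> open (chart_img \<kappa>) \<and>
     (\<exists>h. homeomorphism (fst \<kappa>) (chart_img \<kappa>) (snd \<kappa>) h)"

definition overlap :: "'m chart \<Rightarrow> 'm chart \<Rightarrow> (real^7) set" where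
  "overlap \<kappa> \<kappa>' = snd \<kappa> ` (fst \<kappa> \<inter> fst \<kappa>')"

definition transition :: "'m chart \<Rightarrow> 'm chart \<Rightarrow> real^7 \<Rightarrow> real^7" where
  "transition \<kappa> \<kappa>' x = snd \<kappa>' (inv_into (fst \<kappa>) (snd \<kappa>) x)"

text \<open>The manifold is the whole type \<open>'m\<close>; \<open>A\<close> is an atlas of it, not necessarily maximal.\<close>

definition smooth_manifold :: "'m::{t2_space, second_countable_topology} chart set \<Rightarrow> bool" where
  "smooth_manifold A \<longleftrightarrow>
     (\<forall>\<kappa>\<in>A. is_chart \<kappa>) \<and> (\<Union>\<kappa>\<in>A. fst \<kappa>) = UNIV \<and>
     (\<forall>\<kappa>\<in>A. \<forall>\<kappa>'\<in>A. smooth_on (overlap \<kappa> \<kappa>') (transition \<kappa> \<kappa>'))"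

definition jac :: "'m chart \<Rightarrow> 'm chart \<Rightarrow> real^7 \<Rightarrow> 7 \<Rightarrow> 7 \<Rightarrow> real" where
  "jac \<kappa> \<kappa>' x d a = pd a (\<lambda>y. transition \<kappa> \<kappa>' y $ d) x"


section \<open>Tensor fields in coordinates\<close>

text \<open>
  A tensor field on the manifold assigns to each chart \<open>\<kappa>\<close> of the atlas its components, as
  functions on \<open>chart_img \<kappa>\<close> that obey the transformation law on overlaps. Values outside
  \<open>chart_img \<kappa>\<close>, or at \<open>\<kappa>\<close> outside the atlas, are irrelevant.
\<close>

type_synonym vec_field = "real^7 \<Rightarrow> real^7"
type_synonym tensor2 = "7 \<Rightarrow> 7 \<Rightarrow> real"
type_synonym tensor3 = "7 \<Rightarrow> 7 \<Rightarrow> 7 \<Rightarrow> real"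
type_synonym tensor4 = "7 \<Rightarrow> 7 \<Rightarrow> 7 \<Rightarrow> 7 \<Rightarrow> real"

definition smooth_vector_field :: "'m chart set \<Rightarrow> ('m chart \<Rightarrow> vec_field) \<Rightarrow> bool" where
  "smooth_vector_field A Y \<longleftrightarrow>
     (\<forall>\<kappa>\<in>A. smooth_on (chart_img \<kappa>) (Y \<kappa>)) \<and>
     (\<forall>\<kappa>\<in>A. \<forall>\<kappa>'\<in>A. \<forall>x\<in>overlap \<kappa> \<kappa>'. \<forall>d.
        Y \<kappa>' (transition \<kappa> \<kappa>' x) $ d = (\<Sum>a\<in>UNIV. jac \<kappa> \<kappa>' x d a * Y \<kappa> x $ a))"

definition smooth_3form :: "'m chart set \<Rightarrow> ('m chart \<Rightarrow> real^7 \<Rightarrow> tensor3) \<Rightarrow> bool" where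
  "smooth_3form A \<omega> \<longleftrightarrow>
     (\<forall>\<kappa>\<in>A. \<forall>a b c. smooth_on (chart_img \<kappa>) (\<lambda>x. \<omega> \<kappa> x a b c)) \<and>
     (\<forall>\<kappa>\<in>A. \<forall>x\<in>chart_img \<kappa>. \<forall>a b c.
        \<omega> \<kappa> x b a c = - \<omega> \<kappa> x a b c \<and> \<omega> \<kappa> x a c b = - \<omega> \<kappa> x a b c) \<and>
     (\<forall>\<kappa>\<in>A. \<forall>\<kappa>'\<in>A. \<forall>x\<in>overlap \<kappa> \<kappa>'. \<forall>a b c.
        \<omega> \<kappa> x a b c =
          (\<Sum>d\<in>UNIV. \<Sum>e\<in>UNIV. \<Sum>f\<in>UNIV.
             jac \<kappa> \<kappa>' x d a * jac \<kappa> \<kappa>' x e b * jac \<kappa> \<kappa>' x f c *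
             \<omega> \<kappa>' (transition \<kappa> \<kappa>' x) d e f))"

definition lie2 :: "vec_field \<Rightarrow> (real^7 \<Rightarrow> tensor2) \<Rightarrow> real^7 \<Rightarrow> tensor2" where
  "lie2 Y S x i j = (\<Sum>m\<in>UNIV.
     Y x $ m * pd m (\<lambda>y. S y i j) x +
     pd i (\<lambda>y. Y y $ m) x * S x m j + pd j (\<lambda>y. Y y $ m) x * S x i m)"

definition lie3 :: "vec_field \<Rightarrow> (real^7 \<Rightarrow> tensor3) \<Rightarrow> real^7 \<Rightarrow> tensor3" where
  "lie3 Y \<omega> x a b c = (\<Sum>m\<in>UNIV.
     Y x $ m * pd m (\<lambda>y. \<omega> y a b c) x +
     pd a (\<lambda>y. Y y $ m) x * \<omega> x m b c +
     pd b (\<lambda>y. Y y $ m) x * \<omega> x a m c +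
     pd c (\<lambda>y. Y y $ m) x * \<omega> x a b m)"


section \<open>Riemannian geometry in a chart\<close>

type_synonym metric_field = "real^7 \<Rightarrow> real^7^7"

text \<open>\<open>christoffel g x m i j\<close> is $\Gamma^m_{ij}$ of the Levi-Civita connection of \<open>g\<close>.\<close>

definition christoffel :: "metric_field \<Rightarrow> real^7 \<Rightarrow> 7 \<Rightarrow> 7 \<Rightarrow> 7 \<Rightarrow> real" where
  "christoffel g x m i j = (1/2) * (\<Sum>l\<in>UNIV. matrix_inv (g x) $ m $ l *
     (pd i (\<lambda>y. g y $ j $ l) x + pd j (\<lambda>y. g y $ i $ l) x - pd l (\<lambda>y. g y $ i $ j) x))"

text \<open>The first index of a covariant derivative is the direction of differentiation.\<close>

definition nabla2 :: "metric_field \<Rightarrow> (real^7 \<Rightarrow> tensor2) \<Rightarrow> real^7 \<Rightarrow> tensor3" where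
  "nabla2 g S x i j l = pd i (\<lambda>y. S y j l) x -
     (\<Sum>m\<in>UNIV. christoffel g x m i j * S x m l + christoffel g x m i l * S x j m)"

definition nabla3 :: "metric_field \<Rightarrow> (real^7 \<Rightarrow> tensor3) \<Rightarrow> real^7 \<Rightarrow> tensor4" where
  "nabla3 g \<omega> x l a b c = pd l (\<lambda>y. \<omega> y a b c) x -
     (\<Sum>m\<in>UNIV. christoffel g x m l a * \<omega> x m b c +
                 christoffel g x m l b * \<omega> x a m c +
                 christoffel g x m l c * \<omega> x a b m)"

text \<open>
  \<open>riem_up g x m i j k\<close> is $R^m_{ijk}$, the components of
  $(\nabla_i\nabla_j-\nabla_j\nabla_i)\partial_k$, where $\nabla_j\partial_k=\Gamma^m_{jk}\partial_m$.
\<close>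

definition riem_up :: "metric_field \<Rightarrow> real^7 \<Rightarrow> tensor4" where
  "riem_up g x m i j k =
     pd i (\<lambda>y. christoffel g y m j k) x - pd j (\<lambda>y. christoffel g y m i k) x +
     (\<Sum>p\<in>UNIV. christoffel g x m i p * christoffel g x p j k -
                 christoffel g x m j p * christoffel g x p i k)"

definition riem :: "metric_field \<Rightarrow> real^7 \<Rightarrow> tensor4" where
  "riem g x i j k l = (\<Sum>m\<in>UNIV. riem_up g x m i j k * g x $ m $ l)"


section \<open>Pointwise algebra of $G_2$-structures\<close>

text \<open>
  For distinct \<open>i\<close>, \<open>j\<close>, \<open>k\<close>, \<open>basis_3form i j k\<close> is $e^i\wedge e^j\wedge e^k$, in the
  normalisation $\alpha=\frac1{3!}\alpha_{abc}\,e^a\wedge e^b\wedge e^c$.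
\<close>

definition basis_3form :: "7 \<Rightarrow> 7 \<Rightarrow> 7 \<Rightarrow> tensor3" where
  "basis_3form i j k a b c =
     (if (a, b, c) \<in> {(i, j, k), (j, k, i), (k, i, j)} then 1
      else if (a, b, c) \<in> {(j, i, k), (i, k, j), (k, j, i)} then -1
      else 0)"

definition phi0 :: tensor3 where
  "phi0 a b c =
     basis_3form 1 2 3 a b c + basis_3form 1 4 5 a b c + basis_3form 1 6 7 a b c +
     basis_3form 2 4 6 a b c - basis_3form 2 5 7 a b c - basis_3form 3 4 7 a b c -
     basis_3form 3 5 6 a b c"

definition G2_form :: "tensor3 \<Rightarrow> bool" where
  "G2_form \<omega> \<longleftrightarrow> (\<exists>L :: real^7^7. invertible L \<and>
     (\<forall>a b c. \<omega> a b c =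
        (\<Sum>d\<in>UNIV. \<Sum>e\<in>UNIV. \<Sum>f\<in>UNIV. L$d$a * L$e$b * L$f$c * phi0 d e f)))"

definition interior3 :: "real^7 \<Rightarrow> tensor3 \<Rightarrow> tensor2" where
  "interior3 u \<omega> a b = (\<Sum>i\<in>UNIV. u $ i * \<omega> i a b)"

text \<open>
  The coefficient of $dx^1\wedge\cdots\wedge dx^7$ in $\alpha\wedge\beta\wedge\gamma$;
  the factor is $1/(2!\,2!\,3!)$.
\<close>

definition wedge223 :: "tensor2 \<Rightarrow> tensor2 \<Rightarrow> tensor3 \<Rightarrow> real" where
  "wedge223 \<alpha> \<beta> \<gamma> = (1/24) * (\<Sum>p | p permutes (UNIV :: 7 set).
     of_int (sign p) * \<alpha> (p 1) (p 2) * \<beta> (p 3) (p 4) * \<gamma> (p 5) (p 6) (p 7))"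

text \<open>
  \<open>g\<close> and $\nu\,dx^1\wedge\cdots\wedge dx^7$ are the metric and the volume form of \<open>\<omega>\<close>. The
  orientation is part of what \<open>\<omega>\<close> determines: \<open>\<nu>\<close> is $\pm\sqrt{\det g}$ with the sign forced by
  the last clause (for \<open>phi0\<close> it is \<open>-1\<close>).
\<close>

definition metric_vol :: "tensor3 \<Rightarrow> real^7^7 \<Rightarrow> real \<Rightarrow> bool" where
  "metric_vol \<omega> g \<nu> \<longleftrightarrow>
     transpose g = g \<and> (\<forall>u. u \<noteq> 0 \<longrightarrow> u \<bullet> (g *v u) > 0) \<and> \<nu>\<^sup>2 = det g \<and>
     (\<forall>u v. wedge223 (interior3 u \<omega>) (interior3 v \<omega>) \<omega> = - 6 * (u \<bullet> (g *v v)) * \<nu>)"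

definition metric :: "tensor3 \<Rightarrow> real^7^7" where
  "metric \<omega> = (THE g. \<exists>\<nu>. metric_vol \<omega> g \<nu>)"

definition vol :: "tensor3 \<Rightarrow> real" where
  "vol \<omega> = (THE \<nu>. \<exists>g. metric_vol \<omega> g \<nu>)"

definition ginv :: "tensor3 \<Rightarrow> tensor2" where
  "ginv \<omega> i j = matrix_inv (metric \<omega>) $ i $ j"

definition levi_civita :: "(7 \<Rightarrow> 7) \<Rightarrow> real" where
  "levi_civita p = (if p permutes UNIV then of_int (sign p) else 0)"

definition vol_comp :: "tensor3 \<Rightarrow> 7 \<Rightarrow> 7 \<Rightarrow> 7 \<Rightarrow> 7 \<Rightarrow> 7 \<Rightarrow> 7 \<Rightarrow> 7 \<Rightarrow> real" where
  "vol_comp \<omega> i j k a b c d =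
     vol \<omega> * levi_civita (id(1 := i, 2 := j, 3 := k, 4 := a, 5 := b, 6 := c, 7 := d))"

text \<open>
  \<open>psi \<omega>\<close> is $*\omega$ for the metric and orientation of \<open>\<omega>\<close>:
  $(*\omega)_{abcd}=\frac1{3!}\,\omega^{ijk}\,\mathsf{vol}_{ijkabcd}$, i.e.\ the Hodge star with
  $\alpha\wedge *\beta=\langle\alpha,\beta\rangle\,\mathsf{vol}$.
\<close>

definition psi :: "tensor3 \<Rightarrow> tensor4" where
  "psi \<omega> a b c d = (1/6) * (\<Sum>i\<in>UNIV. \<Sum>j\<in>UNIV. \<Sum>k\<in>UNIV.
     (\<Sum>p\<in>UNIV. \<Sum>q\<in>UNIV. \<Sum>r\<in>UNIV. ginv \<omega> i p * ginv \<omega> j q * ginv \<omega> k r * \<omega> p q r) *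
     vol_comp \<omega> i j k a b c d)"


section \<open>$G_2$-structures, torsion and its linearization\<close>

definition G2_structure :: "'m chart set \<Rightarrow> ('m chart \<Rightarrow> real^7 \<Rightarrow> tensor3) \<Rightarrow> bool" where
  "G2_structure A \<phi> \<longleftrightarrow>
     smooth_3form A \<phi> \<and> (\<forall>\<kappa>\<in>A. \<forall>x\<in>chart_img \<kappa>. G2_form (\<phi> \<kappa> x))"

definition metric_field :: "(real^7 \<Rightarrow> tensor3) \<Rightarrow> metric_field" where
  "metric_field \<omega> x = metric (\<omega> x)"

definition torsion :: "(real^7 \<Rightarrow> tensor3) \<Rightarrow> real^7 \<Rightarrow> tensor2" where
  "torsion \<omega> x = (THE S. \<forall>l a b c. nabla3 (metric_field \<omega>) \<omega> x l a b c =
     (\<Sum>m\<in>UNIV. \<Sum>n\<in>UNIV. S l m * ginv (\<omega> x) m n * psi (\<omega> x) n a b c))"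

text \<open>
  A smooth family of $G_2$-structures $\varphi(t)$, \<open>-\<epsilon> < t < \<epsilon>\<close>, on the whole manifold with
  $\varphi(0)=\varphi$ and $\partial_t\varphi(0)=\eta$.
\<close>

definition G2_variation ::
  "'m chart set \<Rightarrow> ('m chart \<Rightarrow> real^7 \<Rightarrow> tensor3) \<Rightarrow> ('m chart \<Rightarrow> real^7 \<Rightarrow> tensor3) \<Rightarrow>
   (real \<Rightarrow> 'm chart \<Rightarrow> real^7 \<Rightarrow> tensor3) \<Rightarrow> bool" where
  "G2_variation A \<phi> \<eta> \<Phi> \<longleftrightarrow> (\<exists>\<epsilon>>0.
     (\<forall>t\<in>{-\<epsilon><..<\<epsilon>}. G2_structure A (\<Phi> t)) \<and>
     (\<forall>\<kappa>\<in>A. \<forall>a b c.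
        smooth_on ({-\<epsilon><..<\<epsilon>} \<times> chart_img \<kappa>) (\<lambda>(t, x). \<Phi> t \<kappa> x a b c))) \<and>
     (\<forall>\<kappa>\<in>A. \<forall>x\<in>chart_img \<kappa>. \<forall>a b c.
        \<Phi> 0 \<kappa> x a b c = \<phi> \<kappa> x a b c \<and>
        ((\<lambda>t. \<Phi> t \<kappa> x a b c) has_real_derivative \<eta> \<kappa> x a b c) (at 0))"

text \<open>
  \<open>DT_eq A \<phi> \<eta> S\<close> is the equation $(DT)[\eta]=S$ at \<open>\<phi>\<close>: for any smooth family with initial
  velocity \<open>\<eta>\<close>, the torsion tensors have derivative \<open>S\<close> at \<open>t = 0\<close>. This is never vacuous when
  \<open>\<eta>\<close> is a smooth 3-form: since the $G_2$-forms are an open orbit, there is a constant \<open>C > 0\<close>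
  such that $\varphi+t\,\eta\,(1+C\,t^2|\eta|_g^2)^{-1/2}$ is such a family, for all real \<open>t\<close>.
\<close>

definition DT_eq ::
  "'m chart set \<Rightarrow> ('m chart \<Rightarrow> real^7 \<Rightarrow> tensor3) \<Rightarrow> ('m chart \<Rightarrow> real^7 \<Rightarrow> tensor3) \<Rightarrow>
   ('m chart \<Rightarrow> real^7 \<Rightarrow> tensor2) \<Rightarrow> bool" where
  "DT_eq A \<phi> \<eta> S \<longleftrightarrow> (\<forall>\<Phi>. G2_variation A \<phi> \<eta> \<Phi> \<longrightarrow>
     (\<forall>\<kappa>\<in>A. \<forall>x\<in>chart_img \<kappa>. \<forall>i j.
        ((\<lambda>t. torsion (\<Phi> t \<kappa>) x i j) has_real_derivative S \<kappa> x i j) (at 0)))"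

end

theory Submission
  imports Defs
begin

text \<open>
  Both sides of the equivalence hold for every $G_2$-structure. A form $L^*\varphi_0$ determines its
  metric and volume through the covariant $B(\varphi)_{ij}=-6g_{ij}\nu$, and $\det B=(-6)^7\nu^9$ makes
  \<open>\<nu>\<close>, \<open>g\<close>, \<open>\<psi>\<close> explicit smooth functions of the form that commute with pullback by
  invertible matrices. Differentiating this equivariance gives their variation along the
  infinitesimal action of $\mathfrak{gl}(7)$, and every 3-form is an infinitesimal variation of $\varphi$ of this kind;
  so $\nabla g=0$ forces $\nabla_l\varphi$ to come from $\mathfrak{so}(7)$, which is exactly
  $\nabla_l\varphi=T_l\cdot\psi$.

  Hence $\partial_l\varphi=\Gamma_l\cdot\varphi+T_l\cdot\psi$. Commuting two coordinate derivatives of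
  $\varphi$ and projecting $\mathfrak{so}(7)$ to $\mathbb{R}^7$ yields the identity; commuting a
  coordinate derivative with $\partial_t$ along a family with velocity $\mathcal{L}_Y\varphi$, where
  $\partial_t\Gamma$ is known from the same computation for $g$, yields $\partial_tT=\mathcal{L}_YT$.
\<close>

section \<open>Permutations of seven indices\<close>

text \<open>\<open>metric\<close>, \<open>vol\<close> and \<open>torsion\<close> are definite
  descriptions and cannot be differentiated as they stand. Each is matched with a closed formula:
  \<open>g_expr\<close> and \<open>nu_expr\<close> solve B = -6 g \<nu>, and
  \<open>torsion_along\<close> recovers T by contraction with the dual form, the constant 1/24
  coming from the full contraction 24 g_mn of \<psi>_mabc with \<psi>_nabc. These formulas are
  smooth on the open set where det B is nonzero, which contains the G2-forms, so differentiation
  with respect to the form takes place there. A family \<phi>(t) is treated as one field of forms on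
  the product of a time interval and a chart. Fields therefore live on an arbitrary Euclidean space
  with seven marked directions in the role of the coordinate directions; time is one more direction,
  and commuting it with the others is the same symmetry of second derivatives that produces the
  curvature. The velocity of the family is known only at t = 0, so it may be differentiated only in
  directions tangent to that slice. Numerical identities for the model form are checked on
  components and carried to a general G2-form by a frame.\<close>

lemma UNIV_7: "(UNIV :: 7 set) = {1, 2, 3, 4, 5, 6, 7}"
proof -
  have "card {1, 2, 3, 4, 5, 6, 7 :: 7} = 7" by simp
  then show ?thesis using card_subset_eq[of "UNIV :: 7 set" "{1, 2, 3, 4, 5, 6, 7}"] by simp
qed

lemma sum_7: "(\<Sum>i\<in>(UNIV :: 7 set). f i) = f 1 + f 2 + f 3 + f 4 + f 5 + f 6 + (f 7 :: 'a::comm_monoid_add)"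
  unfolding UNIV_7 by (simp add: ac_simps)

lemma prod_7: "(\<Prod>i\<in>(UNIV :: 7 set). f i) = f 1 * f 2 * f 3 * f 4 * f 5 * f 6 * (f 7 :: 'a::comm_monoid_mult)"
  unfolding UNIV_7 by (simp add: ac_simps)

lemma forall_7: "(\<forall>i::7. P i) \<longleftrightarrow> P 1 \<and> P 2 \<and> P 3 \<and> P 4 \<and> P 5 \<and> P 6 \<and> P 7"
proof -
  have "(\<forall>i::7. P i) \<longleftrightarrow> (\<forall>i\<in>UNIV. P i)" by simp
  also have "\<dots> \<longleftrightarrow> P 1 \<and> P 2 \<and> P 3 \<and> P 4 \<and> P 5 \<and> P 6 \<and> P 7" unfolding UNIV_7 by (simp only: ball_simps simp_thms)
  finally show ?thesis .
qed

text \<open>The update pattern is the one in \<open>vol_comp\<close>, so that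
  \<open>vol_comp\<close> folds into \<open>eps\<close>. All seven values are overwritten, so the
  base \<open>id\<close> leaves no trace.\<close>

definition args7 :: "7 \<Rightarrow> 7 \<Rightarrow> 7 \<Rightarrow> 7 \<Rightarrow> 7 \<Rightarrow> 7 \<Rightarrow> 7 \<Rightarrow> 7 \<Rightarrow> 7" where
  "args7 i j k a b c d = id(1 := i, 2 := j, 3 := k, 4 := a, 5 := b, 6 := c, 7 := d)"

lemma args7_simps [simp]:
  "args7 i j k a b c d 1 = i" "args7 i j k a b c d 2 = j" "args7 i j k a b c d 3 = k"
  "args7 i j k a b c d 4 = a" "args7 i j k a b c d 5 = b" "args7 i j k a b c d 6 = c"
  "args7 i j k a b c d 7 = d"
  by (simp_all add: args7_def)

lemma args7_eq_iff: "f = args7 i j k a b c d \<longleftrightarrow>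
    f 1 = i \<and> f 2 = j \<and> f 3 = k \<and> f 4 = a \<and> f 5 = b \<and> f 6 = c \<and> f 7 = d"
  unfolding fun_eq_iff by (subst forall_7) simp

lemma args7_eta: "args7 (f 1) (f 2) (f 3) (f 4) (f 5) (f 6) (f 7) = f"
  by (rule sym) (simp add: args7_eq_iff)

text \<open>Products of seven sums expand into sums over index maps, the shape in which determinants
  appear; this lemma moves between the two.\<close>

lemma sum_fun7:
  fixes F :: "(7 \<Rightarrow> 7) \<Rightarrow> 'a::comm_monoid_add"
  shows "(\<Sum>f\<in>UNIV. F f) = (\<Sum>i\<in>UNIV. \<Sum>j\<in>UNIV. \<Sum>k\<in>UNIV. \<Sum>a\<in>UNIV. \<Sum>b\<in>UNIV. \<Sum>c\<in>UNIV. \<Sum>d\<in>UNIV.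
    F (args7 i j k a b c d))"
proof -
  have "(\<Sum>f\<in>UNIV. F f) = (\<Sum>(i,j,k,a,b,c,d)\<in>UNIV. F (args7 i j k a b c d))"
    by (rule sum.reindex_bij_witness[where i = "\<lambda>(i,j,k,a,b,c,d). args7 i j k a b c d"
        and j = "\<lambda>f. (f 1, f 2, f 3, f 4, f 5, f 6, f 7)"])
      (auto simp: args7_eta)
  then show ?thesis
    by (simp only: UNIV_Times_UNIV[symmetric] sum.cartesian_product[symmetric] split_conv
        sum.cartesian_product[where g = "\<lambda>x y. case y of (j,k,a,b,c,d) \<Rightarrow> F (args7 x j k a b c d)", symmetric])
qed

text \<open>Composing with a transposition preserves bijectivity. For a permutation the sign
  changes; for any other map both sides are zero.\<close>

lemma levi_civita_swap: "i \<noteq> j \<Longrightarrow> levi_civita (f \<circ> Transposition.transpose i j) = - levi_civita f"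
proof -
  assume ij: "i \<noteq> j"
  let ?t = "Transposition.transpose i j"
  have t: "?t permutes UNIV" by (simp add: permutes_swap_id)
  have "(f \<circ> ?t) permutes UNIV \<longleftrightarrow> f permutes UNIV"
  proof
    assume "(f \<circ> ?t) permutes UNIV"
    then have "(f \<circ> ?t \<circ> ?t) permutes UNIV" using t permutes_compose by blast
    then show "f permutes UNIV" by (simp add: o_assoc[symmetric])
  qed (use t permutes_compose in blast)
  moreover have "sign (f \<circ> ?t) = - sign f" if "f permutes UNIV"
  proof -
    have "permutation f" "permutation ?t" using that t permutation_permutes by (auto simp: permutation_permutes)
    then show ?thesis by (simp add: sign_compose sign_swap_id ij)
  qed
  ultimately show ?thesis by (simp add: levi_civita_def)
qed

lemma levi_civita_id: "levi_civita id = 1"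
  by (simp add: levi_civita_def permutes_id)

definition eps :: "7 \<Rightarrow> 7 \<Rightarrow> 7 \<Rightarrow> 7 \<Rightarrow> 7 \<Rightarrow> 7 \<Rightarrow> 7 \<Rightarrow> real" where
  "eps i j k a b c d = levi_civita (args7 i j k a b c d)"

lemma eps_swap:
  "eps j i k a b c d = - eps i j k a b c d"
  "eps i k j a b c d = - eps i j k a b c d"
  "eps i j a k b c d = - eps i j k a b c d"
  "eps i j k b a c d = - eps i j k a b c d"
  "eps i j k a c b d = - eps i j k a b c d"
  "eps i j k a b d c = - eps i j k a b c d"
proof -
  have *: "eps i' j' k' a' b' c' d' = - eps i j k a b c d"
    if "args7 i' j' k' a' b' c' d' = args7 i j k a b c d \<circ> Transposition.transpose p q" "p \<noteq> q"
    for i' j' k' a' b' c' d' p q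
    unfolding eps_def using levi_civita_swap that by metis
  show
  "eps j i k a b c d = - eps i j k a b c d"
  "eps i k j a b c d = - eps i j k a b c d"
  "eps i j a k b c d = - eps i j k a b c d"
  "eps i j k b a c d = - eps i j k a b c d"
  "eps i j k a c b d = - eps i j k a b c d"
  "eps i j k a b d c = - eps i j k a b c d"
    by (rule *[of _ _ _ _ _ _ _ 1 2] *[of _ _ _ _ _ _ _ 2 3] *[of _ _ _ _ _ _ _ 3 4] *[of _ _ _ _ _ _ _ 4 5]
      *[of _ _ _ _ _ _ _ 5 6] *[of _ _ _ _ _ _ _ 6 7]; subst eq_commute, simp add: args7_eq_iff Transposition.transpose_def)+
qed

lemma eps_id: "eps 1 2 3 4 5 6 7 = 1"
proof -
  have "args7 1 2 3 4 5 6 7 = id" by (rule sym) (simp add: args7_eq_iff)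
  then show ?thesis by (simp add: eps_def levi_civita_id)
qed

lemma eps_not_distinct: "\<not> distinct [i, j, k, a, b, c, d] \<Longrightarrow> eps i j k a b c d = 0"
proof -
  assume nd: "\<not> distinct [i, j, k, a, b, c, d]"
  let ?f = "args7 i j k a b c d"
  have "distinct (map ?f [1, 2, 3, 4, 5, 6, 7])" if "inj ?f"
    unfolding distinct_map by (intro conjI inj_on_subset[OF that]) simp_all
  then have "\<not> inj ?f" using nd by (simp only: list.map args7_simps) blast
  then show ?thesis by (auto simp: eps_def levi_civita_def permutes_inj)
qed

text \<open>The sum is the determinant of the matrix whose columns are selected by \<open>f\<close>.
  If \<open>f\<close> is a permutation the columns are merely reordered; otherwise two of them
  coincide.\<close>

lemma det_columns:
  "(\<Sum>p\<in>UNIV. levi_civita p * (\<Prod>r\<in>UNIV. M $ p r $ f r)) = det (M :: real^7^7) * levi_civita f"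
proof -
  let ?N = "\<chi> i j. transpose M $ f i $ j"
  have "(\<Sum>p\<in>UNIV. levi_civita p * (\<Prod>r\<in>UNIV. M $ p r $ f r)) =
      (\<Sum>p\<in>{p. p permutes UNIV}. levi_civita p * (\<Prod>r\<in>UNIV. M $ p r $ f r))"
    by (rule sum.mono_neutral_right) (auto simp: levi_civita_def)
  also have "\<dots> = det ?N"
    unfolding det_def by (intro sum.cong) (auto simp: levi_civita_def transpose_def)
  also have "\<dots> = det M * levi_civita f"
  proof (cases "f permutes UNIV")
    case True
    then show ?thesis
      using det_permute_rows[OF True, of "transpose M"] by (simp add: levi_civita_def det_transpose)
  next
    case False
    then have "\<not> inj f"
      using bij_imp_permutes[of f UNIV] finite_UNIV_inj_surj[of f] by (auto simp: bij_def)
    then obtain i j where "i \<noteq> j" "f i = f j" by (auto simp: inj_def)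
    then have "det ?N = 0"
      by (intro det_identical_rows[of i j]) (auto simp: row_def)
    with False show ?thesis by (simp add: levi_civita_def)
  qed
  finally show ?thesis .
qed

lemma det_rows:
  "(\<Sum>p\<in>UNIV. levi_civita p * (\<Prod>r\<in>UNIV. M $ f r $ p r)) = det (M :: real^7^7) * levi_civita f"
  using det_columns[of "transpose M" f] by (simp add: transpose_def det_transpose[unfolded transpose_def])

section \<open>Component tables for the index type and the model form\<close>

lemma neq_7:
  "(1::7) \<noteq> 2" "(1::7) \<noteq> 3" "(1::7) \<noteq> 4" "(1::7) \<noteq> 5" "(1::7) \<noteq> 6"
  "(1::7) \<noteq> 7" "(2::7) \<noteq> 1" "(2::7) \<noteq> 3" "(2::7) \<noteq> 4" "(2::7) \<noteq> 5"
  "(2::7) \<noteq> 6" "(2::7) \<noteq> 7" "(3::7) \<noteq> 1" "(3::7) \<noteq> 2" "(3::7) \<noteq> 4"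
  "(3::7) \<noteq> 5" "(3::7) \<noteq> 6" "(3::7) \<noteq> 7" "(4::7) \<noteq> 1" "(4::7) \<noteq> 2"
  "(4::7) \<noteq> 3" "(4::7) \<noteq> 5" "(4::7) \<noteq> 6" "(4::7) \<noteq> 7" "(5::7) \<noteq> 1"
  "(5::7) \<noteq> 2" "(5::7) \<noteq> 3" "(5::7) \<noteq> 4" "(5::7) \<noteq> 6" "(5::7) \<noteq> 7"
  "(6::7) \<noteq> 1" "(6::7) \<noteq> 2" "(6::7) \<noteq> 3" "(6::7) \<noteq> 4" "(6::7) \<noteq> 5"
  "(6::7) \<noteq> 7" "(7::7) \<noteq> 1" "(7::7) \<noteq> 2" "(7::7) \<noteq> 3" "(7::7) \<noteq> 4"
  "(7::7) \<noteq> 5" "(7::7) \<noteq> 6"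
  by simp_all

text \<open>The order compares representatives modulo 7, so 7 = 0 is the least element and the
  increasing order is 7, 1, 2, 3, 4, 5, 6. Every later reduction to increasing indices uses this
  order.\<close>

lemma less_7:
  "\<not> (1::7) < 1" "(1::7) < 2" "(1::7) < 3" "(1::7) < 4" "(1::7) < 5" "(1::7) < 6" "\<not> (1::7) < 7"
  "\<not> (2::7) < 1" "\<not> (2::7) < 2" "(2::7) < 3" "(2::7) < 4" "(2::7) < 5" "(2::7) < 6" "\<not> (2::7) < 7"
  "\<not> (3::7) < 1" "\<not> (3::7) < 2" "\<not> (3::7) < 3" "(3::7) < 4" "(3::7) < 5" "(3::7) < 6"
  "\<not> (3::7) < 7" "\<not> (4::7) < 1" "\<not> (4::7) < 2" "\<not> (4::7) < 3" "\<not> (4::7) < 4" "(4::7) < 5"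
  "(4::7) < 6" "\<not> (4::7) < 7" "\<not> (5::7) < 1" "\<not> (5::7) < 2" "\<not> (5::7) < 3" "\<not> (5::7) < 4"
  "\<not> (5::7) < 5" "(5::7) < 6" "\<not> (5::7) < 7" "\<not> (6::7) < 1" "\<not> (6::7) < 2" "\<not> (6::7) < 3"
  "\<not> (6::7) < 4" "\<not> (6::7) < 5" "\<not> (6::7) < 6" "\<not> (6::7) < 7" "(7::7) < 1" "(7::7) < 2"
  "(7::7) < 3" "(7::7) < 4" "(7::7) < 5" "(7::7) < 6" "\<not> (7::7) < 7"
  by (simp_all add: less_bit1_def bit1.Rep_numeral bit1.Rep_1)

text \<open>Two indices determine at most one third index with a nonzero entry. Leaving
  \<open>c\<close> free and writing the entry as a delta lets sums over the last index
  collapse.\<close>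

lemma phi0_rows:
  "phi0 1 1 c = 0" "phi0 1 2 c = (if c = 3 then 1 else 0)" "phi0 1 3 c = (if c = 2 then - 1 else 0)"
  "phi0 1 4 c = (if c = 5 then 1 else 0)" "phi0 1 5 c = (if c = 4 then - 1 else 0)"
  "phi0 1 6 c = (if c = 7 then 1 else 0)" "phi0 1 7 c = (if c = 6 then - 1 else 0)"
  "phi0 2 1 c = (if c = 3 then - 1 else 0)" "phi0 2 2 c = 0" "phi0 2 3 c = (if c = 1 then 1 else 0)"
  "phi0 2 4 c = (if c = 6 then 1 else 0)" "phi0 2 5 c = (if c = 7 then - 1 else 0)"
  "phi0 2 6 c = (if c = 4 then - 1 else 0)" "phi0 2 7 c = (if c = 5 then 1 else 0)"
  "phi0 3 1 c = (if c = 2 then 1 else 0)" "phi0 3 2 c = (if c = 1 then - 1 else 0)" "phi0 3 3 c = 0"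
  "phi0 3 4 c = (if c = 7 then - 1 else 0)" "phi0 3 5 c = (if c = 6 then - 1 else 0)"
  "phi0 3 6 c = (if c = 5 then 1 else 0)" "phi0 3 7 c = (if c = 4 then 1 else 0)"
  "phi0 4 1 c = (if c = 5 then - 1 else 0)" "phi0 4 2 c = (if c = 6 then - 1 else 0)"
  "phi0 4 3 c = (if c = 7 then 1 else 0)" "phi0 4 4 c = 0" "phi0 4 5 c = (if c = 1 then 1 else 0)"
  "phi0 4 6 c = (if c = 2 then 1 else 0)" "phi0 4 7 c = (if c = 3 then - 1 else 0)"
  "phi0 5 1 c = (if c = 4 then 1 else 0)" "phi0 5 2 c = (if c = 7 then 1 else 0)"
  "phi0 5 3 c = (if c = 6 then 1 else 0)" "phi0 5 4 c = (if c = 1 then - 1 else 0)" "phi0 5 5 c = 0"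
  "phi0 5 6 c = (if c = 3 then - 1 else 0)" "phi0 5 7 c = (if c = 2 then - 1 else 0)"
  "phi0 6 1 c = (if c = 7 then - 1 else 0)" "phi0 6 2 c = (if c = 4 then 1 else 0)"
  "phi0 6 3 c = (if c = 5 then - 1 else 0)" "phi0 6 4 c = (if c = 2 then - 1 else 0)"
  "phi0 6 5 c = (if c = 3 then 1 else 0)" "phi0 6 6 c = 0" "phi0 6 7 c = (if c = 1 then 1 else 0)"
  "phi0 7 1 c = (if c = 6 then 1 else 0)" "phi0 7 2 c = (if c = 5 then - 1 else 0)"
  "phi0 7 3 c = (if c = 4 then - 1 else 0)" "phi0 7 4 c = (if c = 3 then 1 else 0)"
  "phi0 7 5 c = (if c = 2 then 1 else 0)" "phi0 7 6 c = (if c = 1 then - 1 else 0)" "phi0 7 7 c = 0"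
  by (rule spec[where x = c]; simp only: forall_7 phi0_def basis_3form_def insert_iff empty_iff prod.inject neq_7
      simp_thms if_True if_False add_0_left add_0_right diff_0 diff_0_right minus_zero)+

lemma phi0_swap: "phi0 b a c = - phi0 a b c" "phi0 a c b = - phi0 a b c"
proof -
  have "\<forall>a b c. phi0 b a c = - phi0 a b c" "\<forall>a b c. phi0 a c b = - phi0 a b c"
    by (simp_all only: forall_7 phi0_rows neq_7 simp_thms if_True if_False minus_zero minus_minus)
  then show "phi0 b a c = - phi0 a b c" "phi0 a c b = - phi0 a b c" by blast+
qed

text \<open>Each of the seven terms of \<open>phi0\<close> occurs in six orderings, and antisymmetry
  of \<open>X\<close> makes the six contributions equal.\<close>

lemma phi0_contract:
  assumes "\<And>i j k. X j i k = - X i j k" "\<And>i j k. X i k j = - (X i j k :: real)"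
  shows "(\<Sum>i\<in>UNIV. \<Sum>j\<in>UNIV. \<Sum>k\<in>UNIV. phi0 i j k * X i j k) =
    6 * (X 1 2 3 + X 1 4 5 + X 1 6 7 + X 2 4 6 - X 2 5 7 - X 3 4 7 - X 3 5 6)"
proof -
  have p: "X j k i = X i j k" "X k i j = X i j k" "X k j i = - X i j k" "X j i k = - X i j k" "X i k j = - X i j k" for i j k
    using assms by (metis minus_minus)+
  show ?thesis
    by (simp add: sum_7 phi0_rows p[where i = 1 and j = 2 and k = 3]
      p[where i = 1 and j = 4 and k = 5]
      p[where i = 1 and j = 6 and k = 7]
      p[where i = 2 and j = 4 and k = 6]
      p[where i = 2 and j = 5 and k = 7]
      p[where i = 3 and j = 4 and k = 7]
      p[where i = 3 and j = 5 and k = 6])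
qed

text \<open>Sorting the indices reduces an identity of alternating tensors to increasing triples, of
  which there are 35 for seven indices, so that it can be checked on components.\<close>

lemma alternating3_zero:
  fixes F :: "'i::linorder \<Rightarrow> 'i \<Rightarrow> 'i \<Rightarrow> real"
  assumes s: "\<And>a b c. F b a c = - F a b c" "\<And>a b c. F a c b = - F a b c"
    and z: "\<And>a b c. a < b \<Longrightarrow> b < c \<Longrightarrow> F a b c = 0"
  shows "F a b c = 0"
proof -
  have d: "F a a c = 0" "F a c c = 0" for a c using s(1)[of a a c] s(2)[of a c c] by auto
  have *: "F a b c = 0" if ab: "a < b" for a b c
  proof -
    consider "c < a" | "c = a" | "a < c" "c < b" | "c = b" | "b < c" by fastforce
    then show ?thesis
    proof cases
      case 1 then show ?thesis using z[of c a b] ab s(1)[of a c b] s(2)[of a c b] by simp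
    next
      case 2 then show ?thesis using d s(2)[of a a b] by simp
    next
      case 3 then show ?thesis using z[of a c b] s(2)[of a c b] by simp
    qed (use z ab d in auto)
  qed
  show ?thesis using *[of a b c] *[of b a c] d s(1)[of a b c] by (cases a b rule: linorder_cases) auto
qed

text \<open>For fixed \<open>d\<close> the three-index statement applies to the first three indices;
  the last one is then moved to its place among them.\<close>

lemma alternating4_zero:
  fixes F :: "'i::linorder \<Rightarrow> 'i \<Rightarrow> 'i \<Rightarrow> 'i \<Rightarrow> real"
  assumes s: "\<And>a b c d. F b a c d = - F a b c d" "\<And>a b c d. F a c b d = - F a b c d"
      "\<And>a b c d. F a b d c = - F a b c d"
    and z: "\<And>a b c d. a < b \<Longrightarrow> b < c \<Longrightarrow> c < d \<Longrightarrow> F a b c d = 0"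
  shows "F a b c d = 0"
proof (rule alternating3_zero[of "\<lambda>a b c. F a b c d"])
  fix a b c :: 'i assume abc: "a < b" "b < c"
  have dd: "F a b c c = 0" for a b c using s(3)[of a b c c] by auto
  consider "d < a" | "d = a" | "a < d" "d < b" | "d = b" | "b < d" "d < c" | "d = c" | "c < d" by fastforce
  then show "F a b c d = 0"
  proof cases
    case 1 then show ?thesis using z[of d a b c] abc s(1)[of a d b c] s(2)[of a d b c] s(3)[of a b d c] by simp
  next
    case 2 then show ?thesis using dd[of b c a] s(1)[of a b c a] s(2)[of b a c a] by simp
  next
    case 3 then show ?thesis using z[of a d b c] abc s(2)[of a d b c] s(3)[of a b d c] by simp
  next
    case 4 then show ?thesis using dd[of a c b] s(2)[of a b c b] by simp
  next
    case 5 then show ?thesis using z[of a b d c] abc s(3)[of a b d c] by simp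
  qed (use z abc dd in auto)
qed (rule s(1) s(2))+

text \<open>The components of the Hodge dual of \<open>phi0\<close>, encoded through the contraction
  identity \<phi>_abk \<phi>_cdk = \<delta>_ac \<delta>_bd - \<delta>_ad \<delta>_bc - \<psi>_abcd.
  That this is the dual is \<open>star4_phi0\<close>.\<close>

definition psi0 :: tensor4 where
  "psi0 a b c d = (if a = c \<and> b = d then 1 else 0) - (if a = d \<and> b = c then 1 else 0) -
     (\<Sum>k\<in>UNIV. phi0 a b k * phi0 c d k)"

section \<open>The model form and its dual\<close>

lemma if_mult_delta: "(if P then s else 0) * x = (if P then s * x else (0::real))"
  by simp

lemmas table_simps = neq_7 if_mult_delta mult_zero_left sum.neutral_const sum.delta finite_class.finite_UNIV UNIV_I
      if_True if_False simp_thms mult_1_left mult_minus_left minus_zero minus_minus diff_0 diff_0_right diff_self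
      minus_diff_eq diff_minus_eq_add add_0_left add_0_right add.right_inverse add.left_inverse

text \<open>The outer symmetries are visible in the definition. Antisymmetry in the middle pair is
  special to \<open>phi0\<close> and is read off from its table.\<close>

lemma psi0_swap: "psi0 b a c d = - psi0 a b c d" "psi0 a c b d = - psi0 a b c d" "psi0 a b d c = - psi0 a b c d"
proof -
  show "psi0 b a c d = - psi0 a b c d"
    by (simp only: psi0_def phi0_swap(1)[of b a] mult_minus_left sum_negf conj_commute[of "b = _"])
  show "psi0 a b d c = - psi0 a b c d"
    by (simp only: psi0_def phi0_swap(1)[of d c] mult_minus_right sum_negf)
  have "\<forall>a b c d. psi0 a c b d = - psi0 a b c d"
    by (simp only: forall_7 psi0_def phi0_rows table_simps)
  then show "psi0 a c b d = - psi0 a b c d" by blast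
qed

text \<open>The ordering premise turns antisymmetry into terminating rewrite rules that sort the
  arguments by adjacent transpositions.\<close>

lemma eps_swap_less:
  assumes "i < j"
  shows "eps j i k a b c d = - eps i j k a b c d"
  "eps k j i a b c d = - eps k i j a b c d"
  "eps k a j i b c d = - eps k a i j b c d"
  "eps k a b j i c d = - eps k a b i j c d"
  "eps k a b c j i d = - eps k a b c i j d"
  "eps k a b c d j i = - eps k a b c d i j"
  by (rule eps_swap)+

text \<open>This is the sorted tuple in the order of the index type. It differs from 1, ..., 7 by a
  cycle of length seven, which is even.\<close>

lemma eps_7_first: "eps 7 1 2 3 4 5 6 = 1"
proof -
  have "eps 7 1 2 3 4 5 6 = eps 1 2 3 4 5 6 7"
    using eps_swap(1)[of 1 7 2 3 4 5 6] eps_swap(2)[of 1 2 7 3 4 5 6] eps_swap(3)[of 1 2 3 7 4 5 6]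
       eps_swap(4)[of 1 2 3 4 7 5 6] eps_swap(5)[of 1 2 3 4 5 7 6] eps_swap(6)[of 1 2 3 4 5 6 7] by linarith
  then show ?thesis by (simp only: eps_id)
qed

text \<open>The seven triples of \<open>phi0\<close>, each completed by its complement in increasing
  order.\<close>

lemma eps_lines:
  "eps 1 2 3 7 4 5 6 = - 1"
  "eps 1 4 5 7 2 3 6 = - 1"
  "eps 1 6 7 2 3 4 5 = 1"
  "eps 2 4 6 7 1 3 5 = - 1"
  "eps 2 5 7 1 3 4 6 = 1"
  "eps 3 4 7 1 2 5 6 = 1"
  "eps 3 5 6 7 1 2 4 = - 1"
  by (simp_all only: eps_swap_less less_7 eps_7_first minus_minus)

text \<open>The left side is one sixth of the contraction of \<open>phi0\<close> with
  \<open>eps\<close>. The minus sign reflects that \<open>phi0\<close> induces the orientation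
  opposite to the standard one.\<close>

lemma psi0_eps: "eps 1 2 3 a b c d + eps 1 4 5 a b c d + eps 1 6 7 a b c d + eps 2 4 6 a b c d
   - eps 2 5 7 a b c d - eps 3 4 7 a b c d - eps 3 5 6 a b c d = - psi0 a b c d"
proof -
  let ?F = "\<lambda>a b c d. eps 1 2 3 a b c d + eps 1 4 5 a b c d + eps 1 6 7 a b c d + eps 2 4 6 a b c d
   - eps 2 5 7 a b c d - eps 3 4 7 a b c d - eps 3 5 6 a b c d + psi0 a b c d"
  have z: "\<forall>a b c d. a < b \<longrightarrow> b < c \<longrightarrow> c < d \<longrightarrow> ?F a b c d = 0"
    by (simp only: forall_7 less_7 simp_thms eps_lines eps_not_distinct distinct.simps list.set insert_iff empty_iff
       psi0_def phi0_rows table_simps)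
  have "?F a b c d = 0"
  proof (rule alternating4_zero[of ?F])
    fix a b c d :: 7
    show "?F b a c d = - ?F a b c d"
      by (simp only: eps_swap(4)[of _ _ _ b a] psi0_swap(1)[of b a])
    show "?F a c b d = - ?F a b c d"
      by (simp only: eps_swap(5)[of _ _ _ _ c b] psi0_swap(2)[of a c b])
    show "?F a b d c = - ?F a b c d"
      by (simp only: eps_swap(6)[of _ _ _ _ _ d c] psi0_swap(3)[of a b d c])
  qed (use z in blast)
  then show ?thesis by linarith
qed

lemma phi0_eps: "(\<Sum>i\<in>UNIV. \<Sum>j\<in>UNIV. \<Sum>k\<in>UNIV. phi0 i j k * eps i j k a b c d) = - 6 * psi0 a b c d"
  by (subst phi0_contract[of "\<lambda>i j k. eps i j k a b c d"]) (rule eps_swap, rule eps_swap, simp only: psi0_eps)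

lemma phi0_phi0: "(\<Sum>b\<in>UNIV. \<Sum>c\<in>UNIV. phi0 i b c * phi0 j b c) = (if i = j then 6 else 0)"
proof -
  have "\<forall>i j. (\<Sum>b\<in>UNIV. \<Sum>c\<in>UNIV. phi0 i b c * phi0 j b c) = (if i = j then 6 else 0)"
    by (simp only: forall_7 sum_7[where f = "\<lambda>b. sum (F b) UNIV" for F] phi0_rows table_simps)
  then show ?thesis by blast
qed

section \<open>The action of gl(7) on 3-forms\<close>

definition act3 :: "tensor2 \<Rightarrow> tensor3 \<Rightarrow> tensor3" where
  "act3 M w a b c = (\<Sum>m\<in>UNIV. M m a * w m b c) + (\<Sum>m\<in>UNIV. M m b * w a m c) + (\<Sum>m\<in>UNIV. M m c * w a b m)"

definition alt3 :: "tensor3 \<Rightarrow> bool" where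
  "alt3 w \<longleftrightarrow> (\<forall>a b c. w b a c = - w a b c \<and> w a c b = - w a b c)"

lemma alt3D: "alt3 w \<Longrightarrow> w b a c = - w a b c" "alt3 w \<Longrightarrow> w a c b = - w a b c"
  unfolding alt3_def by blast+

lemma alt3_phi0: "alt3 phi0"
  unfolding alt3_def using phi0_swap by blast

lemma alt3_act3: "alt3 w \<Longrightarrow> alt3 (act3 M w)"
proof -
  assume w: "alt3 w"
  have s1: "w b a c = - w a b c" and s2: "w a c b = - w a b c" for a b c by (rule alt3D[OF w])+
  have "act3 M w b a c = - act3 M w a b c" for a b c
    unfolding act3_def s1[of a _ c] s1[of _ b c] s1[of a b] mult_minus_right sum_negf by argo
  moreover have "act3 M w a c b = - act3 M w a b c" for a b c
    unfolding act3_def s2[of a b] s2[of _ b c] s2[of a _ c] mult_minus_right sum_negf by argo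
  ultimately show ?thesis unfolding alt3_def by blast
qed

text \<open>The coefficients of \<open>M\<close> invert \<open>M \<mapsto> act3 M phi0\<close> separately on the trace part, the traceless symmetric
  part and the 7-dimensional part of $\mathfrak{gl}(7)/\mathfrak{g}_2\cong\Lambda^3$.\<close>

lemma act3_phi0_surj:
  assumes h: "alt3 h"
  shows "\<exists>M. h = act3 M phi0"
proof -
  define P where "P i j = (\<Sum>a\<in>UNIV. \<Sum>b\<in>UNIV. phi0 j a b * h i a b)" for i j
  define M where "M m a = P m a / 12 + P a m / 6 - (if m = a then P 1 1 + P 2 2 + P 3 3 + P 4 4 + P 5 5 + P 6 6 + P 7 7 else 0) / 36" for m a
  have s1: "a < b \<Longrightarrow> h b a c = - h a b c" and s2: "a < b \<Longrightarrow> h c b a = - h c a b" for a b c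
    by (rule alt3D[OF h])+
  have d1: "h a a c = 0" for a c using alt3D(1)[OF h, of a a c] by linarith
  have d2: "h c a a = 0" for a c using alt3D(2)[OF h, of c a a] by linarith
  let ?F = "\<lambda>a b c. h a b c - act3 M phi0 a b c"
  have z: "\<forall>a b c. a < b \<longrightarrow> b < c \<longrightarrow> ?F a b c = 0"
    apply (simp only: forall_7 less_7 simp_thms act3_def sum_7[where f="\<lambda>m. M m i * F m" for i F] phi0_rows table_simps mult_zero_right)
    apply (simp only: M_def P_def neq_7 sum_7[where f="\<lambda>m. sum (F m) UNIV" for F] phi0_rows table_simps less_7 s1 s2 d1 d2)
    apply (simp add: field_simps)
    done
  have "h a b c = act3 M phi0 a b c" for a b c
  proof -
    note k = alt3D[OF alt3_act3[OF alt3_phi0], of M]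
    have "?F a b c = 0"
    proof (rule alternating3_zero[of ?F])
      show "?F b a c = - ?F a b c" for a b c
        by (simp only: k(1)[of b a c] alt3D(1)[OF h, of b a c])
      show "?F a c b = - ?F a b c" for a b c
        by (simp only: k(2)[of a c b] alt3D(2)[OF h, of a c b])
    qed (use z in blast)
    then show ?thesis by linarith
  qed
  then show ?thesis by blast
qed

text \<open>In so(7) = g_2 + R^7 the first summand annihilates \<open>phi0\<close>, so only the R^7
  part of \<open>M\<close>, its contraction with \<open>phi0\<close>, can enter. The identity itself
  is checked on increasing triples.\<close>

lemma act3_phi0_skew:
  assumes M: "\<And>a b. M b a = - M a b"
  shows "act3 M phi0 a b c = (1/2) * (\<Sum>n\<in>UNIV. (\<Sum>i\<in>UNIV. \<Sum>j\<in>UNIV. phi0 n i j * M i j) * psi0 n a b c)"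
proof -
  have s: "a < b \<Longrightarrow> M b a = - M a b" for a b by (rule M)
  have d: "M a a = 0" for a using M[of a a] by linarith
  define X where "X n = (\<Sum>i\<in>UNIV. \<Sum>j\<in>UNIV. phi0 n i j * M i j)" for n
  let ?F = "\<lambda>a b c. 2 * act3 M phi0 a b c - (\<Sum>n\<in>UNIV. X n * psi0 n a b c)"
  have z: "\<forall>a b c. a < b \<longrightarrow> b < c \<longrightarrow> ?F a b c = 0"
    apply (simp only: forall_7 less_7 simp_thms act3_def sum_7[where f="\<lambda>m. F m * G m" for F G] psi0_def phi0_rows table_simps mult_zero_right)
    apply (simp only: X_def neq_7 sum_7[where f="\<lambda>m. sum (F m) UNIV" for F] phi0_rows table_simps less_7 s d)
    apply (simp add: field_simps)
    done
  have "?F a b c = 0"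
  proof (rule alternating3_zero[of ?F])
    note k = alt3D[OF alt3_act3[OF alt3_phi0], of M]
    show "?F b a c = - ?F a b c" for a b c
      by (simp only: k(1)[of b a c] psi0_swap(2)[of _ b a] mult_minus_right sum_negf)
    show "?F a c b = - ?F a b c" for a b c
      by (simp only: k(2)[of a c b] psi0_swap(3)[of _ a c b] mult_minus_right sum_negf)
  qed (use z in blast)
  then show ?thesis unfolding X_def by linarith
qed

section \<open>Pullback and derivation as operators in single slots\<close>

definition op1 :: "tensor2 \<Rightarrow> tensor3 \<Rightarrow> tensor3" where "op1 A w a b c = (\<Sum>d\<in>UNIV. A d a * w d b c)"
definition op2 :: "tensor2 \<Rightarrow> tensor3 \<Rightarrow> tensor3" where "op2 A w a b c = (\<Sum>d\<in>UNIV. A d b * w a d c)"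
definition op3 :: "tensor2 \<Rightarrow> tensor3 \<Rightarrow> tensor3" where "op3 A w a b c = (\<Sum>d\<in>UNIV. A d c * w a b d)"

definition mcomp :: "tensor2 \<Rightarrow> tensor2 \<Rightarrow> tensor2" where "mcomp A B i j = (\<Sum>d\<in>UNIV. A i d * B d j)"

definition pullback3 :: "real^7^7 \<Rightarrow> tensor3 \<Rightarrow> tensor3" where
  "pullback3 L w = op1 (\<lambda>i j. L $ i $ j) (op2 (\<lambda>i j. L $ i $ j) (op3 (\<lambda>i j. L $ i $ j) w))"

lemma sum_swap_mult:
  fixes A B :: "7 \<Rightarrow> real"
  shows "(\<Sum>d\<in>UNIV. A d * (\<Sum>e\<in>UNIV. B e * F d e)) = (\<Sum>e\<in>UNIV. B e * (\<Sum>d\<in>UNIV. A d * F d e))"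
  unfolding sum_distrib_left by (subst sum.swap) (simp only: mult.left_commute)

lemma sum_mcomp:
  fixes A :: "7 \<Rightarrow> real"
  shows "(\<Sum>d\<in>UNIV. A d * (\<Sum>e\<in>UNIV. B e d * F e)) = (\<Sum>e\<in>UNIV. (\<Sum>d\<in>UNIV. B e d * A d) * F e)"
  unfolding sum_distrib_left sum_distrib_right by (subst sum.swap) (simp only: ac_simps)

text \<open>Together with \<open>op_comp\<close>, where operators in one slot compose
  contravariantly, this lets pullbacks, derivations and commutators be computed without index
  sums.\<close>

lemma op_commute:
  "op2 B (op1 A w) = op1 A (op2 B w)" "op3 B (op1 A w) = op1 A (op3 B w)" "op3 B (op2 A w) = op2 A (op3 B w)"
  unfolding op1_def op2_def op3_def fun_eq_iff by (intro allI, rule sum_swap_mult)+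

lemma op_comp:
  "op1 A (op1 B w) = op1 (mcomp B A) w" "op2 A (op2 B w) = op2 (mcomp B A) w" "op3 A (op3 B w) = op3 (mcomp B A) w"
  unfolding op1_def op2_def op3_def fun_eq_iff mcomp_def by (simp_all only: sum_mcomp simp_thms)

lemma op_add:
  "op1 A (\<lambda>a b c. u a b c + v a b c) = (\<lambda>a b c. op1 A u a b c + op1 A v a b c)"
  "op2 A (\<lambda>a b c. u a b c + v a b c) = (\<lambda>a b c. op2 A u a b c + op2 A v a b c)"
  "op3 A (\<lambda>a b c. u a b c + v a b c) = (\<lambda>a b c. op3 A u a b c + op3 A v a b c)"
  unfolding op1_def op2_def op3_def by (simp_all only: distrib_left sum.distrib)

lemma op_scale:
  "op1 A (\<lambda>a b c. r * v a b c) = (\<lambda>a b c. r * op1 A v a b c)"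
  "op2 A (\<lambda>a b c. r * v a b c) = (\<lambda>a b c. r * op2 A v a b c)"
  "op3 A (\<lambda>a b c. r * v a b c) = (\<lambda>a b c. r * op3 A v a b c)"
  unfolding op1_def op2_def op3_def by (simp_all only: sum_distrib_left mult.left_commute[of _ r])

lemma op_sum:
  fixes F :: "7 \<Rightarrow> tensor3"
  shows "op1 A (\<lambda>a b c. \<Sum>i\<in>UNIV. x i * F i a b c) = (\<lambda>a b c. \<Sum>i\<in>UNIV. x i * op1 A (F i) a b c)"
  "op2 A (\<lambda>a b c. \<Sum>i\<in>UNIV. x i * F i a b c) = (\<lambda>a b c. \<Sum>i\<in>UNIV. x i * op2 A (F i) a b c)"
  "op3 A (\<lambda>a b c. \<Sum>i\<in>UNIV. x i * F i a b c) = (\<lambda>a b c. \<Sum>i\<in>UNIV. x i * op3 A (F i) a b c)"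
  unfolding op1_def op2_def op3_def fun_eq_iff by (intro allI, rule sum_swap_mult)+

lemma mcomp_mat: "mcomp (\<lambda>i j. A $ i $ j) (\<lambda>i j. B $ i $ j) = (\<lambda>i j. ((A :: real^7^7) ** B) $ i $ j)"
  unfolding mcomp_def matrix_matrix_mult_def by simp

lemma pullback3_comp: "pullback3 L (pullback3 K w) = pullback3 (K ** L) w"
  unfolding pullback3_def by (simp only: op_commute op_comp mcomp_mat)

lemma op_mat1: "op1 (\<lambda>i j. (mat 1 :: real^7^7) $ i $ j) w = w" "op2 (\<lambda>i j. (mat 1 :: real^7^7) $ i $ j) w = w"
   "op3 (\<lambda>i j. (mat 1 :: real^7^7) $ i $ j) w = w"
  unfolding op1_def op2_def op3_def fun_eq_iff mat_def vec_lambda_beta if_mult_delta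
  by (simp_all only: sum.delta finite_class.finite_UNIV UNIV_I if_True mult_1_left simp_thms)

lemma pullback3_mat1: "pullback3 (mat 1) w = w"
  unfolding pullback3_def by (simp only: op_mat1)

lemma act3_op: "act3 M w = (\<lambda>a b c. op1 M w a b c + op2 M w a b c + op3 M w a b c)"
  unfolding act3_def op1_def op2_def op3_def by (rule refl)

text \<open>\<open>M\<close> acting after the pullback corresponds to N = L M L^-1 acting before it.
  Stated as L M = N L the relation involves no inverse.\<close>

lemma act3_pullback3:
  assumes "mcomp (\<lambda>i j. L $ i $ j) M = mcomp N (\<lambda>i j. L $ i $ j)"
  shows "act3 M (pullback3 L w) = pullback3 L (act3 N w)"
  unfolding act3_op pullback3_def by (simp only: op_add op_commute op_comp assms)

lemma op_diff_left:
  "op1 (\<lambda>i j. A i j - B i j) w = (\<lambda>a b c. op1 A w a b c - op1 B w a b c)"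
  "op2 (\<lambda>i j. A i j - B i j) w = (\<lambda>a b c. op2 A w a b c - op2 B w a b c)"
  "op3 (\<lambda>i j. A i j - B i j) w = (\<lambda>a b c. op3 A w a b c - op3 B w a b c)"
  unfolding op1_def op2_def op3_def by (simp_all only: left_diff_distrib sum_subtractf)

text \<open>Terms that act in two different slots cancel. Since pullback reverses products, the
  bracket appears as N M - M N.\<close>

lemma act3_commutator:
  "act3 M (act3 N w) a b c - act3 N (act3 M w) a b c = act3 (\<lambda>i j. mcomp N M i j - mcomp M N i j) w a b c"
  unfolding act3_op by (simp only: op_add op_commute op_comp op_diff_left)

definition pair3 :: "tensor3 \<Rightarrow> tensor3 \<Rightarrow> real" where
  "pair3 u v = (\<Sum>a\<in>UNIV. \<Sum>b\<in>UNIV. \<Sum>c\<in>UNIV. u a b c * v a b c)"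

lemma pair_adjoint:
  fixes A :: tensor2
  shows "(\<Sum>a\<in>UNIV. (\<Sum>d\<in>UNIV. A d a * u d) * v a) = (\<Sum>d\<in>UNIV. u d * (\<Sum>a\<in>UNIV. A d a * v a))"
  unfolding sum_distrib_left sum_distrib_right by (subst sum.swap) (simp only: ac_simps)

lemma pair3_adjoint:
  "pair3 (op1 A u) v = pair3 u (op1 (\<lambda>i j. A j i) v)"
  "pair3 (op2 A u) v = pair3 u (op2 (\<lambda>i j. A j i) v)"
  "pair3 (op3 A u) v = pair3 u (op3 (\<lambda>i j. A j i) v)"
proof -
  have sw: "(\<Sum>a\<in>UNIV. \<Sum>b\<in>UNIV. \<Sum>c\<in>UNIV. F a b c) = (\<Sum>b\<in>UNIV. \<Sum>c\<in>UNIV. \<Sum>a\<in>UNIV. F a b c)" for F :: tensor3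
    by (subst sum.swap) (rule sum.cong[OF refl], rule sum.swap)
  have sw2: "(\<Sum>b\<in>UNIV. \<Sum>c\<in>UNIV. G b c) = (\<Sum>c\<in>UNIV. \<Sum>b\<in>UNIV. G b c)" for G :: tensor2
    by (rule sum.swap)
  show "pair3 (op1 A u) v = pair3 u (op1 (\<lambda>i j. A j i) v)"
    unfolding pair3_def op1_def sw[of "\<lambda>a b c. _ a b c * v a b c"] sw[of "\<lambda>a b c. u a b c * _ a b c"]
    by (simp only: pair_adjoint)
  show "pair3 (op2 A u) v = pair3 u (op2 (\<lambda>i j. A j i) v)"
    unfolding pair3_def op2_def by (rule sum.cong[OF refl], rule trans[OF sw2], rule trans[OF _ sw2]) (simp only: pair_adjoint)
  show "pair3 (op3 A u) v = pair3 u (op3 (\<lambda>i j. A j i) v)"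
    unfolding pair3_def op3_def by (simp only: pair_adjoint)
qed

lemma pair3_pullback3: "pair3 (pullback3 A u) v = pair3 u (pullback3 (transpose A) v)"
  unfolding pullback3_def pair3_adjoint op_commute transpose_def vec_lambda_beta by (rule refl)

lemma sum_swap4:
  fixes G :: "7 \<Rightarrow> tensor3"
  shows "(\<Sum>a\<in>UNIV. \<Sum>b\<in>UNIV. \<Sum>c\<in>UNIV. \<Sum>i\<in>UNIV. G i a b c) = (\<Sum>i\<in>UNIV. \<Sum>a\<in>UNIV. \<Sum>b\<in>UNIV. \<Sum>c\<in>UNIV. G i a b c)"
proof -
  have "(\<Sum>a\<in>UNIV. \<Sum>b\<in>UNIV. \<Sum>c\<in>UNIV. \<Sum>i\<in>UNIV. G i a b c) = (\<Sum>a\<in>UNIV. \<Sum>b\<in>UNIV. \<Sum>i\<in>UNIV. \<Sum>c\<in>UNIV. G i a b c)"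
    by (rule sum.cong[OF refl], rule sum.cong[OF refl], rule sum.swap)
  also have "\<dots> = (\<Sum>a\<in>UNIV. \<Sum>i\<in>UNIV. \<Sum>b\<in>UNIV. \<Sum>c\<in>UNIV. G i a b c)"
    by (rule sum.cong[OF refl], rule sum.swap)
  also have "\<dots> = (\<Sum>i\<in>UNIV. \<Sum>a\<in>UNIV. \<Sum>b\<in>UNIV. \<Sum>c\<in>UNIV. G i a b c)"
    by (rule sum.swap)
  finally show ?thesis .
qed

lemma pair3_sum:
  fixes F :: "7 \<Rightarrow> tensor3"
  shows "pair3 (\<lambda>a b c. \<Sum>i\<in>UNIV. x i * F i a b c) v = (\<Sum>i\<in>UNIV. x i * pair3 (F i) v)"
    "pair3 v (\<lambda>a b c. \<Sum>i\<in>UNIV. x i * F i a b c) = (\<Sum>i\<in>UNIV. x i * pair3 v (F i))"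
proof -
  show *: "pair3 (\<lambda>a b c. \<Sum>i\<in>UNIV. x i * F i a b c) v = (\<Sum>i\<in>UNIV. x i * pair3 (F i) v)" for v
    unfolding pair3_def sum_distrib_left sum_distrib_right by (subst sum_swap4) (simp only: mult.assoc)
  have c: "pair3 v w = pair3 w v" for v w unfolding pair3_def by (simp only: mult.commute)
  show "pair3 v (\<lambda>a b c. \<Sum>i\<in>UNIV. x i * F i a b c) = (\<Sum>i\<in>UNIV. x i * pair3 v (F i))"
    unfolding c[of v] by (rule *)
qed

section \<open>Metric and volume form of a 3-form\<close>

lemma pullback3_sums:
  "pullback3 L w a b c = (\<Sum>d\<in>UNIV. L $ d $ a * (\<Sum>e\<in>UNIV. L $ e $ b * (\<Sum>f\<in>UNIV. L $ f $ c * w d e f)))"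
  unfolding pullback3_def op1_def op2_def op3_def by (rule refl)

definition pullback2 :: "real^7^7 \<Rightarrow> tensor2 \<Rightarrow> tensor2" where
  "pullback2 L s a b = (\<Sum>d\<in>UNIV. L $ d $ a * (\<Sum>e\<in>UNIV. L $ e $ b * s d e))"

text \<open>The sum runs over all index maps, \<open>levi_civita\<close> being zero off the
  permutations, so that it can be exchanged with the expansions given by
  \<open>sum_fun7\<close>.\<close>

definition wedge_sum :: "tensor2 \<Rightarrow> tensor2 \<Rightarrow> tensor3 \<Rightarrow> real" where
  "wedge_sum s t w = (\<Sum>p\<in>UNIV. levi_civita p * (s (p 1) (p 2) * (t (p 3) (p 4) * w (p 5) (p 6) (p 7))))"

lemma wedge223_eq: "wedge223 s t w = (1/24) * wedge_sum s t w"
proof -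
  have "wedge_sum s t w = (\<Sum>p | p permutes (UNIV :: 7 set). levi_civita p * (s (p 1) (p 2) * (t (p 3) (p 4) * w (p 5) (p 6) (p 7))))"
    unfolding wedge_sum_def by (rule sum.mono_neutral_right) (auto simp: levi_civita_def)
  also have "\<dots> = (\<Sum>p | p permutes (UNIV :: 7 set). of_int (sign p) * s (p 1) (p 2) * t (p 3) (p 4) * w (p 5) (p 6) (p 7))"
    by (rule sum.cong) (auto simp: levi_civita_def)
  finally show ?thesis unfolding wedge223_def by (simp only:)
qed

text \<open>A form of top degree is multiplied by det L under pullback. Expanding all factors over
  index maps \<open>f\<close> and summing over \<open>p\<close> leaves the sum in
  \<open>det_rows\<close>.\<close>

lemma wedge_sum_pullback:
  "wedge_sum (pullback2 L s) (pullback2 L t) (pullback3 L w) = det L * wedge_sum s t w"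
proof -
  let ?F = "\<lambda>f. s (f 1) (f 2) * (t (f 3) (f 4) * w (f 5) (f 6) (f (7::7)))"
  have prod: "pullback2 L s (p 1) (p 2) * (pullback2 L t (p 3) (p 4) * pullback3 L w (p 5) (p 6) (p 7)) =
      (\<Sum>f\<in>UNIV. (\<Prod>r\<in>UNIV. L $ f r $ p r) * ?F f)" for p :: "7 \<Rightarrow> 7"
  proof -
    let ?X = "\<lambda>i j. L $ i $ p 1 * (L $ j $ p 2 * s i j)"
    let ?Y = "\<lambda>i j. L $ i $ p 3 * (L $ j $ p 4 * t i j)"
    let ?Z = "\<lambda>i j k. L $ i $ p 5 * (L $ j $ p 6 * (L $ k $ p 7 * w i j k))"
    have "(\<Sum>f\<in>UNIV. (\<Prod>r\<in>UNIV. L $ f r $ p r) * ?F f) =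
      (\<Sum>i\<in>UNIV. \<Sum>j\<in>UNIV. \<Sum>k\<in>UNIV. \<Sum>a\<in>UNIV. \<Sum>b\<in>UNIV. \<Sum>c\<in>UNIV. \<Sum>d\<in>UNIV. ?X i j * (?Y k a * ?Z b c d))"
      unfolding sum_fun7 prod_7 args7_simps by (simp only: ac_simps)
    also have "\<dots> = (\<Sum>i\<in>UNIV. \<Sum>j\<in>UNIV. ?X i j) * ((\<Sum>i\<in>UNIV. \<Sum>j\<in>UNIV. ?Y i j) * (\<Sum>i\<in>UNIV. \<Sum>j\<in>UNIV. \<Sum>k\<in>UNIV. ?Z i j k))"
      by (simp only: sum_distrib_left[symmetric] sum_distrib_right[symmetric])
    finally show ?thesis
      unfolding pullback2_def pullback3_sums sum_distrib_left by (simp only:)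
  qed
  have "wedge_sum (pullback2 L s) (pullback2 L t) (pullback3 L w) =
      (\<Sum>p\<in>UNIV. \<Sum>f\<in>UNIV. ?F f * (levi_civita p * (\<Prod>r\<in>UNIV. L $ f r $ p r)))"
    unfolding wedge_sum_def prod sum_distrib_left by (simp only: ac_simps)
  also have "\<dots> = (\<Sum>f\<in>UNIV. ?F f * (det L * levi_civita f))"
    by (subst sum.swap) (simp only: sum_distrib_left[symmetric] det_rows)
  also have "\<dots> = det L * wedge_sum s t w"
    unfolding wedge_sum_def sum_distrib_left by (simp only: ac_simps)
  finally show ?thesis .
qed

text \<open>Known as Hitchin's form: the bilinear form with values in 7-forms that sends u and v to
  the wedge product of the contractions of \<open>w\<close> by u and by v with \<open>w\<close>
  itself.\<close>

definition hitchin :: "tensor3 \<Rightarrow> tensor2" where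
  "hitchin w i j = (1/24) * wedge_sum (w i) (w j) w"

lemma wedge_sum_linear:
  "wedge_sum (\<lambda>a b. \<Sum>i\<in>UNIV. x i * s i a b) t w = (\<Sum>i\<in>(UNIV::7 set). x i * wedge_sum (s i) t w)"
  "wedge_sum s' (\<lambda>a b. \<Sum>i\<in>UNIV. x i * s i a b) w = (\<Sum>i\<in>(UNIV::7 set). x i * wedge_sum s' (s i) w)"
  unfolding wedge_sum_def sum_distrib_left sum_distrib_right
  by (subst sum.swap; simp only: ac_simps)+

lemma wedge223_interior3:
  "wedge223 (interior3 u w) (interior3 v w) w = (\<Sum>i\<in>UNIV. u $ i * (\<Sum>j\<in>UNIV. v $ j * hitchin w i j))"
proof -
  have i: "interior3 u w = (\<lambda>a b. \<Sum>i\<in>UNIV. u $ i * w i a b)" for u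
    by (simp only: interior3_def fun_eq_iff simp_thms)
  show ?thesis unfolding wedge223_eq hitchin_def i wedge_sum_linear
    by (simp only: sum_distrib_left mult.left_commute)
qed

lemma hitchin_pullback3: "hitchin (pullback3 L w) i j = det L * pullback2 L (hitchin w) i j"
proof -
  have p: "pullback3 L w i = (\<lambda>a b. \<Sum>d\<in>UNIV. L $ d $ i * pullback2 L (w d) a b)" for i
    by (simp only: pullback3_sums pullback2_def fun_eq_iff simp_thms)
  have "hitchin (pullback3 L w) i j = (1/24) * (\<Sum>d\<in>UNIV. L $ d $ i * (\<Sum>e\<in>UNIV. L $ e $ j *
     wedge_sum (pullback2 L (w d)) (pullback2 L (w e)) (pullback3 L w)))"
    unfolding hitchin_def by (simp only: p[of i] p[of j] wedge_sum_linear)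
  then show ?thesis
    unfolding wedge_sum_pullback pullback2_def hitchin_def by (simp only: sum_distrib_left mult.left_commute)
qed

lemma eps_sum: "wedge_sum s t w = (\<Sum>i\<in>UNIV. \<Sum>j\<in>UNIV. \<Sum>k\<in>UNIV. \<Sum>a\<in>UNIV. s i j * (t k a *
   (\<Sum>b\<in>UNIV. \<Sum>c\<in>UNIV. \<Sum>d\<in>UNIV. w b c d * eps i j k a b c d)))"
  unfolding wedge_sum_def sum_fun7 args7_simps eps_def[symmetric] sum_distrib_left by (simp only: ac_simps)

text \<open>Moving three indices past four takes twelve transpositions.\<close>

lemma eps_rotate: "eps a b c d i j k = eps i j k a b c d"
proof -
  have "eps a b c d i j k = eps i a b c d j k" for a b c d i j k
    using eps_swap(4)[of a b c i d j k] eps_swap(3)[of a b i c d j k] eps_swap(2)[of a i b c d j k] eps_swap(1)[of i a b c d j k] by linarith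
  moreover have "eps i a b c d j k = eps i j a b c d k" for a b c d i j k
    using eps_swap(5)[of i a b c j d k] eps_swap(4)[of i a b j c d k] eps_swap(3)[of i a j b c d k] eps_swap(2)[of i j a b c d k] by linarith
  moreover have "eps i j a b c d k = eps i j k a b c d" for a b c d i j k
    using eps_swap(6)[of i j a b c k d] eps_swap(5)[of i j a b k c d] eps_swap(4)[of i j a k b c d] eps_swap(3)[of i j k a b c d] by linarith
  ultimately show ?thesis by (simp only:)
qed

lemma phi0_psi0: "(\<Sum>c\<in>UNIV. \<Sum>d\<in>UNIV. phi0 j c d * psi0 a b c d) = - 4 * phi0 j a b"
proof -
  have "\<forall>j a b. (\<Sum>c\<in>UNIV. \<Sum>d\<in>UNIV. phi0 j c d * psi0 a b c d) = - 4 * phi0 j a b"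
    by (simp only: forall_7 sum_7[where f = "\<lambda>b. sum (F b) UNIV" for F] phi0_rows psi0_def table_simps mult_zero_right) simp
  then show ?thesis by blast
qed

text \<open>The factors are 1/24 from the wedge product, -6 from \<open>phi0_eps\<close>, -4 from
  \<open>phi0_psi0\<close> and 6 from \<open>phi0_phi0\<close>. Under B = -6 g \<nu> the value
  corresponds to the Euclidean metric and \<nu> = -1.\<close>

lemma hitchin_phi0: "hitchin phi0 i j = (if i = j then 6 else 0)"
proof -
  have e: "(\<Sum>b\<in>UNIV. \<Sum>c\<in>UNIV. \<Sum>d\<in>UNIV. phi0 b c d * eps i j k a b c d) = - 6 * psi0 i j k a" for i j k a
    unfolding phi0_eps[symmetric] by (intro sum.cong refl arg_cong2[where f = times] eps_rotate)
  have "hitchin phi0 i j = (1/24) * (\<Sum>a\<in>UNIV. \<Sum>b\<in>UNIV. phi0 i a b * (\<Sum>c\<in>UNIV. \<Sum>d\<in>UNIV. phi0 j c d * (- 6 * psi0 a b c d)))"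
    unfolding hitchin_def eps_sum e sum_distrib_left by (simp only: ac_simps)
  also have "\<dots> = (\<Sum>a\<in>UNIV. \<Sum>b\<in>UNIV. phi0 i a b * phi0 j a b)"
  proof -
    have "(\<Sum>c\<in>UNIV. \<Sum>d\<in>UNIV. phi0 j c d * (- 6 * psi0 a b c d)) = 24 * phi0 j a b" for a b
      unfolding mult.left_commute[of _ "- 6"] sum_distrib_left[symmetric] phi0_psi0 by (simp only: mult.assoc[symmetric])
    then show ?thesis by (simp only: sum_distrib_left) simp
  qed
  finally show ?thesis unfolding phi0_phi0 .
qed


text \<open>The seven slots are split as three and four: the first three are to be moved across
  \<open>pair3\<close> as an adjoint, while the last four become the slots of the dual form.\<close>

lemma eps_pullback:
  "det L * eps i j k a b c d = pullback3 L (\<lambda>i j k. \<Sum>a'\<in>UNIV. L $ a' $ a * (\<Sum>b'\<in>UNIV. L $ b' $ b *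
     (\<Sum>c'\<in>UNIV. L $ c' $ c * (\<Sum>d'\<in>UNIV. L $ d' $ d * eps i j k a' b' c' d')))) i j k"
proof -
  have "det L * eps i j k a b c d = (\<Sum>p\<in>UNIV. levi_civita p * (\<Prod>r\<in>UNIV. L $ p r $ args7 i j k a b c d r))"
    unfolding eps_def det_columns by (rule refl)
  then show ?thesis
    unfolding pullback3_sums sum_fun7 prod_7 args7_simps eps_def[symmetric] sum_distrib_left
    by (simp only: ac_simps)
qed

text \<open>The Hodge star with \<open>G\<close> in the role of the inverse metric, raising indices,
  and \<open>\<nu>\<close> in that of the volume coefficient. As parameters they allow the
  transformation law to be proved before they are computed from \<open>w\<close>.\<close>

definition star4 :: "real^7^7 \<Rightarrow> real \<Rightarrow> tensor3 \<Rightarrow> tensor4" where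
  "star4 G \<nu> w a b c d = (1/6) * (\<nu> * pair3 (pullback3 G w) (\<lambda>i j k. eps i j k a b c d))"

text \<open>Raising the indices of the pulled-back form gives the pullback of the raised form by the
  transpose of \<open>K\<close>. Its adjoint cancels three of the seven factors \<open>L\<close> in
  \<open>eps_pullback\<close>; the other four remain.\<close>

lemma star4_pullback:
  assumes "L ** K = mat 1" and "G' = K ** (G ** transpose K)"
  shows "star4 G' (det L * \<nu>) (pullback3 L w) a b c d =
    (\<Sum>n\<in>UNIV. L $ n $ a * pullback3 L (star4 G \<nu> w n) b c d)"
proof -
  let ?U = "pullback3 G w"
  let ?V = "\<lambda>i j k. \<Sum>a'\<in>UNIV. L $ a' $ a * (\<Sum>b'\<in>UNIV. L $ b' $ b *
     (\<Sum>c'\<in>UNIV. L $ c' $ c * (\<Sum>d'\<in>UNIV. L $ d' $ d * eps i j k a' b' c' d')))"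
  have "L ** G' = G ** transpose K"
    unfolding assms(2) by (simp only: matrix_mul_assoc assms(1) matrix_mul_lid)
  then have U: "pullback3 G' (pullback3 L w) = pullback3 (transpose K) ?U"
    by (simp only: pullback3_comp)
  have "star4 G' (det L * \<nu>) (pullback3 L w) a b c d =
     (1/6) * (\<nu> * pair3 (pullback3 (transpose K) ?U) (\<lambda>i j k. det L * eps i j k a b c d))"
    unfolding star4_def U pair3_def sum_distrib_left by (simp only: ac_simps)
  also have "(\<lambda>i j k. det L * eps i j k a b c d) = pullback3 L ?V"
    by (simp only: fun_eq_iff eps_pullback simp_thms)
  also have "pair3 (pullback3 (transpose K) ?U) (pullback3 L ?V) = pair3 ?U ?V"
    by (subst pair3_pullback3) (simp only: transpose_transpose pullback3_comp[of K L] assms(1) pullback3_mat1)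
  also have "pair3 ?U ?V = (\<Sum>a'\<in>UNIV. L $ a' $ a * (\<Sum>b'\<in>UNIV. L $ b' $ b * (\<Sum>c'\<in>UNIV. L $ c' $ c *
      (\<Sum>d'\<in>UNIV. L $ d' $ d * pair3 ?U (\<lambda>i j k. eps i j k a' b' c' d')))))"
    by (simp only: pair3_sum(2))
  finally have "star4 G' (det L * \<nu>) (pullback3 L w) a b c d = (1/6) * (\<nu> * \<dots>)" .
  then show ?thesis
    unfolding pullback3_sums[of L "star4 _ _ _ _"] star4_def[of G] sum_distrib_left by (simp only: ac_simps)
qed

lemma star4_phi0: "star4 (mat 1) (- 1) phi0 a b c d = psi0 a b c d"
  unfolding star4_def pullback3_mat1 pair3_def phi0_eps by simp

definition hitchin_matrix :: "tensor3 \<Rightarrow> real^7^7" where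
  "hitchin_matrix w = (\<chi> i j. hitchin w i j)"

text \<open>The relations $B_{ij}=-6g_{ij}\nu$ and $\nu^2=\det g$ give $\det B=(-6)^7\nu^9$, and $(-6)^7=-279936$.\<close>

definition nu_expr :: "tensor3 \<Rightarrow> real" where
  "nu_expr w = root 9 (det (hitchin_matrix w) / (- 279936))"

definition g_expr :: "tensor3 \<Rightarrow> real^7^7" where
  "g_expr w = (1 / (- 6 * nu_expr w)) *\<^sub>R hitchin_matrix w"

lemma pullback2_matrix: "(\<chi> i j. pullback2 L (\<lambda>i j. B $ i $ j) i j) = transpose L ** (B ** L)"
  unfolding pullback2_def matrix_matrix_mult_def transpose_def vec_eq_iff vec_lambda_beta
  by (simp only: mult.commute simp_thms)

lemma det_scaleR7: "det (c *\<^sub>R (B :: real^7^7)) = c ^ 7 * det B"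
proof -
  have "c *\<^sub>R B = (\<chi> i. c *s B $ i)" by (simp add: vec_eq_iff)
  then show ?thesis using det_rows_mul[of "\<lambda>_. c" "\<lambda>i. B $ i"] by (simp add: vec_lambda_eta)
qed

lemma hitchin_matrix_pullback3:
  "hitchin_matrix (pullback3 L w) = det L *\<^sub>R (transpose L ** (hitchin_matrix w ** L))"
proof -
  have "transpose L ** (hitchin_matrix w ** L) = (\<chi> i j. pullback2 L (hitchin w) i j)"
    unfolding pullback2_matrix[symmetric] hitchin_matrix_def vec_lambda_beta by (rule refl)
  then show ?thesis
    by (simp only: hitchin_matrix_def hitchin_pullback3 vec_eq_iff vector_scaleR_component vec_lambda_beta real_scaleR_def simp_thms)
qed

text \<open>B takes values in 7-forms, so det B scales by 7 + 2 powers of det L; the odd root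
  returns det L with its sign.\<close>

lemma nu_expr_pullback3: "nu_expr (pullback3 L w) = det L * nu_expr w"
proof -
  have "det (hitchin_matrix (pullback3 L w)) = det L ^ 9 * det (hitchin_matrix w)"
    unfolding hitchin_matrix_pullback3 det_scaleR7 det_mul det_transpose by (simp add: eval_nat_numeral)
  then have "nu_expr (pullback3 L w) = root 9 (det L ^ 9 * (det (hitchin_matrix w) / (- 279936)))"
    unfolding nu_expr_def by (simp only: times_divide_eq_right)
  then show ?thesis
    by (simp only: real_root_mult nu_expr_def) (simp add: odd_real_root_power_cancel)
qed

lemma g_expr_pullback3:
  assumes "det L \<noteq> 0"
  shows "g_expr (pullback3 L w) = transpose L ** (g_expr w ** L)"
  unfolding g_expr_def hitchin_matrix_pullback3 nu_expr_pullback3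
proof -
  let ?M = "transpose L ** (hitchin_matrix w ** L)"
  have "(1 / (- 6 * (det L * nu_expr w))) *\<^sub>R (det L *\<^sub>R ?M) = (1 / (- 6 * nu_expr w)) *\<^sub>R ?M"
    using assms by simp
  also have "\<dots> = transpose L ** ((1 / (- 6 * nu_expr w)) *\<^sub>R hitchin_matrix w ** L)"
    by (simp only: scalar_matrix_assoc[symmetric] matrix_scalar_ac)
  finally show "(1 / (- 6 * (det L * nu_expr w))) *\<^sub>R (det L *\<^sub>R ?M) =
    transpose L ** ((1 / (- 6 * nu_expr w)) *\<^sub>R hitchin_matrix w ** L)" .
qed

text \<open>Positive definiteness gives det g nonzero, hence \<nu> nonzero. On basis vectors the
  defining relation reads B = -6 \<nu> g; its determinant -279936 \<nu>^9 fixes \<nu>, and then g is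
  fixed as well.\<close>

lemma metric_vol_unique:
  assumes "metric_vol w g \<nu>"
  shows "\<nu> = nu_expr w" "g = g_expr w" "\<nu> \<noteq> 0"
proof -
  have pos: "u \<noteq> 0 \<Longrightarrow> u \<bullet> (g *v u) > 0" for u
    using assms unfolding metric_vol_def by blast
  have dg: "\<nu>\<^sup>2 = det g" using assms unfolding metric_vol_def by blast
  have b: "wedge223 (interior3 u w) (interior3 v w) w = - 6 * (u \<bullet> (g *v v)) * \<nu>" for u v
    using assms unfolding metric_vol_def by blast
  have "\<forall>x. g *v x = 0 \<longrightarrow> x = 0" using pos by force
  then have "invertible g" using invertible_left_inverse matrix_left_invertible_ker by blast
  then have "det g \<noteq> 0" by (simp add: invertible_det_nz)
  then show nz: "\<nu> \<noteq> 0" using dg by auto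
  have h: "hitchin w i j = - 6 * \<nu> * g $ i $ j" for i j
  proof -
    have "(axis i 1 :: real^7) \<bullet> (g *v axis j 1) = g $ i $ j"
      by (simp add: inner_axis' matrix_vector_mult_basis column_def)
    moreover have "(\<Sum>k\<in>UNIV. (axis i 1 :: real^7) $ k * (\<Sum>l\<in>UNIV. (axis j 1 :: real^7) $ l * hitchin w k l)) = hitchin w i j"
      by (simp only: axis_def vec_lambda_beta if_mult_delta sum.delta finite_class.finite_UNIV UNIV_I if_True mult_1_left)
    ultimately show ?thesis using b[of "axis i 1" "axis j 1"] unfolding wedge223_interior3 by (simp add: ac_simps)
  qed
  then have hm: "hitchin_matrix w = (- 6 * \<nu>) *\<^sub>R g"
    by (simp add: hitchin_matrix_def vec_eq_iff)
  have "det (hitchin_matrix w) / (- 279936) = \<nu> ^ 9"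
    unfolding hm det_scaleR7 dg[symmetric] by (simp add: eval_nat_numeral)
  then show n: "\<nu> = nu_expr w" unfolding nu_expr_def by (simp add: odd_real_root_power_cancel)
  show "g = g_expr w" unfolding g_expr_def hm n[symmetric] using nz by simp
qed

text \<open>The metric is the pullback of the Euclidean one. The volume coefficient is - det L
  because that of \<open>phi0\<close> is -1.\<close>

lemma metric_vol_pullback_phi0:
  assumes "invertible L"
  shows "metric_vol (pullback3 L phi0) (transpose L ** L) (- det L)"
proof -
  have "hitchin_matrix phi0 = 6 *\<^sub>R mat 1"
    by (simp add: hitchin_matrix_def hitchin_phi0 vec_eq_iff mat_def)
  then have hm: "hitchin_matrix (pullback3 L phi0) = (6 * det L) *\<^sub>R (transpose L ** L)"
    unfolding hitchin_matrix_pullback3 by (simp add: scalar_matrix_assoc[symmetric] matrix_scalar_ac)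
  have pos: "u \<bullet> ((transpose L ** L) *v u) > 0" if "u \<noteq> 0" for u
  proof -
    have "L *v u \<noteq> 0" using assms that invertible_left_inverse matrix_left_invertible_ker by blast
    moreover have "u \<bullet> ((transpose L ** L) *v u) = (L *v u) \<bullet> (L *v u)"
      by (metis dot_lmul_matrix matrix_vector_mul_assoc vector_transpose_matrix)
    ultimately show ?thesis by simp
  qed
  have w: "wedge223 (interior3 u w) (interior3 v w) w = u \<bullet> (hitchin_matrix w *v v)" for u v w
    unfolding wedge223_interior3 inner_vec_def matrix_vector_mult_def hitchin_matrix_def vec_lambda_beta inner_real_def
    by (simp only: mult.commute)
  show ?thesis unfolding metric_vol_def w hm
    using pos by (simp add: matrix_transpose_mul det_mul det_transpose power2_eq_square scaleR_matrix_vector_assoc[symmetric])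
qed

section \<open>Contractions and cross-product matrices of the model form\<close>

lemma phi0_phi0_phi0: "(\<Sum>i\<in>UNIV. \<Sum>j\<in>UNIV. phi0 r i j * (\<Sum>p\<in>UNIV. phi0 n i p * phi0 k p j)) = 3 * phi0 n k r"
proof -
  have "\<forall>r n k. (\<Sum>i\<in>UNIV. \<Sum>j\<in>UNIV. phi0 r i j * (\<Sum>p\<in>UNIV. phi0 n i p * phi0 k p j)) = 3 * phi0 n k r"
    by (simp only: forall_7 sum_7[where f = "\<lambda>b. sum (F b) UNIV" for F] phi0_rows table_simps mult_zero_right) simp
  then show ?thesis by blast
qed

lemma psi0_repeated: "psi0 m a n a = 0" "psi0 m a a n = 0"
  using psi0_swap(3)[of m a a n] psi0_swap(2)[of m a a n] by linarith+

lemma if_conj: "(if P \<and> Q then x else y) = (if P then if Q then x else y else (y::real))"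
  by simp

lemma sum_delta7: "(\<Sum>i\<in>(UNIV::7 set). (if i = k then 1 else 0) * f i) = (f k :: real)" 
   "(\<Sum>i\<in>(UNIV::7 set). (if k = i then 1 else 0) * f i) = (f k :: real)"
  by (simp_all only: if_mult_delta sum.delta sum.delta' finite_class.finite_UNIV UNIV_I if_True mult_1_left)

text \<open>Expanding one factor by the definition of \<open>psi0\<close>, the delta terms meet a
  repeated index of the other factor and vanish. The remaining term gives 4 by
  \<open>phi0_psi0\<close> and 6 by \<open>phi0_phi0\<close>.\<close>

lemma psi0_psi0: "pair3 (psi0 m) (psi0 n) = (if m = n then 24 else 0)"
proof -
  have e: "(\<Sum>b\<in>UNIV. \<Sum>c\<in>UNIV. psi0 m a b c * psi0 n a b c) = 4 * (\<Sum>k\<in>UNIV. phi0 n a k * phi0 m a k)" for a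
  proof -
    have d: "psi0 n a b c = (if n = b then 1 else 0) * (if a = c then 1 else 0) - (if n = c then 1 else 0) * (if a = b then 1 else 0) -
        (\<Sum>k\<in>UNIV. phi0 n a k * phi0 k b c)" for b c
    proof -
      have "phi0 b c k = phi0 k b c" for k using phi0_swap(1)[of b k c] phi0_swap(2)[of b c k] by linarith
      then show ?thesis unfolding psi0_def by (simp only: if_mult_delta mult_1_left if_conj)
    qed
    have 1: "(\<Sum>b\<in>UNIV. \<Sum>c\<in>UNIV. psi0 m a b c * ((if n = b then 1 else 0) * (if a = c then 1 else 0))) = psi0 m a n a" for a
      by (simp only: mult.commute[of "psi0 _ _ _ _"] mult.assoc sum_distrib_left[symmetric] sum_delta7)
    have 2: "(\<Sum>b\<in>UNIV. \<Sum>c\<in>UNIV. psi0 m a b c * ((if n = c then 1 else 0) * (if a = b then 1 else 0))) = psi0 m a a n" for a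
      by (subst sum.swap) (simp only: mult.commute[of "psi0 _ _ _ _"] mult.assoc sum_distrib_left[symmetric] sum_delta7)
    have 3: "(\<Sum>b\<in>UNIV. \<Sum>c\<in>UNIV. psi0 m a b c * (\<Sum>k\<in>UNIV. phi0 n a k * phi0 k b c)) =
        (\<Sum>k\<in>UNIV. phi0 n a k * (\<Sum>b\<in>UNIV. \<Sum>c\<in>UNIV. phi0 k b c * psi0 m a b c))"
    proof -
      have "(\<Sum>b\<in>UNIV. \<Sum>c\<in>UNIV. psi0 m a b c * (\<Sum>k\<in>UNIV. phi0 n a k * phi0 k b c)) =
        (\<Sum>b\<in>UNIV. \<Sum>c\<in>UNIV. \<Sum>k\<in>UNIV. phi0 n a k * (phi0 k b c * psi0 m a b c))"
        unfolding sum_distrib_left by (simp only: ac_simps)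
      also have "\<dots> = (\<Sum>b\<in>UNIV. \<Sum>k\<in>UNIV. \<Sum>c\<in>UNIV. phi0 n a k * (phi0 k b c * psi0 m a b c))"
        by (rule sum.cong[OF refl], rule sum.swap)
      also have "\<dots> = (\<Sum>k\<in>UNIV. \<Sum>b\<in>UNIV. \<Sum>c\<in>UNIV. phi0 n a k * (phi0 k b c * psi0 m a b c))"
        by (rule sum.swap)
      finally show ?thesis unfolding sum_distrib_left .
    qed
    have cyc: "phi0 k m a = phi0 m a k" for k using phi0_swap(1)[of k m a] phi0_swap(2)[of m k a] by linarith
    show ?thesis
      unfolding d right_diff_distrib sum_subtractf 1 2 3 phi0_psi0 psi0_repeated
      by (simp only: cyc mult_minus_left mult_minus_right mult.left_commute[of _ "4"] sum_negf sum_distrib_left diff_0 minus_minus diff_self)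
  qed
  show ?thesis
    unfolding pair3_def e sum_distrib_left[symmetric] phi0_phi0 by (cases "m = n") simp_all
qed

text \<open>A skew matrix with prescribed R^7 part: contraction with \<open>phi0\<close> gives (1/3)
  * 6 = 2 times \<open>x\<close>, and the factor 1/2 in \<open>act3_phi0_skew\<close> leaves
  \<open>x\<close> itself.\<close>

definition cross_mat :: "(7 \<Rightarrow> real) \<Rightarrow> tensor2" where
  "cross_mat x m a = (1/3) * (\<Sum>n\<in>UNIV. x n * phi0 n m a)"

lemma cross_mat_skew: "cross_mat x b a = - cross_mat x a b"
  unfolding cross_mat_def phi0_swap(2)[of _ b a] by (simp only: sum_negf mult_minus_right)

lemma act3_cross_mat: "act3 (cross_mat x) phi0 a b c = (\<Sum>n\<in>UNIV. x n * psi0 n a b c)"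
proof -
  have "(\<Sum>i\<in>UNIV. \<Sum>j\<in>UNIV. phi0 n i j * cross_mat x i j) = 2 * x n" for n
  proof -
    have "(\<Sum>i\<in>UNIV. \<Sum>j\<in>UNIV. phi0 n i j * cross_mat x i j) =
        (\<Sum>i\<in>UNIV. \<Sum>j\<in>UNIV. \<Sum>k\<in>UNIV. (1/3) * (x k * (phi0 n i j * phi0 k i j)))"
      unfolding cross_mat_def sum_distrib_left by (simp only: ac_simps)
    also have "\<dots> = (\<Sum>i\<in>UNIV. \<Sum>k\<in>UNIV. \<Sum>j\<in>UNIV. (1/3) * (x k * (phi0 n i j * phi0 k i j)))"
      by (rule sum.cong[OF refl], rule sum.swap)
    also have "\<dots> = (\<Sum>k\<in>UNIV. \<Sum>i\<in>UNIV. \<Sum>j\<in>UNIV. (1/3) * (x k * (phi0 n i j * phi0 k i j)))"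
      by (rule sum.swap)
    also have "\<dots> = 2 * x n"
      unfolding sum_distrib_left[symmetric] phi0_phi0 by (simp add: if_distrib cong: if_cong)
    finally show ?thesis .
  qed
  then show ?thesis
    by (subst act3_phi0_skew[OF cross_mat_skew]) (simp only: sum_distrib_left mult.assoc, simp)
qed

text \<open>The complement R^7 of g_2 in so(7) is not a subalgebra; the R^7 part of a bracket is a
  multiple of the cross product. Each of the two orders contributes (1/9) * 3 by
  \<open>phi0_phi0_phi0\<close>, which adds up to 2/3.\<close>

lemma cross_mat_commutator:
  "(\<Sum>i\<in>UNIV. \<Sum>j\<in>UNIV. phi0 r i j * (mcomp (cross_mat y) (cross_mat x) i j - mcomp (cross_mat x) (cross_mat y) i j)) =
    - (2/3) * (\<Sum>s\<in>UNIV. \<Sum>t\<in>UNIV. x s * (y t * phi0 s t r))"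
proof -
  have *: "(\<Sum>i\<in>UNIV. \<Sum>j\<in>UNIV. phi0 r i j * mcomp (cross_mat y) (cross_mat x) i j) =
     (\<Sum>t\<in>UNIV. \<Sum>s\<in>UNIV. (1/3) * (y t * (x s * phi0 t s r)))" for x y
  proof -
    let ?F = "\<lambda>t s i j p. (1/9) * (y t * (x s * (phi0 r i j * (phi0 t i p * phi0 s p j))))"
    have "(\<Sum>i\<in>UNIV. \<Sum>j\<in>UNIV. phi0 r i j * mcomp (cross_mat y) (cross_mat x) i j) =
      (\<Sum>i\<in>UNIV. \<Sum>j\<in>UNIV. \<Sum>p\<in>UNIV. \<Sum>t\<in>UNIV. \<Sum>s\<in>UNIV. ?F t s i j p)"
    proof (rule sum.cong[OF refl], rule sum.cong[OF refl])
      fix i j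
      have "cross_mat y i p * cross_mat x p j = (1/9) * ((\<Sum>t\<in>UNIV. y t * phi0 t i p) * (\<Sum>s\<in>UNIV. x s * phi0 s p j))" for p
        unfolding cross_mat_def by simp
      then show "phi0 r i j * mcomp (cross_mat y) (cross_mat x) i j = (\<Sum>p\<in>UNIV. \<Sum>t\<in>UNIV. \<Sum>s\<in>UNIV. ?F t s i j p)"
        unfolding mcomp_def sum_product by (simp only: sum_distrib_left ac_simps)
    qed
    also have "\<dots> = (\<Sum>t\<in>UNIV. \<Sum>i\<in>UNIV. \<Sum>j\<in>UNIV. \<Sum>p\<in>UNIV. \<Sum>s\<in>UNIV. ?F t s i j p)"
      by (rule sum_swap4)
    also have "\<dots> = (\<Sum>t\<in>UNIV. \<Sum>s\<in>UNIV. \<Sum>i\<in>UNIV. \<Sum>j\<in>UNIV. \<Sum>p\<in>UNIV. ?F t s i j p)"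
      by (rule sum.cong[OF refl], rule sum_swap4)
    finally show ?thesis unfolding sum_distrib_left[symmetric] phi0_phi0_phi0
      by (simp only: mult.left_commute[of _ 3] sum_distrib_left[symmetric])
  qed
  have "(\<Sum>t\<in>UNIV. \<Sum>s\<in>UNIV. (1/3) * (y t * (x s * phi0 t s r))) = (\<Sum>s\<in>UNIV. \<Sum>t\<in>UNIV. (1/3) * (y t * (x s * phi0 t s r)))"
    by (rule sum.swap)
  also have "\<dots> = (\<Sum>s\<in>UNIV. \<Sum>t\<in>UNIV. - (1/3) * (x s * (y t * phi0 s t r)))"
  proof (intro sum.cong refl)
    show "(1/3) * (y t * (x s * phi0 t s r)) = - (1/3) * (x s * (y t * phi0 s t r))" for s t
      unfolding phi0_swap(1)[of t s] by simp
  qed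
  finally show ?thesis unfolding right_diff_distrib sum_subtractf *
    by (simp only: sum_distrib_left[symmetric])
qed

text \<open>The dual form with its first index raised, so that the torsion equation becomes
  \<nabla>_l \<phi> = T_lm \<open>Psi\<close>^m without an explicit inverse metric.\<close>

definition Psi :: "tensor3 \<Rightarrow> 7 \<Rightarrow> tensor3" where
  "Psi w m a b c = (\<Sum>n\<in>UNIV. matrix_inv (g_expr w) $ m $ n * star4 (transpose (matrix_inv (g_expr w))) (nu_expr w) w n a b c)"

definition dot :: "(7 \<Rightarrow> real) \<Rightarrow> (7 \<Rightarrow> tensor3) \<Rightarrow> tensor3" where
  "dot x P a b c = (\<Sum>m\<in>UNIV. x m * P m a b c)"

text \<open>The quadratic term of the identity, for two rows \<open>S\<close> and \<open>T\<close>
  of the torsion.\<close>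

definition raised_cross :: "tensor3 \<Rightarrow> (7 \<Rightarrow> real) \<Rightarrow> (7 \<Rightarrow> real) \<Rightarrow> 7 \<Rightarrow> real" where
  "raised_cross w S T l = (\<Sum>a\<in>UNIV. \<Sum>b\<in>UNIV. \<Sum>m\<in>UNIV. \<Sum>n\<in>UNIV.
     S a * T b * matrix_inv (g_expr w) $ a $ m * matrix_inv (g_expr w) $ b $ n * w m n l)"

text \<open>The curvature term of the identity: for M^k_a = R^k_ija the inner sum over
  \<open>k\<close> is R_ijab.\<close>

definition lowered_dual :: "tensor3 \<Rightarrow> tensor2 \<Rightarrow> 7 \<Rightarrow> real" where
  "lowered_dual w M l = (\<Sum>a\<in>UNIV. \<Sum>b\<in>UNIV. \<Sum>m\<in>UNIV. \<Sum>n\<in>UNIV.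
     (\<Sum>k\<in>UNIV. M k a * g_expr w $ k $ b) * matrix_inv (g_expr w) $ a $ m * matrix_inv (g_expr w) $ b $ n * w m n l)"

section \<open>Evaluation of the definite descriptions on G2-forms\<close>

lemma matrix_inv_eqI:
  fixes A B :: "real^'n^'n"
  assumes "A ** B = mat 1"
  shows "matrix_inv A = B"
proof -
  have "B ** A = mat 1" using assms matrix_left_right_inverse by blast
  then have "A ** B = mat 1 \<and> B ** A = mat 1" using assms by blast
  then have inv: "A ** matrix_inv A = mat 1 \<and> matrix_inv A ** A = mat 1"
    unfolding matrix_inv_def by (rule someI)
  have "matrix_inv A = matrix_inv A ** (A ** B)" by (simp only: assms matrix_mul_rid)
  also have "\<dots> = B" by (simp only: matrix_mul_assoc inv matrix_mul_lid)
  finally show ?thesis .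
qed

lemma G2_form_pullback3: "G2_form w \<longleftrightarrow> (\<exists>L. invertible L \<and> w = pullback3 L phi0)"
proof -
  have "pullback3 L phi0 a b c = (\<Sum>d\<in>UNIV. \<Sum>e\<in>UNIV. \<Sum>f\<in>UNIV. L$d$a * L$e$b * L$f$c * phi0 d e f)" for L a b c
    unfolding pullback3_sums sum_distrib_left by (simp only: mult.assoc)
  then show ?thesis unfolding G2_form_def fun_eq_iff by (simp only:)
qed

lemma metric_vol_G2:
  assumes "G2_form w"
  shows "metric_vol w (metric w) (vol w)"
proof -
  obtain L where "invertible L" "w = pullback3 L phi0" using assms unfolding G2_form_pullback3 by blast
  then obtain g \<nu> where g: "metric_vol w g \<nu>" using metric_vol_pullback_phi0 by blast
  have "metric w = g" unfolding metric_def
    using g metric_vol_unique[of w] by (intro the_equality) metis+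
  moreover have "vol w = \<nu>" unfolding vol_def
    using g metric_vol_unique[of w] by (intro the_equality) metis+
  ultimately show ?thesis using g by simp
qed

lemma metric_G2: "G2_form w \<Longrightarrow> metric w = g_expr w"
  by (rule metric_vol_unique(2)[OF metric_vol_G2])

lemma vol_G2: "G2_form w \<Longrightarrow> vol w = nu_expr w"
  by (rule metric_vol_unique(1)[OF metric_vol_G2])

lemma psi_G2: "G2_form w \<Longrightarrow> psi w a b c d = star4 (transpose (matrix_inv (g_expr w))) (nu_expr w) w a b c d"
proof -
  assume w: "G2_form w"
  have "(\<Sum>p\<in>UNIV. \<Sum>q\<in>UNIV. \<Sum>r\<in>UNIV. ginv w i p * ginv w j q * ginv w k r * w p q r) =
      pullback3 (transpose (matrix_inv (g_expr w))) w i j k" for i j k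
    unfolding pullback3_sums ginv_def metric_G2[OF w] transpose_def vec_lambda_beta sum_distrib_left by (simp only: mult.assoc)
  then show ?thesis
    unfolding psi_def star4_def pair3_def vol_comp_def vol_G2[OF w] args7_def[symmetric] eps_def[symmetric]
    by (simp only: sum_distrib_left mult.left_commute[of "nu_expr w"])
qed

lemma alt3_pullback3:
  assumes h: "alt3 h"
  shows "alt3 (pullback3 K h)"
  unfolding alt3_def
proof (intro allI conjI)
  fix a b c
  have s1: "h d e f = - h e d f" and s2: "h d e f = - h d f e" for d e f by (rule alt3D[OF h])+
  have "pullback3 K h b a c = (\<Sum>e\<in>UNIV. K $ e $ a * (\<Sum>d\<in>UNIV. K $ d $ b * (\<Sum>f\<in>UNIV. K $ f $ c * h d e f)))"
    unfolding pullback3_sums by (rule sum_swap_mult)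
  also have "\<dots> = (\<Sum>e\<in>UNIV. K $ e $ a * (\<Sum>d\<in>UNIV. K $ d $ b * (\<Sum>f\<in>UNIV. K $ f $ c * - h e d f)))"
    by (intro sum.cong refl arg_cong2[where f = times] s1)
  finally show "pullback3 K h b a c = - pullback3 K h a b c"
    unfolding pullback3_sums mult_minus_right sum_negf .
  have "pullback3 K h a c b = (\<Sum>d\<in>UNIV. K $ d $ a * (\<Sum>f\<in>UNIV. K $ f $ b * (\<Sum>e\<in>UNIV. K $ e $ c * h d e f)))"
    unfolding pullback3_sums by (simp only: sum_swap_mult[of "\<lambda>e. K $ e $ c" "\<lambda>f. K $ f $ b"])
  also have "\<dots> = (\<Sum>d\<in>UNIV. K $ d $ a * (\<Sum>f\<in>UNIV. K $ f $ b * (\<Sum>e\<in>UNIV. K $ e $ c * - h d f e)))"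
    by (intro sum.cong refl arg_cong2[where f = times] s2)
  finally show "pullback3 K h a c b = - pullback3 K h a b c"
    unfolding pullback3_sums mult_minus_right sum_negf .
qed

text \<open>The rows of \<open>L\<close> form an orthonormal coframe in which \<open>w\<close> has
  the components of \<open>phi0\<close>, and \<open>K\<close> is the dual frame. Pointwise
  identities for \<open>w\<close> are those of \<open>phi0\<close> transported by \<open>L\<close>
  and \<open>K\<close>.\<close>

locale G2_frame =
  fixes L K :: "real^7^7" and w :: tensor3
  assumes KL: "K ** L = mat 1" and LK: "L ** K = mat 1" and w: "w = pullback3 L phi0"
begin

lemma metric_vol_frame: "metric_vol w (transpose L ** L) (- det L)"
proof -
  have "invertible L" unfolding invertible_def using KL LK by blast
  then show ?thesis unfolding w by (rule metric_vol_pullback_phi0)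
qed

lemma g_frame: "g_expr w = transpose L ** L"
  by (rule metric_vol_unique(2)[OF metric_vol_frame, symmetric])

lemma nu_frame: "nu_expr w = det L * (- 1)"
  using metric_vol_unique(1)[OF metric_vol_frame] by linarith

lemma ginv_frame: "matrix_inv (g_expr w) = K ** transpose K"
proof (rule matrix_inv_eqI)
  have "transpose L ** transpose K = mat 1"
    using KL by (metis matrix_transpose_mul transpose_mat)
  moreover have "g_expr w ** (K ** transpose K) = transpose L ** ((L ** K) ** transpose K)"
    unfolding g_frame by (simp only: matrix_mul_assoc)
  ultimately show "g_expr w ** (K ** transpose K) = mat 1"
    by (simp only: LK matrix_mul_lid)
qed

lemma ginv_symmetric: "transpose (matrix_inv (g_expr w)) = matrix_inv (g_expr w)"
  unfolding ginv_frame matrix_transpose_mul transpose_transpose by (rule refl)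

lemma sum_KL: "(\<Sum>m\<in>UNIV. K $ m $ i * L $ j $ m) = (if i = j then 1 else 0)"
proof -
  have "(L ** K) $ j $ i = mat 1 $ j $ i" by (simp only: LK)
  then show ?thesis unfolding matrix_matrix_mult_def mat_def vec_lambda_beta mult.commute[of "L $ _ $ _"] eq_commute[of j i] .
qed

lemma sum_LK: "(\<Sum>m\<in>UNIV. L $ m $ i * K $ j $ m) = (if i = j then 1 else 0)"
proof -
  have "(K ** L) $ j $ i = mat 1 $ j $ i" by (simp only: KL)
  then show ?thesis unfolding matrix_matrix_mult_def mat_def vec_lambda_beta mult.commute[of "K $ _ $ _"] eq_commute[of j i] .
qed

lemma star_frame: "star4 (transpose (matrix_inv (g_expr w))) (nu_expr w) w n a b c = (\<Sum>r\<in>UNIV. L $ r $ n * pullback3 L (psi0 r) a b c)"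
proof -
  have "matrix_inv (g_expr w) = K ** (mat 1 ** transpose K)" unfolding ginv_frame by (simp only: matrix_mul_lid)
  from star4_pullback[OF LK this, of "- 1" phi0] show ?thesis
    unfolding ginv_symmetric nu_frame w[symmetric] by (simp only: star4_phi0 fun_eq_iff) (simp only: star4_phi0[abs_def])
qed

text \<open>The first index transforms like a vector: raising it contributes \<open>K\<close> times
  its transpose, and the transpose cancels the \<open>L\<close> in
  \<open>star_frame\<close>.\<close>

lemma Psi_frame: "Psi w m a b c = (\<Sum>r\<in>UNIV. K $ m $ r * pullback3 L (psi0 r) a b c)"
proof -
  have g: "matrix_inv (g_expr w) $ m $ n = (\<Sum>s\<in>UNIV. K $ n $ s * K $ m $ s)" for n
    unfolding ginv_frame matrix_matrix_mult_def transpose_def vec_lambda_beta by (simp only: mult.commute)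
  have "(\<Sum>n\<in>UNIV. K $ n $ s * (\<Sum>r\<in>UNIV. L $ r $ n * pullback3 L (psi0 r) a b c)) = pullback3 L (psi0 s) a b c" for s
    unfolding sum_mcomp by (simp only: mult.commute[of "L $ _ $ _"] sum_KL sum_delta7)
  then show ?thesis
    unfolding Psi_def star_frame g
    using pair_adjoint[of "\<lambda>s n. K $ n $ s" "\<lambda>s. K $ m $ s" "\<lambda>n. \<Sum>r\<in>UNIV. L $ r $ n * pullback3 L (psi0 r) a b c"]
    by (simp only:)
qed

lemma dot_frame: "dot x (Psi w) a b c = pullback3 L (dot (\<lambda>r. \<Sum>m\<in>UNIV. K $ m $ r * x m) psi0) a b c"
proof -
  have "dot x (Psi w) a b c = (\<Sum>r\<in>UNIV. (\<Sum>m\<in>UNIV. K $ m $ r * x m) * pullback3 L (psi0 r) a b c)"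
    unfolding dot_def Psi_frame sum_mcomp by (rule refl)
  also have "\<dots> = pullback3 L (\<lambda>a b c. \<Sum>r\<in>UNIV. (\<Sum>m\<in>UNIV. K $ m $ r * x m) * psi0 r a b c) a b c"
    unfolding pullback3_def op_sum by (rule refl)
  finally show ?thesis unfolding dot_def[abs_def] .
qed

lemma pull_push: "(\<Sum>m\<in>UNIV. K $ m $ r * (\<Sum>n\<in>UNIV. L $ n $ m * x n)) = x r"
proof -
  have "(\<Sum>m\<in>UNIV. K $ m $ r * (\<Sum>n\<in>UNIV. L $ n $ m * x n)) = (\<Sum>n\<in>UNIV. (\<Sum>m\<in>UNIV. L $ n $ m * K $ m $ r) * x n)"
    by (rule sum_mcomp)
  also have "\<dots> = (\<Sum>n\<in>UNIV. (if r = n then 1 else 0) * x n)"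
    by (simp only: mult.commute[of "L $ _ $ _"] sum_KL)
  finally show ?thesis by (simp only: sum_delta7)
qed

lemma push_pull: "(\<Sum>n\<in>UNIV. L $ n $ l * (\<Sum>m\<in>UNIV. K $ m $ n * x m)) = x l"
proof -
  have "(\<Sum>n\<in>UNIV. L $ n $ l * (\<Sum>m\<in>UNIV. K $ m $ n * x m)) = (\<Sum>m\<in>UNIV. (\<Sum>n\<in>UNIV. K $ m $ n * L $ n $ l) * x m)"
    by (rule sum_mcomp)
  also have "\<dots> = (\<Sum>m\<in>UNIV. (if l = m then 1 else 0) * x m)"
    by (simp only: mult.commute[of "K $ _ $ _"] sum_LK)
  finally show ?thesis by (simp only: sum_delta7)
qed

text \<open>An explicit left inverse of \<open>x \<mapsto> dot x (Psi w)\<close>, with the constant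
  24 of \<open>psi0_psi0\<close>. It yields both the injectivity of this map and a smooth formula
  for the torsion.\<close>

lemma dot_Psi_coefficient:
  "(1/24) * pair3 (pullback3 (transpose (matrix_inv (g_expr w))) (dot x (Psi w)))
     (star4 (transpose (matrix_inv (g_expr w))) (nu_expr w) w l) = x l"
proof -
  let ?x = "\<lambda>r. \<Sum>m\<in>UNIV. K $ m $ r * x m"
  let ?u = "dot ?x psi0"
  have d: "dot x (Psi w) = pullback3 L ?u" by (simp only: fun_eq_iff dot_frame simp_thms)
  have s: "star4 (transpose (matrix_inv (g_expr w))) (nu_expr w) w l = (\<lambda>a b c. \<Sum>r\<in>UNIV. L $ r $ l * pullback3 L (psi0 r) a b c)"
    by (simp only: fun_eq_iff star_frame simp_thms)
  have "L ** (K ** transpose K) = transpose K" by (simp only: matrix_mul_assoc LK matrix_mul_lid)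
  then have p: "pullback3 (transpose (matrix_inv (g_expr w))) (pullback3 L ?u) = pullback3 (transpose K) ?u"
    unfolding ginv_symmetric unfolding ginv_frame pullback3_comp by (simp only:)
  have q: "pair3 (pullback3 (transpose K) ?u) (pullback3 L (psi0 r)) = 24 * ?x r" for r
    unfolding pair3_pullback3[of "transpose K"] transpose_transpose pullback3_comp[of K L] LK pullback3_mat1
    unfolding dot_def[abs_def] pair3_sum(1) psi0_psi0 by (simp add: if_distrib cong: if_cong)
  show ?thesis
    unfolding d p s pair3_sum(2) q by (simp only: mult.left_commute[of _ 24] sum_distrib_left[symmetric] push_pull)
qed

text \<open>A matrix \<open>B\<close> in the frame becomes K B L in coordinates;
  \<open>act3_pullback3\<close> applies because L (K B L) = B L.\<close>

lemma act3_frame: "act3 (\<lambda>i j. (K ** (B ** L)) $ i $ j) w = pullback3 L (act3 (\<lambda>i j. B $ i $ j) phi0)"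
proof -
  have "L ** (K ** (B ** L)) = B ** L" by (simp only: matrix_mul_assoc LK matrix_mul_lid)
  then show ?thesis
    unfolding w by (intro act3_pullback3) (simp only: mcomp_mat)
qed

lemma alternating_act3_frame:
  assumes "alt3 h"
  shows "\<exists>M. h = act3 M w"
proof -
  have "alt3 (pullback3 K h)" by (rule alt3_pullback3[OF assms])
  then obtain M0 where M0: "pullback3 K h = act3 M0 phi0" using act3_phi0_surj by blast
  have "h = pullback3 L (pullback3 K h)" by (simp only: pullback3_comp KL pullback3_mat1)
  also have "\<dots> = act3 (\<lambda>i j. (K ** ((\<chi> i j. M0 i j) ** L)) $ i $ j) w"
  proof -
    have "(\<lambda>i j. (\<chi> i j. M0 i j) $ i $ j) = M0" by (simp only: fun_eq_iff vec_lambda_beta simp_thms)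
    then show ?thesis unfolding act3_frame M0 by (simp only:)
  qed
  finally show ?thesis by blast
qed

lemma raise_frame: "(\<Sum>m\<in>UNIV. matrix_inv (g_expr w) $ a $ m * X m) = (\<Sum>r\<in>UNIV. K $ a $ r * (\<Sum>m\<in>UNIV. K $ m $ r * X m))"
proof -
  have g: "matrix_inv (g_expr w) $ a $ m = (\<Sum>r\<in>UNIV. K $ m $ r * K $ a $ r)" for m
    unfolding ginv_frame matrix_matrix_mult_def transpose_def vec_lambda_beta by (simp only: mult.commute)
  show ?thesis unfolding g by (rule pair_adjoint)
qed

lemma w_frame: "w m n l = (\<Sum>s\<in>UNIV. L $ s $ m * (\<Sum>t\<in>UNIV. L $ t $ n * (\<Sum>r\<in>UNIV. L $ r $ l * phi0 s t r)))"
  unfolding w pullback3_sums by (rule refl)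

end

lemma matrix_add_distrib:
  fixes A :: "real^7^7"
  shows "A ** (B + C) = A ** B + A ** C" "(B + C) ** A = B ** A + C ** A"
  unfolding matrix_matrix_mult_def vec_eq_iff
  by (simp_all only: vec_lambda_beta vector_add_component distrib_left distrib_right sum.distrib simp_thms)

lemma matrix_diff_distrib:
  fixes A :: "real^7^7"
  shows "A ** (B - C) = A ** B - A ** C" "(B - C) ** A = B ** A - C ** A"
  unfolding matrix_matrix_mult_def vec_eq_iff
  by (simp_all only: vec_lambda_beta vector_minus_component right_diff_distrib left_diff_distrib sum_subtractf simp_thms)

context G2_frame
begin

text \<open>In frame components the metric is the identity, so both inverse metrics disappear and
  the cross product of R^7 remains.\<close>

lemma raised_cross_frame:
  "raised_cross w S T l = (\<Sum>r\<in>UNIV. L $ r $ l * (\<Sum>s\<in>UNIV. \<Sum>t\<in>UNIV.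
     (\<Sum>m\<in>UNIV. K $ m $ s * S m) * ((\<Sum>m\<in>UNIV. K $ m $ t * T m) * phi0 s t r)))"
proof -
  let ?S = "\<lambda>s. \<Sum>m\<in>UNIV. K $ m $ s * S m" and ?T = "\<lambda>s. \<Sum>m\<in>UNIV. K $ m $ s * T m"
  let ?g = "\<lambda>a m. matrix_inv (g_expr w) $ a $ m"
  have T: "(\<Sum>b\<in>UNIV. T b * (\<Sum>n\<in>UNIV. ?g b n * (\<Sum>t\<in>UNIV. L $ t $ n * X t))) = (\<Sum>t\<in>UNIV. (\<Sum>m\<in>UNIV. K $ m $ t * T m) * X t)" for T X
    unfolding raise_frame pull_push unfolding sum_mcomp by (rule refl)
  have "raised_cross w S T l = (\<Sum>a\<in>UNIV. S a * (\<Sum>m\<in>UNIV. ?g a m * (\<Sum>b\<in>UNIV. T b * (\<Sum>n\<in>UNIV. ?g b n * w m n l))))"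
  proof -
    have "raised_cross w S T l = (\<Sum>a\<in>UNIV. \<Sum>m\<in>UNIV. \<Sum>b\<in>UNIV. \<Sum>n\<in>UNIV. S a * T b * ?g a m * ?g b n * w m n l)"
      unfolding raised_cross_def by (rule sum.cong[OF refl], rule sum.swap)
    then show ?thesis unfolding sum_distrib_left by (simp only: ac_simps)
  qed
  also have "\<dots> = (\<Sum>s\<in>UNIV. ?S s * (\<Sum>t\<in>UNIV. ?T t * (\<Sum>r\<in>UNIV. L $ r $ l * phi0 s t r)))"
  proof -
    have "(\<Sum>b\<in>UNIV. T b * (\<Sum>n\<in>UNIV. ?g b n * w m n l)) =
      (\<Sum>s\<in>UNIV. L $ s $ m * (\<Sum>t\<in>UNIV. ?T t * (\<Sum>r\<in>UNIV. L $ r $ l * phi0 s t r)))" for m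
    proof -
      have "w m n l = (\<Sum>t\<in>UNIV. L $ t $ n * (\<Sum>s\<in>UNIV. L $ s $ m * (\<Sum>r\<in>UNIV. L $ r $ l * phi0 s t r)))" for n
        unfolding w_frame by (rule sum_swap_mult)
      then show ?thesis by (simp only: T) (rule sum_swap_mult)
    qed
    then show ?thesis by (simp only: T)
  qed
  also have "\<dots> = (\<Sum>s\<in>UNIV. \<Sum>t\<in>UNIV. \<Sum>r\<in>UNIV. L $ r $ l * (?S s * (?T t * phi0 s t r)))"
    unfolding sum_distrib_left[of "?S _"] sum_distrib_left[of "?T _"] by (simp only: mult.left_commute[of _ "L $ _ $ l"])
  also have "\<dots> = (\<Sum>s\<in>UNIV. \<Sum>r\<in>UNIV. \<Sum>t\<in>UNIV. L $ r $ l * (?S s * (?T t * phi0 s t r)))"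
    by (rule sum.cong[OF refl], rule sum.swap)
  also have "\<dots> = (\<Sum>r\<in>UNIV. \<Sum>s\<in>UNIV. \<Sum>t\<in>UNIV. L $ r $ l * (?S s * (?T t * phi0 s t r)))"
    by (rule sum.swap)
  finally show ?thesis unfolding sum_distrib_left .
qed

text \<open>\<open>C T\<close> is \<open>cross_mat\<close> of the frame components of
  \<open>T\<close>, written in coordinates. The 1/3 is that of \<open>cross_mat\<close>; the -1/3 is
  the -2/3 of \<open>cross_mat_commutator\<close> times the 1/2 of
  \<open>act3_phi0_skew\<close>.\<close>

lemma act3_cross_frame:
  defines "C \<equiv> \<lambda>T i j. (K ** ((\<chi> i j. cross_mat (\<lambda>r. \<Sum>m\<in>UNIV. K $ m $ r * T m) i j) ** L)) $ i $ j"
  shows "act3 (C T) w = dot T (Psi w)"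
    and "(\<Sum>p\<in>UNIV. C S p l * T p) = (1/3) * raised_cross w S T l"
    and "act3 (\<lambda>i j. mcomp (C T) (C S) i j - mcomp (C S) (C T) i j) w = dot (\<lambda>l. - (1/3) * raised_cross w S T l) (Psi w)"
proof -
  define tl where "tl T r = (\<Sum>m\<in>UNIV. K $ m $ r * T m)" for T r
  define B where "B T = (\<chi> i j. cross_mat (tl T) i j)" for T
  have tlx: "(\<lambda>r. \<Sum>m\<in>UNIV. K $ m $ r * x m) = tl x" for x by (simp only: fun_eq_iff tl_def simp_thms)
  have C: "C T = (\<lambda>i j. (K ** (B T ** L)) $ i $ j)" for T
    unfolding C_def B_def tlx ..
  have B: "(\<lambda>i j. B T $ i $ j) = cross_mat (tl T)" for T unfolding B_def by (simp only: vec_lambda_beta)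
  have a: "act3 (cross_mat x) phi0 = dot x psi0" for x
    by (simp only: fun_eq_iff dot_def act3_cross_mat simp_thms)
  have d: "dot x (Psi w) = pullback3 L (dot (tl x) psi0)" for x
    by (simp only: fun_eq_iff dot_frame tlx simp_thms)
  show "act3 (C T) w = dot T (Psi w)"
    unfolding C act3_frame B a d ..
  show "(\<Sum>p\<in>UNIV. C S p l * T p) = (1/3) * raised_cross w S T l"
  proof -
    have cr: "(\<Sum>s\<in>UNIV. cross_mat (tl S) s r * tl T s) = (1/3) * (\<Sum>s\<in>UNIV. \<Sum>t\<in>UNIV. tl S s * (tl T t * phi0 s t r))" for r
      unfolding cross_mat_def sum_distrib_left sum_distrib_right by (subst sum.swap) (simp only: ac_simps)
    have "(\<Sum>p\<in>UNIV. C S p l * T p) = (\<Sum>p\<in>UNIV. (\<Sum>s\<in>UNIV. K $ p $ s * (B S ** L) $ s $ l) * T p)"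
      unfolding C matrix_matrix_mult_def[of K] vec_lambda_beta by (rule refl)
    also have "\<dots> = (\<Sum>s\<in>UNIV. (B S ** L) $ s $ l * tl T s)"
      using pair_adjoint[of "\<lambda>s p. K $ p $ s" "\<lambda>s. (B S ** L) $ s $ l" T] unfolding tl_def .
    also have "\<dots> = (\<Sum>s\<in>UNIV. (\<Sum>r\<in>UNIV. L $ r $ l * cross_mat (tl S) s r) * tl T s)"
      unfolding matrix_matrix_mult_def B_def vec_lambda_beta by (simp only: mult.commute[of "cross_mat _ _ _"])
    also have "\<dots> = (\<Sum>r\<in>UNIV. L $ r $ l * (\<Sum>s\<in>UNIV. cross_mat (tl S) s r * tl T s))"
      using sum_mcomp[of "tl T" "\<lambda>r s. cross_mat (tl S) s r" "\<lambda>r. L $ r $ l"] by (simp only: mult.commute)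
    finally show ?thesis
      unfolding cr raised_cross_frame tl_def[symmetric] by (simp only: sum_distrib_left mult.left_commute[of _ "1/3"])
  qed
  show "act3 (\<lambda>i j. mcomp (C T) (C S) i j - mcomp (C S) (C T) i j) w = dot (\<lambda>l. - (1/3) * raised_cross w S T l) (Psi w)"
  proof -
    have m: "mcomp (C T) (C S) i j = (K ** ((B T ** B S) ** L)) $ i $ j" for S T i j
    proof -
      have "(K ** (B T ** L)) ** (K ** (B S ** L)) = K ** (B T ** ((L ** K) ** (B S ** L)))"
        by (simp only: matrix_mul_assoc)
      also have "\<dots> = K ** ((B T ** B S) ** L)" by (simp only: LK matrix_mul_lid matrix_mul_assoc)
      finally show ?thesis unfolding C mcomp_mat by (rule arg_cong)
    qed
    have "(\<lambda>i j. mcomp (C T) (C S) i j - mcomp (C S) (C T) i j) = (\<lambda>i j. (K ** ((B T ** B S - B S ** B T) ** L)) $ i $ j)"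
      unfolding m by (simp only: matrix_diff_distrib vector_minus_component)
    then have "act3 (\<lambda>i j. mcomp (C T) (C S) i j - mcomp (C S) (C T) i j) w =
       pullback3 L (act3 (\<lambda>i j. (B T ** B S - B S ** B T) $ i $ j) phi0)"
      by (simp only: act3_frame)
    also have "(\<lambda>i j. (B T ** B S - B S ** B T) $ i $ j) =
        (\<lambda>i j. mcomp (cross_mat (tl T)) (cross_mat (tl S)) i j - mcomp (cross_mat (tl S)) (cross_mat (tl T)) i j)" (is "_ = ?M")
      unfolding B[symmetric] mcomp_mat by (simp only: vector_minus_component)
    also have "act3 ?M phi0 = dot (\<lambda>r. - (1/3) * (\<Sum>s\<in>UNIV. \<Sum>t\<in>UNIV. tl S s * (tl T t * phi0 s t r))) psi0"
    proof -
      have "mcomp (cross_mat y) (cross_mat x) b a = mcomp (cross_mat x) (cross_mat y) a b" for x y a b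
        unfolding mcomp_def cross_mat_skew[of y b] cross_mat_skew[of x _ a] by (simp add: mult.commute)
      then have sk: "?M b a = - ?M a b" for a b by simp
      define P where "P n = (\<Sum>s\<in>UNIV. \<Sum>t\<in>UNIV. tl S s * (tl T t * phi0 s t n))" for n
      have "act3 ?M phi0 a b c = (1/2) * (\<Sum>n\<in>UNIV. - (2/3) * P n * psi0 n a b c)" for a b c
        using act3_phi0_skew[of ?M, OF sk] unfolding cross_mat_commutator P_def .
      then show ?thesis unfolding fun_eq_iff dot_def sum_distrib_left P_def[symmetric] by simp
    qed
    finally have fin: "act3 (\<lambda>i j. mcomp (C T) (C S) i j - mcomp (C S) (C T) i j) w =
      pullback3 L (dot (\<lambda>r. - (1/3) * (\<Sum>s\<in>UNIV. \<Sum>t\<in>UNIV. tl S s * (tl T t * phi0 s t r))) psi0)" .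
    have "tl (\<lambda>l. - (1/3) * raised_cross w S T l) r = - (1/3) * (\<Sum>s\<in>UNIV. \<Sum>t\<in>UNIV. tl S s * (tl T t * phi0 s t r))" for r
    proof -
      have "tl (\<lambda>l. - (1/3) * raised_cross w S T l) r = - (1/3) * (\<Sum>m\<in>UNIV. K $ m $ r * raised_cross w S T m)"
        unfolding tl_def by (simp only: sum_distrib_left mult.left_commute)
      then show ?thesis unfolding raised_cross_frame pull_push tl_def .
    qed
    then have "tl (\<lambda>l. - (1/3) * raised_cross w S T l) = (\<lambda>r. - (1/3) * (\<Sum>s\<in>UNIV. \<Sum>t\<in>UNIV. tl S s * (tl T t * phi0 s t r)))"
      by (rule ext)
    then show ?thesis unfolding d fin by (simp only:)
  qed
qed

lemma lowered_dual_eq: "lowered_dual w M l = (\<Sum>k\<in>UNIV. raised_cross w (M k) (\<lambda>b. g_expr w $ k $ b) l)"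
proof -
  let ?F = "\<lambda>k a b m n. M k a * g_expr w $ k $ b * matrix_inv (g_expr w) $ a $ m * matrix_inv (g_expr w) $ b $ n * w m n l"
  have "lowered_dual w M l = (\<Sum>a\<in>UNIV. \<Sum>b\<in>UNIV. \<Sum>m\<in>UNIV. \<Sum>n\<in>UNIV. \<Sum>k\<in>UNIV. ?F k a b m n)"
    unfolding lowered_dual_def sum_distrib_right by (rule refl)
  also have "\<dots> = (\<Sum>a\<in>UNIV. \<Sum>k\<in>UNIV. \<Sum>b\<in>UNIV. \<Sum>m\<in>UNIV. \<Sum>n\<in>UNIV. ?F k a b m n)"
    by (rule sum.cong[OF refl], rule sum_swap4)
  also have "\<dots> = (\<Sum>k\<in>UNIV. \<Sum>a\<in>UNIV. \<Sum>b\<in>UNIV. \<Sum>m\<in>UNIV. \<Sum>n\<in>UNIV. ?F k a b m n)"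
    by (rule sum.swap)
  finally show ?thesis unfolding raised_cross_def .
qed

text \<open>Skewness of \<open>M\<close> with respect to the metric says that its frame matrix B = L
  M K is skew, so that \<open>act3_phi0_skew\<close> applies.\<close>

lemma act3_skew_frame:
  assumes skew: "\<And>a b. (\<Sum>m\<in>UNIV. M m a * g_expr w $ m $ b) + (\<Sum>m\<in>UNIV. M m b * g_expr w $ m $ a) = 0"
  shows "act3 M w = dot (\<lambda>l. - (1/2) * lowered_dual w M l) (Psi w)"
proof -
  define A where "A = (\<chi> i j. M i j)"
  define B where "B = L ** (A ** K)"
  have M: "M = (\<lambda>i j. (K ** (B ** L)) $ i $ j)"
  proof -
    have "K ** (B ** L) = (K ** L) ** (A ** (K ** L))" unfolding B_def by (simp only: matrix_mul_assoc)
    then show ?thesis unfolding A_def by (simp only: KL matrix_mul_lid matrix_mul_rid vec_lambda_beta)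
  qed
  have gA: "transpose A ** g_expr w + transpose (transpose A ** g_expr w) = 0"
    unfolding A_def matrix_matrix_mult_def transpose_def vec_eq_iff using skew by simp
  have gs: "transpose (transpose A ** g_expr w) = g_expr w ** A"
    unfolding matrix_transpose_mul transpose_transpose g_frame by (rule refl)
  have KtLt: "transpose K ** transpose L = mat 1" using LK by (metis matrix_transpose_mul transpose_mat)
  have "transpose B = - B"
  proof -
    have "transpose K ** ((transpose A ** g_expr w + g_expr w ** A) ** K) = 0"
      using gA unfolding gs by simp
    moreover have "transpose K ** ((transpose A ** g_expr w) ** K) = transpose B"
      unfolding B_def matrix_transpose_mul g_frame by (simp only: matrix_mul_assoc[symmetric] LK matrix_mul_rid)
    moreover have "transpose K ** ((g_expr w ** A) ** K) = B"
    proof -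
      have "transpose K ** ((g_expr w ** A) ** K) = (transpose K ** transpose L) ** (L ** (A ** K))"
        unfolding g_frame by (simp only: matrix_mul_assoc)
      then show ?thesis unfolding KtLt B_def by (simp only: matrix_mul_lid)
    qed
    ultimately have "transpose B + B = 0"
      by (simp only: matrix_add_distrib)
    then show ?thesis by (simp only: eq_neg_iff_add_eq_0)
  qed
  then have "transpose B $ a $ b = (- B) $ a $ b" for a b by (simp only:)
  then have sk: "B $ b $ a = - B $ a $ b" for a b
    unfolding transpose_def vec_lambda_beta vector_uminus_component .
  define Z where "Z n = (\<Sum>i\<in>UNIV. \<Sum>j\<in>UNIV. phi0 n i j * B $ i $ j)" for n
  define y where "y n = (1/2) * Z n" for n
  have ac: "act3 M w a b c = pullback3 L (dot y psi0) a b c" for a b c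
  proof -
    have "act3 (\<lambda>i j. B $ i $ j) phi0 a b c = dot y psi0 a b c" for a b c
    proof -
      have "act3 (\<lambda>i j. B $ i $ j) phi0 a b c = (1/2) * (\<Sum>n\<in>UNIV. Z n * psi0 n a b c)"
        unfolding Z_def by (rule act3_phi0_skew) (rule sk)
      then show ?thesis unfolding dot_def y_def sum_distrib_left by (simp only: mult.assoc)
    qed
    then have "act3 (\<lambda>i j. B $ i $ j) phi0 = dot y psi0" by (intro ext)
    then show ?thesis unfolding M act3_frame by (simp only:)
  qed
  have gK: "(\<Sum>b\<in>UNIV. K $ b $ t * g_expr w $ k $ b) = L $ t $ k" for t k
  proof -
    have "g_expr w ** K = transpose L" unfolding g_frame by (simp only: matrix_mul_assoc[symmetric] LK matrix_mul_rid)
    then have "(g_expr w ** K) $ k $ t = transpose L $ k $ t" by (simp only:)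
    then show ?thesis unfolding matrix_matrix_mult_def transpose_def vec_lambda_beta by (simp only: mult.commute)
  qed
  have cyc: "phi0 s t r = phi0 r s t" for r s t using phi0_swap(2)[of s r t] phi0_swap(1)[of s r t] by linarith
  have Bx: "B $ t $ s = (\<Sum>k\<in>UNIV. L $ t $ k * (\<Sum>a\<in>UNIV. K $ a $ s * M k a))" for s t
    unfolding B_def A_def matrix_matrix_mult_def vec_lambda_beta by (simp only: mult.commute)
  have ld: "lowered_dual w M l = - 2 * (\<Sum>r\<in>UNIV. L $ r $ l * y r)" for l
  proof -
    let ?Q = "\<lambda>k s. \<Sum>a\<in>UNIV. K $ a $ s * M k a"
    have y: "(\<Sum>k\<in>UNIV. \<Sum>s\<in>UNIV. \<Sum>t\<in>UNIV. ?Q k s * (L $ t $ k * phi0 s t r)) = - 2 * y r" for r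
    proof -
      have "(\<Sum>k\<in>UNIV. \<Sum>s\<in>UNIV. \<Sum>t\<in>UNIV. ?Q k s * (L $ t $ k * phi0 s t r)) =
        (\<Sum>s\<in>UNIV. \<Sum>k\<in>UNIV. \<Sum>t\<in>UNIV. ?Q k s * (L $ t $ k * phi0 s t r))"
        by (rule sum.swap)
      also have "\<dots> = (\<Sum>s\<in>UNIV. \<Sum>t\<in>UNIV. \<Sum>k\<in>UNIV. ?Q k s * (L $ t $ k * phi0 s t r))"
        by (rule sum.cong[OF refl], rule sum.swap)
      also have "\<dots> = (\<Sum>s\<in>UNIV. \<Sum>t\<in>UNIV. phi0 r s t * B $ t $ s)"
        unfolding Bx sum_distrib_left[of "phi0 _ _ _"] cyc[where r = r] by (simp only: ac_simps)
      \<comment> \<open>The minus sign of the lemma arises here: lowering M^k_a to M_ab produces the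
        transposed frame matrix.\<close>
      also have "\<dots> = (\<Sum>s\<in>UNIV. \<Sum>t\<in>UNIV. - (phi0 r s t * B $ s $ t))"
        by (intro sum.cong refl) (subst sk, rule mult_minus_right)
      also have "\<dots> = - 2 * y r"
        unfolding y_def Z_def by (simp only: sum_negf)
      finally show ?thesis .
    qed
    have "lowered_dual w M l = (\<Sum>k\<in>UNIV. \<Sum>r\<in>UNIV. L $ r $ l * (\<Sum>s\<in>UNIV. \<Sum>t\<in>UNIV. ?Q k s * (L $ t $ k * phi0 s t r)))"
      unfolding lowered_dual_eq raised_cross_frame gK by (rule refl)
    also have "\<dots> = (\<Sum>r\<in>UNIV. \<Sum>k\<in>UNIV. L $ r $ l * (\<Sum>s\<in>UNIV. \<Sum>t\<in>UNIV. ?Q k s * (L $ t $ k * phi0 s t r)))"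
      by (rule sum.swap)
    also have "\<dots> = - 2 * (\<Sum>r\<in>UNIV. L $ r $ l * y r)"
      unfolding sum_distrib_left[symmetric, of "L $ _ $ _"] y by (simp only: sum_distrib_left mult.left_commute[of _ "- 2"])
    finally show ?thesis .
  qed
  have "(\<lambda>r. \<Sum>m\<in>UNIV. K $ m $ r * (- (1/2) * lowered_dual w M m)) = y"
  proof (rule ext)
    fix r
    have "(\<Sum>m\<in>UNIV. K $ m $ r * (- (1/2) * lowered_dual w M m)) = (\<Sum>m\<in>UNIV. K $ m $ r * (\<Sum>n\<in>UNIV. L $ n $ m * y n))"
      unfolding ld by (rule sum.cong[OF refl]) simp
    then show "(\<Sum>m\<in>UNIV. K $ m $ r * (- (1/2) * lowered_dual w M m)) = y r" unfolding pull_push .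
  qed
  then show ?thesis
    unfolding fun_eq_iff ac dot_frame by (simp only: simp_thms)
qed

end

lemma G2_frame_exists:
  assumes "G2_form w"
  obtains L K where "G2_frame L K w"
proof -
  obtain L where L: "invertible L" "w = pullback3 L phi0" using assms unfolding G2_form_pullback3 by blast
  then obtain K where "L ** K = mat 1" "K ** L = mat 1" unfolding invertible_def by blast
  with L have "G2_frame L K w" by unfold_locales
  then show thesis by (rule that)
qed

section \<open>Directional derivatives and smoothness\<close>

abbreviation dd :: "'a::real_normed_vector \<Rightarrow> ('a \<Rightarrow> 'b::real_normed_vector) \<Rightarrow> 'a \<Rightarrow> 'b" where
  "dd v f x \<equiv> frechet_derivative f (at x) v"

lemma dd_eq: "(f has_derivative f') (at x) \<Longrightarrow> dd v f x = f' v"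
  using frechet_derivative_at by metis

lemma has_derivative_dd: "f differentiable (at x) \<Longrightarrow> (f has_derivative (\<lambda>v. dd v f x)) (at x)"
  by (simp add: frechet_derivative_works[symmetric])

lemma dd_add: "f differentiable (at x) \<Longrightarrow> g differentiable (at x) \<Longrightarrow> dd v (\<lambda>x. f x + g x) x = dd v f x + dd v g x"
  by (rule dd_eq) (intro has_derivative_add has_derivative_dd)

lemma dd_minus: "f differentiable (at x) \<Longrightarrow> dd v (\<lambda>x. - f x) x = - dd v f x"
  by (rule dd_eq) (intro has_derivative_minus has_derivative_dd)

lemma dd_mult:
  fixes f g :: "'a::real_normed_vector \<Rightarrow> real"
  shows "f differentiable (at x) \<Longrightarrow> g differentiable (at x) \<Longrightarrow> dd v (\<lambda>x. f x * g x) x = f x * dd v g x + dd v f x * g x"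
  by (rule dd_eq) (intro has_derivative_mult has_derivative_dd)

text \<open>Non-differentiable functions are covered as well: then neither function has a derivative
  at \<open>x\<close>, and the two choice terms behind \<open>frechet_derivative\<close>
  coincide.\<close>

lemma dd_cong:
  assumes "open S" "x \<in> S" "\<And>y. y \<in> S \<Longrightarrow> f y = g y" 
  shows "dd v f x = dd v g x"
proof (cases "f differentiable (at x)")
  case True
  from has_derivative_transform_within_open[OF has_derivative_dd[OF True] assms] show ?thesis by (simp add: dd_eq)
next
  case False
  have "\<not> g differentiable (at x)"
  proof
    assume "g differentiable (at x)"
    then obtain g' where "(g has_derivative g') (at x)" unfolding differentiable_def by blast
    from has_derivative_transform_within_open[OF this assms(1,2)] assms(3) have "(f has_derivative g') (at x)" by simp
    with False show False unfolding differentiable_def by blast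
  qed
  with False show ?thesis unfolding frechet_derivative_def differentiable_def by meson
qed

lemma differentiable_cong:
  assumes "open S" "x \<in> S" "\<And>y. y \<in> S \<Longrightarrow> f y = g y" "f differentiable (at x)"
  shows "g differentiable (at x)"
  using has_derivative_transform_within_open[OF has_derivative_dd[OF assms(4)] assms(1-3)] by (auto simp: differentiable_def)

lemma Ck_on_cong:
  assumes S: "open S" and "\<And>x. x \<in> S \<Longrightarrow> f x = g x" and "Ck_on k S f"
  shows "Ck_on k S g"
  using assms(2,3)
proof (induction k arbitrary: f g)
  case 0
  then show ?case using continuous_on_cong[of S S f g] by simp
next
  case (Suc k)
  have "g differentiable (at x)" if "x \<in> S" for x
    using differentiable_cong[OF S that Suc.prems(1)] Suc.prems(2) that by simp
  moreover have "Ck_on k S (\<lambda>x. dd b g x)" if "b \<in> Basis" for b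
    using Suc.IH[of "\<lambda>x. dd b f x" "\<lambda>x. dd b g x"] dd_cong[OF S _ Suc.prems(1)] Suc.prems(2) that by simp
  ultimately show ?case by simp
qed

lemma Ck_on_SucD: "Ck_on (Suc k) S f \<Longrightarrow> Ck_on k S f"
proof (induction k arbitrary: f)
  case 0
  then have "f differentiable_on S"
    by (auto simp: differentiable_on_def intro: differentiable_at_withinI)
  then show ?case by (simp add: differentiable_imp_continuous_on)
next
  case (Suc k)
  have "\<forall>x\<in>S. f differentiable (at x)" using Suc.prems by simp
  moreover have "Ck_on k S (\<lambda>x. dd b f x)" if "b \<in> Basis" for b
  proof -
    have "Ck_on (Suc k) S (\<lambda>x. dd b f x)" using Suc.prems that by (simp only: Ck_on.simps(2)[of "Suc k"])
    then show ?thesis by (rule Suc.IH)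
  qed
  ultimately show ?case by simp
qed

lemma Ck_on_differentiable: "Ck_on (Suc k) S f \<Longrightarrow> x \<in> S \<Longrightarrow> f differentiable (at x)"
  by simp

lemma Ck_on_const: "Ck_on k S (\<lambda>x. c)"
proof (induction k arbitrary: c)
  case (Suc k)
  then show ?case by (simp add: frechet_derivative_const)
qed simp

lemma Ck_on_add:
  assumes S: "open S"
  shows "Ck_on k S f \<Longrightarrow> Ck_on k S g \<Longrightarrow> Ck_on k S (\<lambda>x. f x + g x)"
proof (induction k arbitrary: f g)
  case 0
  then show ?case by (simp add: continuous_on_add)
next
  case (Suc k)
  have "Ck_on k S (\<lambda>x. dd b (\<lambda>x. f x + g x) x)" if "b \<in> Basis" for b
    by (rule Ck_on_cong[OF S _ Suc.IH[of "dd b f" "dd b g"]]) (use Suc.prems that in \<open>simp_all add: dd_add\<close>)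
  then show ?case using Suc.prems by simp
qed

lemma Ck_on_mult:
  fixes f g :: "'a::euclidean_space \<Rightarrow> real"
  assumes S: "open S"
  shows "Ck_on k S f \<Longrightarrow> Ck_on k S g \<Longrightarrow> Ck_on k S (\<lambda>x. f x * g x)"
proof (induction k arbitrary: f g)
  case 0
  then show ?case by (simp add: continuous_on_mult)
next
  case (Suc k)
  have "Ck_on k S (\<lambda>x. dd b (\<lambda>x. f x * g x) x)" if "b \<in> Basis" for b
  proof (rule Ck_on_cong[OF S])
    show "Ck_on k S (\<lambda>x. f x * dd b g x + dd b f x * g x)"
      by (intro Ck_on_add[OF S] Suc.IH) (use Suc.prems Ck_on_SucD that in \<open>simp_all only: Ck_on.simps(2), blast+\<close>)
  qed (use Suc.prems in \<open>simp add: dd_mult\<close>)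
  moreover have "\<forall>x\<in>S. (\<lambda>x. f x * g x) differentiable (at x)" using Suc.prems by (simp add: differentiable_mult)
  ultimately show ?case by simp
qed

lemma Ck_on_cmult:
  fixes f :: "'a::euclidean_space \<Rightarrow> real"
  shows "open S \<Longrightarrow> Ck_on k S f \<Longrightarrow> Ck_on k S (\<lambda>x. c * f x)"
  by (rule Ck_on_mult) (auto intro: Ck_on_const)

lemma Ck_on_minus:
  fixes f :: "'a::euclidean_space \<Rightarrow> real"
  shows "open S \<Longrightarrow> Ck_on k S f \<Longrightarrow> Ck_on k S (\<lambda>x. - f x)"
  using Ck_on_cmult[of S k f "-1"] by simp

lemma Ck_on_diff:
  fixes f g :: "'a::euclidean_space \<Rightarrow> real"
  shows "open S \<Longrightarrow> Ck_on k S f \<Longrightarrow> Ck_on k S g \<Longrightarrow> Ck_on k S (\<lambda>x. f x - g x)"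
  using Ck_on_add[of S k f "\<lambda>x. - g x"] Ck_on_minus by fastforce

lemma Ck_on_sum:
  assumes S: "open S" and f: "\<And>i. i \<in> I \<Longrightarrow> Ck_on k S (f i)"
  shows "Ck_on k S (\<lambda>x. \<Sum>i\<in>I. f i x)"
  using f by (induction I rule: infinite_finite_induct) (auto intro: Ck_on_const Ck_on_add[OF S])

lemma Ck_on_prod:
  fixes f :: "'i \<Rightarrow> 'a::euclidean_space \<Rightarrow> real"
  assumes S: "open S" and f: "\<And>i. i \<in> I \<Longrightarrow> Ck_on k S (f i)"
  shows "Ck_on k S (\<lambda>x. \<Prod>i\<in>I. f i x)"
  using f by (induction I rule: infinite_finite_induct) (auto intro: Ck_on_const Ck_on_mult[OF S])

lemma Ck_on_inverse:
  fixes f :: "'a::euclidean_space \<Rightarrow> real"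
  assumes S: "open S" and nz: "\<And>x. x \<in> S \<Longrightarrow> f x \<noteq> 0"
  shows "Ck_on k S f \<Longrightarrow> Ck_on k S (\<lambda>x. inverse (f x))"
proof (induction k)
  case 0
  then show ?case using nz by (simp add: continuous_on_inverse)
next
  case (Suc k)
  have d: "((\<lambda>x. inverse (f x)) has_derivative (\<lambda>h. - (inverse (f x) * dd h f x * inverse (f x)))) (at x)" if "x \<in> S" for x
    using Deriv.has_derivative_inverse[where f = f, OF nz[OF that] has_derivative_dd] Suc.prems that by simp
  have i: "Ck_on k S (\<lambda>x. inverse (f x))" using Suc.IH Ck_on_SucD[OF Suc.prems] .
  have "Ck_on k S (\<lambda>x. dd b (\<lambda>x. inverse (f x)) x)" if "b \<in> Basis" for b
  proof (rule Ck_on_cong[OF S])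
    show "Ck_on k S (\<lambda>x. - (inverse (f x) * dd b f x * inverse (f x)))"
      by (intro Ck_on_minus Ck_on_mult S i) (use Suc.prems that in simp)
  qed (simp add: dd_eq[OF d])
  then show ?case using d by (auto simp: differentiable_def)
qed

lemma Ck_on_root9:
  fixes f :: "'a::euclidean_space \<Rightarrow> real"
  assumes S: "open S" and nz: "\<And>x. x \<in> S \<Longrightarrow> f x \<noteq> 0"
  shows "Ck_on k S f \<Longrightarrow> Ck_on k S (\<lambda>x. root 9 (f x))"
proof (induction k)
  case 0
  then show ?case by (simp add: continuous_on_real_root)
next
  case (Suc k)
  have d: "((\<lambda>x. root 9 (f x)) has_derivative (\<lambda>h. dd h f x * inverse (9 * root 9 (f x) ^ 8))) (at x)" if "x \<in> S" for x
  proof -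
    have "(root 9 has_field_derivative inverse (9 * root 9 (f x) ^ 8)) (at (f x))"
      using DERIV_odd_real_root[of 9 "f x"] nz[OF that] by simp
    from DERIV_compose_FDERIV[where f = "root 9" and g = f, OF this has_derivative_dd] show ?thesis
      using Suc.prems that by simp
  qed
  have i: "Ck_on k S (\<lambda>x. root 9 (f x))" using Suc.IH Ck_on_SucD[OF Suc.prems] .
  have "Ck_on k S (\<lambda>x. dd b (\<lambda>x. root 9 (f x)) x)" if "b \<in> Basis" for b
  proof (rule Ck_on_cong[OF S])
    \<comment> \<open>The eighth power is written as a product so that \<open>Ck_on_prod\<close>
      applies.\<close>
    have "Ck_on k S (\<lambda>x. inverse (9 * (\<Prod>j\<in>{..<8::nat}. root 9 (f x))))"
      by (intro Ck_on_inverse Ck_on_cmult Ck_on_prod S i) (use nz in auto)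
    then show "Ck_on k S (\<lambda>x. dd b f x * inverse (9 * root 9 (f x) ^ 8))"
      by (intro Ck_on_mult S) (use Suc.prems that in simp_all)
  qed (simp add: dd_eq[OF d])
  then show ?case using d by (auto simp: differentiable_def)
qed

lemma Ck_on_bounded_linear:
  assumes h: "bounded_linear h"
  shows "Ck_on k S h"
proof (cases k)
  case 0
  then show ?thesis using h by (simp add: linear_continuous_on)
next
  case (Suc j)
  have "(h has_derivative h) (at x)" for x using h by (rule bounded_linear_imp_has_derivative)
  then have "h differentiable (at x)" "dd b h x = h b" for x b by (auto simp: differentiable_def dd_eq)
  then show ?thesis using Suc by (simp add: Ck_on_const)
qed

lemma Ck_on_compose_linear:
  assumes S: "open S" and h: "bounded_linear h"
  shows "Ck_on k S f \<Longrightarrow> Ck_on k S (\<lambda>x. h (f x))"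
proof (induction k arbitrary: f)
  case 0
  then show ?case using continuous_on_compose2[OF linear_continuous_on[OF h, of UNIV]] by fastforce
next
  case (Suc k)
  have d: "((\<lambda>x. h (f x)) has_derivative (\<lambda>v. h (dd v f x))) (at x)" if "x \<in> S" for x
    using bounded_linear.has_derivative[OF h has_derivative_dd[of f x]] Suc.prems that by simp
  have "Ck_on k S (\<lambda>x. dd b (\<lambda>x. h (f x)) x)" if "b \<in> Basis" for b
    by (rule Ck_on_cong[OF S _ Suc.IH[of "dd b f"]]) (use Suc.prems that in \<open>simp_all add: dd_eq[OF d]\<close>)
  then show ?case using d by (auto simp: differentiable_def)
qed

section \<open>Symmetry of second derivatives\<close>

lemma has_real_derivative_line:
  fixes f :: "'a::real_normed_vector \<Rightarrow> real"
  assumes "f differentiable (at (x + s *\<^sub>R u))"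
  shows "((\<lambda>s. f (x + s *\<^sub>R u)) has_real_derivative dd u f (x + s *\<^sub>R u)) (at s)"
proof -
  have "((\<lambda>s. x + s *\<^sub>R u) has_vector_derivative u) (at s)"
    by (auto intro!: derivative_eq_intros)
  then have "((\<lambda>s. f (x + s *\<^sub>R u)) has_derivative (\<lambda>h. dd (h *\<^sub>R u) f (x + s *\<^sub>R u))) (at s)"
    unfolding has_vector_derivative_def using has_derivative_compose[where f = "\<lambda>s. x + s *\<^sub>R u" and g = f, OF _ has_derivative_dd[OF assms]] by blast
  moreover have "dd (h *\<^sub>R u) f (x + s *\<^sub>R u) = dd u f (x + s *\<^sub>R u) * h" for h
    using linear_frechet_derivative[OF assms] by (simp add: linear_cmul)
  ultimately show ?thesis unfolding has_field_derivative_def by simp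
qed

text \<open>The mean value theorem is applied once in direction \<open>u\<close>, to a difference in
  direction \<open>v\<close>, and once in direction \<open>v\<close>.\<close>

lemma second_difference:
  fixes f :: "'a::euclidean_space \<Rightarrow> real"
  assumes f: "Ck_on (Suc (Suc 0)) S f" and u: "u \<in> Basis" and v: "v \<in> Basis" and h: "h > 0"
    and S: "\<And>s t. 0 \<le> s \<Longrightarrow> s \<le> h \<Longrightarrow> 0 \<le> t \<Longrightarrow> t \<le> h \<Longrightarrow> x + s *\<^sub>R u + t *\<^sub>R v \<in> S"
  shows "\<exists>s t. 0 \<le> s \<and> s \<le> h \<and> 0 \<le> t \<and> t \<le> h \<and>
    f (x + h *\<^sub>R u + h *\<^sub>R v) - f (x + h *\<^sub>R u) - f (x + h *\<^sub>R v) + f x = h * h * dd v (dd u f) (x + s *\<^sub>R u + t *\<^sub>R v)"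
proof -
  have df: "f differentiable (at y)" if "y \<in> S" for y using f that by simp
  have du: "dd u f differentiable (at y)" if "y \<in> S" for y using f that u by simp
  let ?q = "\<lambda>s. f (x + h *\<^sub>R v + s *\<^sub>R u) - f (x + s *\<^sub>R u)"
  have "\<exists>s. 0 < s \<and> s < h \<and> ?q h - ?q 0 = (h - 0) * (dd u f (x + h *\<^sub>R v + s *\<^sub>R u) - dd u f (x + s *\<^sub>R u))"
  proof (rule MVT2[OF h])
    fix s assume s: "0 \<le> s" "s \<le> h"
    show "(?q has_real_derivative dd u f (x + h *\<^sub>R v + s *\<^sub>R u) - dd u f (x + s *\<^sub>R u)) (at s)"
      using S[OF s, of h] S[OF s, of 0] h by (intro DERIV_diff has_real_derivative_line df) (simp_all add: ac_simps)
  qed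
  then obtain s where s: "0 < s" "s < h" and q: "?q h - ?q 0 = h * (dd u f (x + h *\<^sub>R v + s *\<^sub>R u) - dd u f (x + s *\<^sub>R u))" by auto
  have "\<exists>t. 0 < t \<and> t < h \<and> dd u f (x + s *\<^sub>R u + h *\<^sub>R v) - dd u f (x + s *\<^sub>R u + 0 *\<^sub>R v) = (h - 0) * dd v (dd u f) (x + s *\<^sub>R u + t *\<^sub>R v)"
  proof (rule MVT2[OF h])
    fix t assume t: "0 \<le> t" "t \<le> h"
    show "((\<lambda>t. dd u f (x + s *\<^sub>R u + t *\<^sub>R v)) has_real_derivative dd v (dd u f) (x + s *\<^sub>R u + t *\<^sub>R v)) (at t)"
      using S[of s t] t s by (intro has_real_derivative_line du) simp
  qed
  then obtain t where t: "0 < t" "t < h" "dd u f (x + s *\<^sub>R u + h *\<^sub>R v) - dd u f (x + s *\<^sub>R u) = h * dd v (dd u f) (x + s *\<^sub>R u + t *\<^sub>R v)" by auto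
  have "f (x + h *\<^sub>R u + h *\<^sub>R v) - f (x + h *\<^sub>R u) - f (x + h *\<^sub>R v) + f x = ?q h - ?q 0" by (simp add: ac_simps)
  also have "\<dots> = h * h * dd v (dd u f) (x + s *\<^sub>R u + t *\<^sub>R v)"
    using q t(3) by (simp add: ac_simps)
  finally show ?thesis using s t by (intro exI[of _ s] exI[of _ t]) auto
qed

text \<open>The second difference is symmetric in \<open>u\<close> and \<open>v\<close>, so both
  mixed derivatives take a common value at points arbitrarily near \<open>x\<close>; continuity then
  excludes different values at \<open>x\<close>.\<close>

lemma dd_commute:
  fixes f :: "'a::euclidean_space \<Rightarrow> real"
  assumes S: "open S" and x: "x \<in> S" and f: "Ck_on (Suc (Suc 0)) S f" and u: "u \<in> Basis" and v: "v \<in> Basis"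
  shows "dd v (dd u f) x = dd u (dd v f) x"
proof (rule ccontr)
  let ?a = "dd v (dd u f)" and ?b = "dd u (dd v f)"
  assume ne: "?a x \<noteq> ?b x"
  define e where "e = \<bar>?a x - ?b x\<bar> / 2"
  have e: "e > 0" using ne by (simp add: e_def)
  have "continuous_on S ?a" "continuous_on S ?b" using f u v by simp_all
  then have "isCont ?a x" "isCont ?b x" using S x by (simp_all add: continuous_on_eq_continuous_at)
  then obtain d1 d2 where d: "d1 > 0" "d2 > 0"
    and d1: "\<And>y. dist y x < d1 \<Longrightarrow> dist (?a y) (?a x) < e"
    and d2: "\<And>y. dist y x < d2 \<Longrightarrow> dist (?b y) (?b x) < e"
    unfolding continuous_at_eps_delta using e by metis
  obtain d3 where d3: "d3 > 0" "ball x d3 \<subseteq> S" using S x openE by blast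
  \<comment> \<open>With a quarter of the radius, two displacements of length at most
    \<open>h\<close> stay strictly inside it.\<close>
  define h where "h = min d1 (min d2 d3) / 4"
  have h: "h > 0" using d d3 by (simp add: h_def)
  have near: "dist (x + s *\<^sub>R p + t *\<^sub>R q) x < min d1 (min d2 d3)" if "0 \<le> s" "s \<le> h" "0 \<le> t" "t \<le> h" "p \<in> Basis" "q \<in> Basis" for s t and p q :: 'a
  proof -
    have "dist (x + s *\<^sub>R p + t *\<^sub>R q) x = norm (s *\<^sub>R p + t *\<^sub>R q)" by (simp add: dist_norm)
    also have "\<dots> \<le> s + t" using norm_triangle_ineq[of "s *\<^sub>R p" "t *\<^sub>R q"] that by simp
    also have "\<dots> < min d1 (min d2 d3)" using that h by (simp add: h_def)
    finally show ?thesis .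
  qed
  have inS: "x + s *\<^sub>R p + t *\<^sub>R q \<in> S" if "0 \<le> s" "s \<le> h" "0 \<le> t" "t \<le> h" "p \<in> Basis" "q \<in> Basis" for s t and p q :: 'a
    using near[OF that] d3(2) by (auto simp: dist_commute)
  obtain s t where 1: "0 \<le> s" "s \<le> h" "0 \<le> t" "t \<le> h"
    "f (x + h *\<^sub>R u + h *\<^sub>R v) - f (x + h *\<^sub>R u) - f (x + h *\<^sub>R v) + f x = h * h * ?a (x + s *\<^sub>R u + t *\<^sub>R v)"
    using second_difference[OF f u v h, of x] inS u v by blast
  obtain s' t' where 2: "0 \<le> s'" "s' \<le> h" "0 \<le> t'" "t' \<le> h"
    "f (x + h *\<^sub>R v + h *\<^sub>R u) - f (x + h *\<^sub>R v) - f (x + h *\<^sub>R u) + f x = h * h * ?b (x + s' *\<^sub>R v + t' *\<^sub>R u)"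
    using second_difference[OF f v u h, of x] inS u v by blast
  have "h * h * ?a (x + s *\<^sub>R u + t *\<^sub>R v) = h * h * ?b (x + s' *\<^sub>R v + t' *\<^sub>R u)"
  proof -
    have "x + h *\<^sub>R v + h *\<^sub>R u = x + h *\<^sub>R u + h *\<^sub>R v" by (simp add: ac_simps)
    then show ?thesis using 1(5) 2(5) by (simp only:)
  qed
  then have "?a (x + s *\<^sub>R u + t *\<^sub>R v) = ?b (x + s' *\<^sub>R v + t' *\<^sub>R u)" using h by simp
  moreover have "dist (?a (x + s *\<^sub>R u + t *\<^sub>R v)) (?a x) < e" using d1 near[OF 1(1-4) u v] by simp
  moreover have "dist (?b (x + s' *\<^sub>R v + t' *\<^sub>R u)) (?b x) < e" using d2 near[OF 2(1-4) v u] by simp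
  ultimately show False unfolding e_def dist_real_def by (simp add: field_simps) argo
qed

section \<open>Smooth dependence of metric, volume and dual on the form\<close>

definition nondeg :: "tensor3 \<Rightarrow> bool" where
  "nondeg w \<longleftrightarrow> det (hitchin_matrix w) \<noteq> 0"

lemma nondeg_nu: "nondeg w \<Longrightarrow> nu_expr w \<noteq> 0"
  unfolding nondeg_def nu_expr_def by simp

lemma nondeg_G2: "G2_form w \<Longrightarrow> nondeg w"
  using metric_vol_unique(1,3)[OF metric_vol_G2] unfolding nondeg_def nu_expr_def by fastforce

lemma nondeg_det_g: "nondeg w \<Longrightarrow> det (g_expr w) \<noteq> 0"
  using nondeg_nu[of w] unfolding g_expr_def det_scaleR7 nondeg_def by simp

lemma matrix_inv_right:
  fixes A :: "real^'n^'n"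
  assumes "det A \<noteq> 0"
  shows "A ** matrix_inv A = mat 1"
proof -
  from assms obtain B where "A ** B = mat 1" using invertible_det_nz[of A] unfolding invertible_def by blast
  then show ?thesis using matrix_inv_eqI[of A B] by (simp only:)
qed

text \<open>Cramer's rule expresses the inverse through determinants and thus makes it a smooth
  function of the entries.\<close>

lemma matrix_inv_component:
  fixes A :: "real^'n^'n"
  assumes "det A \<noteq> 0"
  shows "matrix_inv A $ k $ l = det (\<chi> i j. if j = k then axis l 1 $ i else A $ i $ j) / det A"
proof -
  have "A *v (matrix_inv A *v axis l 1) = axis l 1"
    by (simp only: matrix_vector_mul_assoc matrix_inv_right[OF assms] matrix_vector_mul_lid)
  then have "matrix_inv A *v axis l 1 = (\<chi> k. det (\<chi> i j. if j = k then axis l 1 $ i else A $ i $ j) / det A)"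
    using cramer[OF assms] by blast
  then have "(matrix_inv A *v axis l 1) $ k = det (\<chi> i j. if j = k then axis l 1 $ i else A $ i $ j) / det A"
    by (simp only: vec_lambda_beta)
  then show ?thesis by (simp add: matrix_vector_mult_basis column_def)
qed

lemma Ck_on_det:
  fixes M :: "'a::euclidean_space \<Rightarrow> real^'n^'n"
  assumes S: "open S" and "\<And>i j. Ck_on k S (\<lambda>x. M x $ i $ j)"
  shows "Ck_on k S (\<lambda>x. det (M x))"
  unfolding det_def by (intro Ck_on_sum Ck_on_cmult Ck_on_prod assms)

context
  fixes S :: "'a::euclidean_space set" and w :: "'a \<Rightarrow> tensor3" and k :: nat
  assumes S: "open S" and w: "\<And>a b c. Ck_on k S (\<lambda>x. w x a b c)" and nd: "\<And>x. x \<in> S \<Longrightarrow> nondeg (w x)"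
begin

lemma Ck_on_hitchin: "Ck_on k S (\<lambda>x. hitchin_matrix (w x) $ i $ j)"
  unfolding hitchin_matrix_def hitchin_def wedge_sum_def vec_lambda_beta by (intro Ck_on_sum Ck_on_cmult Ck_on_mult S w)

lemma Ck_on_nu: "Ck_on k S (\<lambda>x. nu_expr (w x))"
proof -
  have "Ck_on k S (\<lambda>x. root 9 ((- 1 / 279936) * det (hitchin_matrix (w x))))"
    by (intro Ck_on_root9 Ck_on_cmult Ck_on_det Ck_on_hitchin S) (use nd in \<open>simp add: nondeg_def\<close>)
  then show ?thesis unfolding nu_expr_def by simp
qed

lemma Ck_on_g: "Ck_on k S (\<lambda>x. g_expr (w x) $ i $ j)"
proof -
  have "Ck_on k S (\<lambda>x. inverse (- 6 * nu_expr (w x)) * hitchin_matrix (w x) $ i $ j)"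
    by (intro Ck_on_mult Ck_on_inverse Ck_on_cmult Ck_on_hitchin Ck_on_nu S) (use nondeg_nu[OF nd] in simp)
  then show ?thesis unfolding g_expr_def by (simp add: inverse_eq_divide)
qed

lemma Ck_on_ginv: "Ck_on k S (\<lambda>x. matrix_inv (g_expr (w x)) $ i $ j)"
proof (rule Ck_on_cong[OF S])
  show "Ck_on k S (\<lambda>x. det (\<chi> p q. if q = i then axis j 1 $ p else g_expr (w x) $ p $ q) * inverse (det (g_expr (w x))))"
  proof (intro Ck_on_mult Ck_on_inverse Ck_on_det S Ck_on_g)
    show "Ck_on k S (\<lambda>x. (\<chi> p q. if q = i then axis j 1 $ p else g_expr (w x) $ p $ q) $ p $ q)" for p q
      by (cases "q = i") (simp_all add: Ck_on_const Ck_on_g)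
  qed (use nondeg_det_g[OF nd] in simp)
qed (simp add: matrix_inv_component nondeg_det_g nd field_class.field_divide_inverse)

lemma Ck_on_star: "Ck_on k S (\<lambda>x. star4 (transpose (matrix_inv (g_expr (w x)))) (nu_expr (w x)) (w x) a b c d)"
  unfolding star4_def pair3_def pullback3_sums transpose_def vec_lambda_beta
  by (intro Ck_on_sum Ck_on_cmult Ck_on_mult S w Ck_on_ginv Ck_on_nu Ck_on_const)

lemma Ck_on_Psi: "Ck_on k S (\<lambda>x. Psi (w x) m a b c)"
  unfolding Psi_def by (intro Ck_on_sum Ck_on_mult S Ck_on_ginv Ck_on_star)

end

section \<open>Derivatives with respect to the form\<close>

definition to_vec :: "tensor3 \<Rightarrow> real^7^7^7" where "to_vec w = (\<chi> a b c. w a b c)"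
definition of_vec :: "real^7^7^7 \<Rightarrow> tensor3" where "of_vec V a b c = V $ a $ b $ c"

lemma of_to_vec [simp]: "of_vec (to_vec w) = w"
  by (simp add: of_vec_def to_vec_def fun_eq_iff)

text \<open>The derivative at \<open>w\<close> in direction \<open>h\<close>, computed on the
  Euclidean space \<open>real^7^7^7\<close> that \<open>to_vec\<close> identifies with
  \<open>tensor3\<close>.\<close>

definition tensor_deriv :: "(tensor3 \<Rightarrow> real) \<Rightarrow> tensor3 \<Rightarrow> tensor3 \<Rightarrow> real" where
  "tensor_deriv F w h = dd (to_vec h) (\<lambda>V. F (of_vec V)) (to_vec w)"

definition tensor_differentiable :: "(tensor3 \<Rightarrow> real) \<Rightarrow> tensor3 \<Rightarrow> bool" where
  "tensor_differentiable F w \<longleftrightarrow> (\<lambda>V. F (of_vec V)) differentiable (at (to_vec w))"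

lemma to_vec_expand: "to_vec w = (\<Sum>a\<in>UNIV. \<Sum>b\<in>UNIV. \<Sum>c\<in>UNIV. w a b c *\<^sub>R axis a (axis b (axis c 1)))"
proof -
  have "(\<Sum>a\<in>UNIV. \<Sum>b\<in>UNIV. \<Sum>c\<in>UNIV. w a b c *\<^sub>R (axis a (axis b (axis c 1)) :: real^7^7^7)) $ i $ j $ k = w i j k" for i j k
  proof -
    have "(axis a (axis b (axis c 1)) :: real^7^7^7) $ i $ j $ k = (if i = a then 1 else 0) * ((if j = b then 1 else 0) * (if k = c then 1 else 0))" for a b c
      by (simp add: axis_def)
    then show ?thesis
      by (simp only: sum_component vector_scaleR_component real_scaleR_def mult.commute[of "w _ _ _"] mult.assoc
          sum_distrib_left[symmetric] sum_delta7)
  qed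
  then show ?thesis by (simp add: to_vec_def vec_eq_iff)
qed

lemma to_vec_has_derivative:
  assumes "\<And>a b c. (\<lambda>x. w x a b c) differentiable (at x)"
  shows "((\<lambda>x. to_vec (w x)) has_derivative (\<lambda>v. to_vec (\<lambda>a b c. dd v (\<lambda>x. w x a b c) x))) (at x)"
  unfolding to_vec_expand
  by (intro has_derivative_sum has_derivative_scaleR_left has_derivative_dd assms)

lemma tensor_chain:
  fixes w :: "'a::real_normed_vector \<Rightarrow> tensor3"
  assumes F: "tensor_differentiable F (w x)" and w: "\<And>a b c. (\<lambda>x. w x a b c) differentiable (at x)"
  shows "((\<lambda>x. F (w x)) has_derivative (\<lambda>v. tensor_deriv F (w x) (\<lambda>a b c. dd v (\<lambda>x. w x a b c) x))) (at x)"
  using has_derivative_compose[OF to_vec_has_derivative[OF w] has_derivative_dd[OF F[unfolded tensor_differentiable_def]]]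
  unfolding tensor_deriv_def by simp

lemma tensor_deriv_linear:
  assumes F: "tensor_differentiable F w"
  shows "tensor_deriv F w (\<lambda>a b c. u a b c + v a b c) = tensor_deriv F w u + tensor_deriv F w v"
    and "tensor_deriv F w (\<lambda>a b c. u a b c - v a b c) = tensor_deriv F w u - tensor_deriv F w v"
    and "tensor_deriv F w (\<lambda>a b c. r * u a b c) = r * tensor_deriv F w u"
    and "tensor_deriv F w (\<lambda>a b c. \<Sum>i\<in>I. x i * h i a b c) = (\<Sum>i\<in>I. x i * tensor_deriv F w (h i))"
proof -
  have lin: "linear (frechet_derivative (\<lambda>V. F (of_vec V)) (at (to_vec w)))"
    using F unfolding tensor_differentiable_def by (rule linear_frechet_derivative)
  have "to_vec (\<lambda>a b c. u a b c + v a b c) = to_vec u + to_vec v" "to_vec (\<lambda>a b c. u a b c - v a b c) = to_vec u - to_vec v"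
    "to_vec (\<lambda>a b c. r * u a b c) = r *\<^sub>R to_vec u"
    "to_vec (\<lambda>a b c. \<Sum>i\<in>I. x i * h i a b c) = (\<Sum>i\<in>I. x i *\<^sub>R to_vec (h i))"
    by (simp_all add: to_vec_def vec_eq_iff)
  then show "tensor_deriv F w (\<lambda>a b c. u a b c + v a b c) = tensor_deriv F w u + tensor_deriv F w v"
    "tensor_deriv F w (\<lambda>a b c. u a b c - v a b c) = tensor_deriv F w u - tensor_deriv F w v"
    "tensor_deriv F w (\<lambda>a b c. r * u a b c) = r * tensor_deriv F w u"
    "tensor_deriv F w (\<lambda>a b c. \<Sum>i\<in>I. x i * h i a b c) = (\<Sum>i\<in>I. x i * tensor_deriv F w (h i))"
    using lin by (simp_all add: tensor_deriv_def linear_add linear_diff linear_cmul linear_sum)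
qed

text \<open>Provides an open domain containing all G2-forms on which the explicit expressions are
  differentiable functions of the form.\<close>

lemma open_nondeg: "open {V. nondeg (of_vec V)}"
proof -
  have "Ck_on 0 UNIV (\<lambda>V. of_vec V a b c)" for a b c
    unfolding of_vec_def by (simp add: continuous_intros)
  then have "Ck_on 0 UNIV (\<lambda>V. hitchin (of_vec V) i j)" for i j
    unfolding hitchin_def wedge_sum_def by (intro Ck_on_sum Ck_on_cmult Ck_on_mult open_UNIV)
  then have "Ck_on 0 UNIV (\<lambda>V. det (hitchin_matrix (of_vec V)))"
    by (intro Ck_on_det) (simp_all add: hitchin_matrix_def)
  then have "continuous_on UNIV (\<lambda>V. det (hitchin_matrix (of_vec V)))" by simp
  then have "open ((\<lambda>V. det (hitchin_matrix (of_vec V))) -` (- {0}))"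
    by (intro open_vimage) auto
  moreover have "(\<lambda>V. det (hitchin_matrix (of_vec V))) -` (- {0}) = {V. nondeg (of_vec V)}" by (auto simp: nondeg_def)
  ultimately show ?thesis by simp
qed

lemma Ck_on_of_vec: "Ck_on k S (\<lambda>V. of_vec V a b c)"
  unfolding of_vec_def by (rule Ck_on_bounded_linear) (intro bounded_linear_compose[OF bounded_linear_vec_nth] bounded_linear_vec_nth)

lemma tensor_differentiable_g: "nondeg w \<Longrightarrow> tensor_differentiable (\<lambda>w. g_expr w $ i $ j) w"
  unfolding tensor_differentiable_def
  by (rule Ck_on_differentiable[OF Ck_on_g[OF open_nondeg Ck_on_of_vec]]) auto

lemma tensor_differentiable_Psi: "nondeg w \<Longrightarrow> tensor_differentiable (\<lambda>w. Psi w m a b c) w"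
  unfolding tensor_differentiable_def
  by (rule Ck_on_differentiable[OF Ck_on_Psi[OF open_nondeg Ck_on_of_vec]]) auto

section \<open>Infinitesimal equivariance\<close>

lemma has_real_derivative_dd:
  fixes f :: "real \<Rightarrow> real"
  assumes "(f has_real_derivative d) (at x)"
  shows "f differentiable (at x)" "dd 1 f x = d"
  using assms unfolding has_field_derivative_def by (auto simp: differentiable_def dd_eq)

definition near_id :: "tensor2 \<Rightarrow> real \<Rightarrow> real^7^7" where
  "near_id M t = mat 1 + t *\<^sub>R (\<chi> i j. M i j)"

lemma op_near_id:
  "op1 (\<lambda>i j. near_id M t $ i $ j) w = (\<lambda>a b c. w a b c + t * op1 M w a b c)"
  "op2 (\<lambda>i j. near_id M t $ i $ j) w = (\<lambda>a b c. w a b c + t * op2 M w a b c)"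
  "op3 (\<lambda>i j. near_id M t $ i $ j) w = (\<lambda>a b c. w a b c + t * op3 M w a b c)"
  unfolding near_id_def op1_def op2_def op3_def mat_def vector_add_component vector_scaleR_component vec_lambda_beta
    real_scaleR_def distrib_right sum.distrib mult.assoc sum_distrib_left[symmetric] sum_delta7 by (rule refl)+

text \<open>The pullback is a cubic polynomial in t whose linear coefficient is
  \<open>act3 M w\<close>.\<close>

lemma pullback3_near_id_derivative:
  "((\<lambda>t. pullback3 (near_id M t) w a b c) has_real_derivative act3 M w a b c) (at 0)"
proof -
  have e: "pullback3 (near_id M t) w a b c = w a b c + t * op3 M w a b c + t * (op2 M w a b c + t * op2 M (op3 M w) a b c)
     + t * (op1 M w a b c + t * op1 M (op3 M w) a b c + t * (op1 M (op2 M w) a b c + t * op1 M (op2 M (op3 M w)) a b c))" for t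
    unfolding pullback3_def op_near_id op_add op_scale by (simp only: distrib_left ac_simps)
  show ?thesis unfolding e act3_op by (auto intro!: derivative_eq_intros)
qed

lemma near_id_0: "near_id M 0 = mat 1"
  by (simp add: near_id_def)

lemma near_id_det: "\<exists>e>0. \<forall>t. \<bar>t\<bar> < e \<longrightarrow> det (near_id M t) \<noteq> 0"
proof -
  have "Ck_on 0 UNIV (\<lambda>t::real. det (near_id M t))"
    by (intro Ck_on_det) (simp_all add: near_id_def continuous_intros)
  then have "isCont (\<lambda>t. det (near_id M t)) 0" by (simp add: continuous_on_eq_continuous_at)
  moreover have "det (near_id M 0) = 1" by (simp add: near_id_0)
  ultimately obtain e where "e > 0" "\<And>t. dist t 0 < e \<Longrightarrow> dist (det (near_id M t)) 1 < 1"
    unfolding continuous_at_eps_delta by (metis zero_less_one)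
  then show ?thesis by (intro exI[of _ e]) (force simp: dist_real_def)
qed

lemma tensor_chain_near_id:
  assumes "tensor_differentiable F w"
  shows "((\<lambda>t. F (pullback3 (near_id M t) w)) has_real_derivative tensor_deriv F w (act3 M w)) (at 0)"
proof -
  let ?c = "\<lambda>t. pullback3 (near_id M t) w"
  have c0: "?c 0 = w" by (simp add: near_id_0 pullback3_mat1)
  note d = has_real_derivative_dd[OF pullback3_near_id_derivative[of M w]]
  have "((\<lambda>t. F (?c t)) has_derivative (\<lambda>v. tensor_deriv F (?c 0) (\<lambda>a b c. dd v (\<lambda>t. ?c t a b c) 0))) (at 0)"
    by (rule tensor_chain) (use assms d in \<open>simp_all add: c0\<close>)
  then have D: "(\<lambda>t. F (?c t)) differentiable (at 0)"
    and E: "dd 1 (\<lambda>t. F (?c t)) 0 = tensor_deriv F w (act3 M w)"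
    by (auto simp: differentiable_def dd_eq c0 d)
  have "((\<lambda>s. F (?c (0 + s *\<^sub>R 1))) has_real_derivative dd 1 (\<lambda>t. F (?c t)) (0 + 0 *\<^sub>R 1)) (at 0)"
    by (rule has_real_derivative_line) (use D in simp)
  then show ?thesis by (simp add: E)
qed

lemma DERIV_unique_near:
  fixes f g :: "real \<Rightarrow> real"
  assumes "(f has_real_derivative a) (at 0)" "(g has_real_derivative b) (at 0)" "e > 0" "\<And>t. \<bar>t\<bar> < e \<Longrightarrow> f t = g t"
  shows "a = b"
proof -
  have "(f has_real_derivative b) (at 0)"
    by (rule DERIV_cong_ev[OF refl _ refl, THEN iffD2, OF _ assms(2)])
      (use assms(3,4) in \<open>auto simp: eventually_nhds_metric dist_real_def\<close>)
  then show ?thesis using assms(1) DERIV_unique by blast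
qed

text \<open>Differentiates the equivariance \<open>g_expr_pullback3\<close> along 1 + t M at t =
  0.\<close>

lemma g_expr_natural:
  assumes w: "nondeg w"
  shows "tensor_deriv (\<lambda>w. g_expr w $ i $ j) w (act3 M w) =
    (\<Sum>m\<in>UNIV. M m i * g_expr w $ m $ j) + (\<Sum>m\<in>UNIV. M m j * g_expr w $ i $ m)"
proof -
  obtain e where e: "e > 0" "\<And>t. \<bar>t\<bar> < e \<Longrightarrow> det (near_id M t) \<noteq> 0" using near_id_det by blast
  let ?g = "g_expr w"
  have "((\<lambda>t. (\<Sum>p\<in>UNIV. near_id M t $ p $ i * (\<Sum>q\<in>UNIV. ?g $ p $ q * near_id M t $ q $ j))) has_real_derivative
     (\<Sum>p\<in>UNIV. M p i * (\<Sum>q\<in>UNIV. ?g $ p $ q * (if q = j then 1 else 0)) + (if p = i then 1 else 0) * (\<Sum>q\<in>UNIV. ?g $ p $ q * M q j))) (at 0)"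
    unfolding near_id_def mat_def
    by (auto intro!: derivative_eq_intros sum.cong simp: field_simps)
  moreover have "(\<Sum>p\<in>UNIV. M p i * (\<Sum>q\<in>UNIV. ?g $ p $ q * (if q = j then 1 else 0)) + (if p = i then 1 else 0) * (\<Sum>q\<in>UNIV. ?g $ p $ q * M q j)) =
     (\<Sum>m\<in>UNIV. M m i * g_expr w $ m $ j) + (\<Sum>m\<in>UNIV. M m j * g_expr w $ i $ m)"
    unfolding sum.distrib sum_delta7 by (simp only: mult.commute[of "?g $ _ $ _"] sum_delta7)
  moreover have "g_expr (pullback3 (near_id M t) w) $ i $ j = (\<Sum>p\<in>UNIV. near_id M t $ p $ i * (\<Sum>q\<in>UNIV. ?g $ p $ q * near_id M t $ q $ j))" if "\<bar>t\<bar> < e" for t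
    unfolding g_expr_pullback3[OF e(2)[OF that]] matrix_matrix_mult_def transpose_def vec_lambda_beta by (rule refl)
  ultimately show ?thesis
    using DERIV_unique_near[OF tensor_chain_near_id[OF tensor_differentiable_g[OF w]] _ e(1)] by simp
qed

text \<open>Both sides contain \<open>L\<close> and neither contains its inverse, so that
  differentiation at the identity involves no derivative of an inverse matrix.\<close>

lemma Psi_pullback3:
  assumes L: "det L \<noteq> 0" and w: "nondeg w"
  shows "(\<Sum>m\<in>UNIV. L $ r $ m * Psi (pullback3 L w) m a b c) = pullback3 L (Psi w r) a b c"
proof -
  let ?G = "matrix_inv (g_expr w)" and ?S = "star4 (transpose (matrix_inv (g_expr w))) (nu_expr w) w"
  obtain K where LK: "L ** K = mat 1" using L invertible_det_nz[of L] unfolding invertible_def by blast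
  then have KL: "K ** L = mat 1" using matrix_left_right_inverse by blast
  have t: "transpose L ** transpose K = mat 1" "transpose K ** transpose L = mat 1"
    by (simp_all only: matrix_transpose_mul[symmetric] KL LK transpose_mat)
  have G': "matrix_inv (g_expr (pullback3 L w)) = K ** (?G ** transpose K)"
  proof (rule matrix_inv_eqI)
    have "transpose L ** (g_expr w ** L) ** (K ** (?G ** transpose K)) = transpose L ** (g_expr w ** ((L ** K) ** (?G ** transpose K)))"
      by (simp only: matrix_mul_assoc)
    also have "\<dots> = transpose L ** ((g_expr w ** ?G) ** transpose K)"
      by (simp only: LK matrix_mul_lid matrix_mul_assoc)
    finally show "g_expr (pullback3 L w) ** (K ** (?G ** transpose K)) = mat 1"
      by (simp only: g_expr_pullback3[OF L] matrix_inv_right[OF nondeg_det_g[OF w]] matrix_mul_lid t)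
  qed
  have s: "star4 (transpose (matrix_inv (g_expr (pullback3 L w)))) (nu_expr (pullback3 L w)) (pullback3 L w) n a b c =
    (\<Sum>n'\<in>UNIV. L $ n' $ n * pullback3 L (?S n') a b c)" for n
    unfolding nu_expr_pullback3
    by (rule star4_pullback[OF LK]) (simp only: G' matrix_transpose_mul transpose_transpose matrix_mul_assoc)
  have "(\<Sum>m\<in>UNIV. L $ r $ m * Psi (pullback3 L w) m a b c) =
    (\<Sum>m\<in>UNIV. L $ r $ m * (\<Sum>n\<in>UNIV. (K ** (?G ** transpose K)) $ m $ n * (\<Sum>n'\<in>UNIV. L $ n' $ n * pullback3 L (?S n') a b c)))"
    unfolding Psi_def s unfolding G' by (rule refl)
  also have "\<dots> = (L *v ((K ** (?G ** transpose K)) *v (transpose L *v (\<chi> n. pullback3 L (?S n) a b c)))) $ r"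
    unfolding matrix_vector_mult_def transpose_def vec_lambda_beta by (rule refl)
  also have "L *v ((K ** (?G ** transpose K)) *v (transpose L *v (\<chi> n. pullback3 L (?S n) a b c))) =
      (L ** ((K ** (?G ** transpose K)) ** transpose L)) *v (\<chi> n. pullback3 L (?S n) a b c)"
    by (simp only: matrix_vector_mul_assoc matrix_mul_assoc)
  also have "L ** ((K ** (?G ** transpose K)) ** transpose L) = (L ** K) ** (?G ** (transpose K ** transpose L))"
    by (simp only: matrix_mul_assoc)
  also have "\<dots> = ?G" by (simp only: LK t matrix_mul_lid matrix_mul_rid)
  also have "(?G *v (\<chi> n. pullback3 L (?S n) a b c)) $ r = (\<Sum>n\<in>UNIV. ?G $ r $ n * pullback3 L (?S n) a b c)"
    unfolding matrix_vector_mult_def vec_lambda_beta by (rule refl)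
  also have "\<dots> = pullback3 L (Psi w r) a b c"
    unfolding pullback3_def Psi_def[abs_def] op_sum by (rule refl)
  finally show ?thesis .
qed

text \<open>The derivative of \<open>Psi_pullback3\<close> along 1 + t M: the action in the three
  lower slots, minus a term for the upper index of \<open>Psi\<close>.\<close>

lemma Psi_natural:
  assumes w: "nondeg w"
  shows "tensor_deriv (\<lambda>w. Psi w r a b c) w (act3 M w) = act3 M (Psi w r) a b c - (\<Sum>m\<in>UNIV. M r m * Psi w m a b c)"
proof -
  obtain e where e: "e > 0" "\<And>t. \<bar>t\<bar> < e \<Longrightarrow> det (near_id M t) \<noteq> 0" using near_id_det by blast
  let ?P = "\<lambda>t m. Psi (pullback3 (near_id M t) w) m a b c"
  have "((\<lambda>t. ?P t r + t * (\<Sum>m\<in>UNIV. M r m * ?P t m)) has_real_derivative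
     tensor_deriv (\<lambda>w. Psi w r a b c) w (act3 M w) + (\<Sum>m\<in>UNIV. M r m * ?P 0 m)) (at 0)"
    by (auto intro!: derivative_eq_intros tensor_chain_near_id tensor_differentiable_Psi w)
  moreover have "?P t r + t * (\<Sum>m\<in>UNIV. M r m * ?P t m) = pullback3 (near_id M t) (Psi w r) a b c" if "\<bar>t\<bar> < e" for t
  proof -
    have "?P t r + t * (\<Sum>m\<in>UNIV. M r m * ?P t m) = (\<Sum>m\<in>UNIV. near_id M t $ r $ m * ?P t m)"
      unfolding near_id_def mat_def vector_add_component vector_scaleR_component vec_lambda_beta
        real_scaleR_def distrib_right sum.distrib mult.assoc sum_distrib_left[symmetric] sum_delta7 by (rule refl)
    then show ?thesis by (simp only: Psi_pullback3[OF e(2)[OF that] w])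
  qed
  ultimately have "tensor_deriv (\<lambda>w. Psi w r a b c) w (act3 M w) + (\<Sum>m\<in>UNIV. M r m * ?P 0 m) = act3 M (Psi w r) a b c"
    using DERIV_unique_near[OF _ pullback3_near_id_derivative e(1)] by blast
  then show ?thesis by (simp add: near_id_0 pullback3_mat1)
qed

section \<open>The torsion tensor\<close>

lemma g_expr_symmetric: "G2_form w \<Longrightarrow> g_expr w $ i $ j = g_expr w $ j $ i"
proof -
  assume "G2_form w"
  then obtain L K where "G2_frame L K w" by (rule G2_frame_exists)
  then have "g_expr w = transpose L ** L" by (rule G2_frame.g_frame)
  then have "transpose (g_expr w) = g_expr w" by (simp only: matrix_transpose_mul transpose_transpose)
  then have "transpose (g_expr w) $ j $ i = g_expr w $ j $ i" by (simp only:)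
  then show ?thesis unfolding transpose_def vec_lambda_beta .
qed

text \<open>The directions \<open>e\<close> lie in any normed space, so the same formula serves for
  a chart and for time times a chart with seven spatial directions.\<close>

definition christoffel_along :: "(7 \<Rightarrow> 'a::real_normed_vector) \<Rightarrow> ('a \<Rightarrow> tensor3) \<Rightarrow> 'a \<Rightarrow> 7 \<Rightarrow> 7 \<Rightarrow> 7 \<Rightarrow> real" where
  "christoffel_along e w z m i j = (1/2) * (\<Sum>l\<in>UNIV. matrix_inv (g_expr (w z)) $ m $ l *
     (dd (e i) (\<lambda>y. g_expr (w y) $ j $ l) z + dd (e j) (\<lambda>y. g_expr (w y) $ i $ l) z - dd (e l) (\<lambda>y. g_expr (w y) $ i $ j) z))"

definition cov_along :: "(7 \<Rightarrow> 'a::real_normed_vector) \<Rightarrow> ('a \<Rightarrow> tensor3) \<Rightarrow> 'a \<Rightarrow> 7 \<Rightarrow> tensor3" where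
  "cov_along e w z l a b c = dd (e l) (\<lambda>y. w y a b c) z - act3 (\<lambda>m a. christoffel_along e w z m l a) (w z) a b c"

text \<open>The left inverse of \<open>dot_Psi_coefficient\<close> applied to the covariant
  derivative. That it solves the torsion equation is \<open>cov_eq_dot\<close>.\<close>

definition torsion_along :: "(7 \<Rightarrow> 'a::real_normed_vector) \<Rightarrow> ('a \<Rightarrow> tensor3) \<Rightarrow> 'a \<Rightarrow> tensor2" where
  "torsion_along e w z l m = (1/24) * pair3 (pullback3 (transpose (matrix_inv (g_expr (w z)))) (cov_along e w z l))
     (star4 (transpose (matrix_inv (g_expr (w z)))) (nu_expr (w z)) (w z) m)"

lemma dot_Psi_coefficient_G2:
  assumes "G2_form w"
  shows "(1/24) * pair3 (pullback3 (transpose (matrix_inv (g_expr w))) (dot x (Psi w)))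
     (star4 (transpose (matrix_inv (g_expr w))) (nu_expr w) w l) = x l"
  using G2_frame.dot_Psi_coefficient G2_frame_exists[OF assms] by metis

lemma dot_Psi_inject:
  assumes "G2_form w" "\<And>a b c. dot x (Psi w) a b c = dot y (Psi w) a b c"
  shows "x = y"
proof -
  have "dot x (Psi w) = dot y (Psi w)" using assms(2) by (intro ext)
  then have "x l = y l" for l using dot_Psi_coefficient_G2[OF assms(1), of x l] dot_Psi_coefficient_G2[OF assms(1), of y l] by (simp only:)
  then show ?thesis by (rule ext)
qed

text \<open>\<open>S\<close> may be a chart image or an interval times one. Derivatives in
  directions other than the \<open>e i\<close> exist as well and are used for time.\<close>

locale G2_field =
  fixes S :: "'a::euclidean_space set" and w :: "'a \<Rightarrow> tensor3" and e :: "7 \<Rightarrow> 'a"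
  assumes S: "open S" and e: "\<And>i. e i \<in> Basis"
    and smooth: "\<And>k a b c. Ck_on k S (\<lambda>z. w z a b c)"
    and alt: "\<And>z. z \<in> S \<Longrightarrow> alt3 (w z)" and G2: "\<And>z. z \<in> S \<Longrightarrow> G2_form (w z)"
begin

abbreviation g where "g z i j \<equiv> g_expr (w z) $ i $ j"
abbreviation \<Gamma> where "\<Gamma> z l \<equiv> (\<lambda>m a. christoffel_along e w z m l a)"
abbreviation T where "T z \<equiv> torsion_along e w z"

lemma nd: "z \<in> S \<Longrightarrow> nondeg (w z)"
  by (rule nondeg_G2[OF G2])

lemma smooth_g: "Ck_on k S (\<lambda>z. g z i j)"
  by (rule Ck_on_g[OF S smooth nd])

lemma smooth_Psi: "Ck_on k S (\<lambda>z. Psi (w z) m a b c)"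
  by (rule Ck_on_Psi[OF S smooth nd])

lemma smooth_dd: "(\<And>k. Ck_on k S f) \<Longrightarrow> b \<in> Basis \<Longrightarrow> Ck_on k S (dd b f)"
proof -
  assume f: "\<And>k. Ck_on k S f" and b: "b \<in> Basis"
  have "Ck_on (Suc k) S f" by (rule f)
  with b show ?thesis by simp
qed

lemma smooth_christoffel: "Ck_on k S (\<lambda>z. christoffel_along e w z m i j)"
  unfolding christoffel_along_def
  by (intro Ck_on_cmult Ck_on_sum Ck_on_mult Ck_on_add Ck_on_diff S Ck_on_ginv[OF S smooth nd] smooth_dd smooth_g e)

lemma smooth_cov: "Ck_on k S (\<lambda>z. cov_along e w z l a b c)"
  unfolding cov_along_def act3_def
  by (intro Ck_on_sum Ck_on_mult Ck_on_add Ck_on_diff S smooth_dd smooth_christoffel smooth e)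

lemma smooth_torsion: "Ck_on k S (\<lambda>z. T z l m)"
  unfolding torsion_along_def pair3_def pullback3_sums transpose_def vec_lambda_beta
  by (intro Ck_on_cmult Ck_on_sum Ck_on_mult S Ck_on_ginv[OF S smooth nd] smooth_cov Ck_on_star[OF S smooth nd, unfolded transpose_def])

lemma diff_of_smooth: "(\<And>k. Ck_on k S f) \<Longrightarrow> z \<in> S \<Longrightarrow> f differentiable (at z)"
proof -
  assume f: "\<And>k. Ck_on k S f" and z: "z \<in> S"
  have "Ck_on (Suc 0) S f" by (rule f)
  then show ?thesis using z by (rule Ck_on_differentiable)
qed

lemma g_sym: "z \<in> S \<Longrightarrow> g z i j = g z j i"
  by (rule g_expr_symmetric[OF G2])

lemma dg_sym: "z \<in> S \<Longrightarrow> dd v (\<lambda>y. g y i j) z = dd v (\<lambda>y. g y j i) z"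
  by (rule dd_cong[OF S]) (auto intro: g_sym)

lemma christoffel_sym: "z \<in> S \<Longrightarrow> christoffel_along e w z m i j = christoffel_along e w z m j i"
  unfolding christoffel_along_def dg_sym[where z = z and i = i and j = j] by (simp only: add.commute)

lemma christoffel_lower:
  assumes z: "z \<in> S"
  shows "(\<Sum>m\<in>UNIV. christoffel_along e w z m l i * g z m j) =
    (1/2) * (dd (e l) (\<lambda>y. g y i j) z + dd (e i) (\<lambda>y. g y l j) z - dd (e j) (\<lambda>y. g y l i) z)"
proof -
  let ?P = "\<lambda>k. dd (e l) (\<lambda>y. g y i k) z + dd (e i) (\<lambda>y. g y l k) z - dd (e k) (\<lambda>y. g y l i) z"
  let ?h = "\<lambda>m k. matrix_inv (g_expr (w z)) $ m $ k"
  have "g_expr (w z) ** matrix_inv (g_expr (w z)) = mat 1" by (rule matrix_inv_right[OF nondeg_det_g[OF nd[OF z]]])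
  then have "(g_expr (w z) ** matrix_inv (g_expr (w z))) $ j $ k = mat 1 $ j $ k" for k by (simp only:)
  then have d: "(\<Sum>m\<in>UNIV. g z j m * ?h m k) = (if j = k then 1 else 0)" for k
    unfolding matrix_matrix_mult_def mat_def vec_lambda_beta .
  have "(\<Sum>m\<in>UNIV. christoffel_along e w z m l i * g z m j) = (\<Sum>m\<in>UNIV. g z j m * (\<Sum>k\<in>UNIV. ?h m k * ((1/2) * ?P k)))"
    unfolding christoffel_along_def g_sym[OF z, of _ j] by (simp only: sum_distrib_left ac_simps)
  also have "\<dots> = (\<Sum>k\<in>UNIV. (\<Sum>m\<in>UNIV. g z j m * ?h m k) * ((1/2) * ?P k))"
    unfolding sum_mcomp by (simp only: mult.commute)
  also have "\<dots> = (1/2) * ?P j" unfolding d sum_delta7 ..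
  finally show ?thesis .
qed

lemma metric_compatible:
  assumes z: "z \<in> S"
  shows "dd (e l) (\<lambda>y. g y i j) z = (\<Sum>m\<in>UNIV. \<Gamma> z l m i * g z m j) + (\<Sum>m\<in>UNIV. \<Gamma> z l m j * g z i m)"
  unfolding g_sym[OF z, of i] christoffel_lower[OF z]
  using dg_sym[OF z, where v = "e l" and i = j and j = i] by argo

lemma alt_cov:
  assumes z: "z \<in> S"
  shows "alt3 (cov_along e w z l)"
proof -
  have 1: "dd v (\<lambda>y. w y b a c) z = - dd v (\<lambda>y. w y a b c) z" "dd v (\<lambda>y. w y a c b) z = - dd v (\<lambda>y. w y a b c) z" for v a b c
  proof -
    have d: "(\<lambda>y. w y a b c) differentiable (at z)" by (rule diff_of_smooth[OF smooth z])
    have "dd v (\<lambda>y. w y b a c) z = dd v (\<lambda>y. - w y a b c) z" "dd v (\<lambda>y. w y a c b) z = dd v (\<lambda>y. - w y a b c) z"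
      by (rule dd_cong[OF S z], rule alt3D[OF alt], assumption)+
    then show "dd v (\<lambda>y. w y b a c) z = - dd v (\<lambda>y. w y a b c) z" "dd v (\<lambda>y. w y a c b) z = - dd v (\<lambda>y. w y a b c) z"
      unfolding dd_minus[OF d] .
  qed
  note 2 = alt3D[OF alt3_act3[OF alt[OF z]]]
  show ?thesis unfolding alt3_def cov_along_def
  proof (intro allI conjI)
    fix a b c
    let ?A = "act3 (\<lambda>m a. christoffel_along e w z m l a) (w z)"
    show "dd (e l) (\<lambda>y. w y b a c) z - ?A b a c = - (dd (e l) (\<lambda>y. w y a b c) z - ?A a b c)"
      using 1(1)[where v = "e l" and a = a and b = b and c = c] 2(1)[of "\<lambda>m a. christoffel_along e w z m l a" b a c] by linarith
    show "dd (e l) (\<lambda>y. w y a c b) z - ?A a c b = - (dd (e l) (\<lambda>y. w y a b c) z - ?A a b c)"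
      using 1(2)[where v = "e l" and a = a and b = b and c = c] 2(2)[of "\<lambda>m a. christoffel_along e w z m l a" a c b] by linarith
  qed
qed

lemma chain_w:
  assumes z: "z \<in> S" and F: "tensor_differentiable F (w z)"
  shows "dd v (\<lambda>y. F (w y)) z = tensor_deriv F (w z) (\<lambda>a b c. dd v (\<lambda>y. w y a b c) z)"
  by (rule dd_eq[OF tensor_chain[OF F diff_of_smooth[OF smooth z]]])

text \<open>Write \<nabla>_l w as \<open>act3 M w\<close>. By the chain rule the derivative of
  \<open>g_expr\<close> in this direction is the covariant derivative of the metric, hence zero; by
  \<open>g_expr_natural\<close> it is the symmetric part of \<open>M\<close> with its index lowered.
  So \<open>M\<close> is skew and \<open>act3_skew_frame\<close> applies.\<close>

lemma cov_eq_dot: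
  assumes z: "z \<in> S"
  shows "cov_along e w z l = dot (T z l) (Psi (w z))"
proof -
  obtain L K where fr: "G2_frame L K (w z)" using G2_frame_exists[OF G2[OF z]] .
  obtain M where M: "cov_along e w z l = act3 M (w z)"
    using G2_frame.alternating_act3_frame[OF fr alt_cov[OF z]] by blast
  have "(\<Sum>m\<in>UNIV. M m i * g z m j) + (\<Sum>m\<in>UNIV. M m j * g z m i) = 0" for i j
  proof -
    note td = tensor_differentiable_g[OF nd[OF z]]
    have "tensor_deriv (\<lambda>w. g_expr w $ i $ j) (w z) (cov_along e w z l) =
       tensor_deriv (\<lambda>w. g_expr w $ i $ j) (w z) (\<lambda>a b c. dd (e l) (\<lambda>y. w y a b c) z) -
       tensor_deriv (\<lambda>w. g_expr w $ i $ j) (w z) (act3 (\<Gamma> z l) (w z))"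
      unfolding tensor_deriv_linear(2)[OF td, symmetric] cov_along_def[abs_def] by (rule refl)
    also have "\<dots> = 0"
      unfolding chain_w[OF z td, symmetric] g_expr_natural[OF nd[OF z]] metric_compatible[OF z] by (rule diff_self)
    finally show ?thesis unfolding M g_expr_natural[OF nd[OF z]] g_sym[OF z, of i] .
  qed
  then have *: "cov_along e w z l = dot (\<lambda>l. - (1/2) * lowered_dual (w z) M l) (Psi (w z))"
    unfolding M by (rule G2_frame.act3_skew_frame[OF fr])
  moreover have "T z l = (\<lambda>l. - (1/2) * lowered_dual (w z) M l)"
    unfolding torsion_along_def[abs_def] * dot_Psi_coefficient_G2[OF G2[OF z]] by (rule refl)
  ultimately show ?thesis by (simp only:)
qed

lemma torsion_equation:
  assumes z: "z \<in> S"
  shows "dd (e l) (\<lambda>y. w y a b c) z = act3 (\<Gamma> z l) (w z) a b c + dot (T z l) (Psi (w z)) a b c"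
  unfolding cov_eq_dot[OF z, symmetric] cov_along_def by simp

end

text \<open>With \<open>r = 1\<close> this is the action on covariant 3-tensors, and with \<open>r = 0\<close> the action on
  covariant 2-tensors carrying an inert third index; the commutator formula only needs \<open>r * r = r\<close>.\<close>

definition gact :: "real \<Rightarrow> tensor2 \<Rightarrow> tensor3 \<Rightarrow> tensor3" where
  "gact r M q a b c = op1 M q a b c + op2 M q a b c + r * op3 M q a b c"

lemma gact_1: "gact 1 M q = act3 M q"
  unfolding fun_eq_iff gact_def act3_op by simp

lemma gact_0: "gact 0 M (\<lambda>a b c. s a b) a b c = (\<Sum>m\<in>UNIV. M m a * s m b) + (\<Sum>m\<in>UNIV. M m b * s a m)"
  unfolding gact_def op1_def op2_def by simp

lemma gact_add: "gact r M (\<lambda>a b c. u a b c + v a b c) a b c = gact r M u a b c + gact r M v a b c"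
  unfolding gact_def op_add by (simp only: distrib_left)

lemma gact_sum: "gact r M (\<lambda>a b c. \<Sum>i\<in>UNIV. x i * F i a b c) a b c = (\<Sum>i\<in>(UNIV :: 7 set). x i * gact r M (F i) a b c)"
  unfolding gact_def op_sum by (simp only: distrib_left sum.distrib sum_distrib_left mult.left_commute[of r])

lemma gact_mat_linear:
  "gact r (\<lambda>i j. A i j + B i j) q a b c = gact r A q a b c + gact r B q a b c"
  "gact r (\<lambda>i j. A i j - B i j) q a b c = gact r A q a b c - gact r B q a b c"
  "gact r (\<lambda>i j. \<Sum>k\<in>UNIV. x k * F k i j) q a b c = (\<Sum>k\<in>(UNIV :: 7 set). x k * gact r (F k) q a b c)"
proof -
  show "gact r (\<lambda>i j. A i j + B i j) q a b c = gact r A q a b c + gact r B q a b c"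
    unfolding gact_def op1_def op2_def op3_def distrib_right sum.distrib distrib_left by simp
  show "gact r (\<lambda>i j. A i j - B i j) q a b c = gact r A q a b c - gact r B q a b c"
    unfolding gact_def op1_def op2_def op3_def left_diff_distrib sum_subtractf right_diff_distrib by simp
  have *: "(\<Sum>d\<in>UNIV. (\<Sum>k\<in>UNIV. x k * G k d) * H d) = (\<Sum>k\<in>(UNIV :: 7 set). x k * (\<Sum>d\<in>(UNIV :: 7 set). G k d * (H d :: real)))" for G H
    unfolding sum_distrib_left sum_distrib_right by (subst sum.swap) (simp only: mult.assoc)
  have **: "r * (\<Sum>k\<in>UNIV. x k * Z k) = (\<Sum>k\<in>(UNIV :: 7 set). x k * (r * Z k))" for Z
    by (simp only: sum_distrib_left mult.left_commute)
  show "gact r (\<lambda>i j. \<Sum>k\<in>UNIV. x k * F k i j) q a b c = (\<Sum>k\<in>(UNIV :: 7 set). x k * gact r (F k) q a b c)"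
    unfolding gact_def op1_def op2_def op3_def * ** distrib_left sum.distrib by (rule refl)
qed

lemma gact_commutator:
  assumes r: "r * r = r"
  shows "gact r M (gact r N q) a b c - gact r N (gact r M q) a b c = gact r (\<lambda>i j. mcomp N M i j - mcomp M N i j) q a b c"
proof -
  have e: "gact r N q = (\<lambda>a b c. op1 N q a b c + op2 N q a b c + r * op3 N q a b c)" for N q
    by (simp only: fun_eq_iff gact_def simp_thms)
  have rr: "r * (r * x) = r * x" for x using r by (simp only: mult.assoc[symmetric])
  show ?thesis
    unfolding e op_add op_scale op_diff_left
    by (simp only: op_commute op_comp distrib_left right_diff_distrib rr)
qed

lemma dd_gact:
  fixes M :: "'a::real_normed_vector \<Rightarrow> tensor2"
  assumes M: "\<And>i j. (\<lambda>y. M y i j) differentiable (at z)" and q: "\<And>a b c. (\<lambda>y. q y a b c) differentiable (at z)"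
  shows "dd v (\<lambda>y. gact r (M y) (q y) a b c) z =
    gact r (\<lambda>i j. dd v (\<lambda>y. M y i j) z) (q z) a b c + gact r (M z) (\<lambda>a b c. dd v (\<lambda>y. q y a b c) z) a b c"
proof -
  have s: "((\<lambda>y. \<Sum>d\<in>UNIV. f d y * h d y) has_derivative (\<lambda>v. (\<Sum>d\<in>UNIV. f d z * dd v (h d) z + dd v (f d) z * h d z))) (at z)"
    if "\<And>d. f d differentiable (at z)" "\<And>d. h d differentiable (at z)" for f h :: "7 \<Rightarrow> 'a \<Rightarrow> real"
    by (intro has_derivative_sum has_derivative_mult has_derivative_dd that)
  show ?thesis
    unfolding gact_def op1_def op2_def op3_def
    by (rule trans, rule dd_eq, (rule has_derivative_add has_derivative_mult_right s M q)+) (simp add: sum.distrib distrib_left)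
qed

lemma dd_dot:
  fixes x :: "'a::real_normed_vector \<Rightarrow> 7 \<Rightarrow> real"
  assumes "\<And>m. (\<lambda>y. x y m) differentiable (at z)" "\<And>m. (\<lambda>y. P y m a b c) differentiable (at z)"
  shows "dd v (\<lambda>y. dot (x y) (P y) a b c) z = dot (\<lambda>m. dd v (\<lambda>y. x y m) z) (P z) a b c + (\<Sum>m\<in>UNIV. x z m * dd v (\<lambda>y. P y m a b c) z)"
  unfolding dot_def
  by (rule trans, rule dd_eq, (rule has_derivative_sum has_derivative_mult has_derivative_dd assms)+) (simp add: sum.distrib)

lemma dot_natural:
  "(\<Sum>r\<in>UNIV. x r * (act3 M (P r) a b c - (\<Sum>m\<in>UNIV. M r m * P m a b c))) =
    act3 M (dot x P) a b c - dot (\<lambda>m. \<Sum>r\<in>UNIV. M r m * x r) P a b c"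
proof -
  have "act3 M (dot x P) a b c = (\<Sum>r\<in>UNIV. x r * act3 M (P r) a b c)"
    unfolding gact_1[symmetric] dot_def[abs_def] by (rule gact_sum)
  moreover have "(\<Sum>r\<in>UNIV. x r * (\<Sum>m\<in>UNIV. M r m * P m a b c)) = dot (\<lambda>m. \<Sum>r\<in>UNIV. M r m * x r) P a b c"
    unfolding dot_def by (rule sum_mcomp)
  ultimately show ?thesis by (simp only: right_diff_distrib sum_subtractf)
qed

lemma dot_diff: "dot (\<lambda>m. x m - y m) P a b c = dot x P a b c - dot y P a b c"
  unfolding dot_def by (simp only: left_diff_distrib sum_subtractf)

lemma dot_add: "dot (\<lambda>m. x m + y m) P a b c = dot x P a b c + dot y P a b c"
  unfolding dot_def by (simp only: distrib_right sum.distrib)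

lemma dot_scale: "dot (\<lambda>m. k * x m) P a b c = k * dot x P a b c"
  unfolding dot_def by (simp only: mult.assoc sum_distrib_left)

text \<open>Removes the frame from the statements of \<open>act3_cross_frame\<close>. The matrices
  \<open>C\<close> are chosen at a single point, so no smooth choice of frames is made.\<close>

lemma G2_cross_exists:
  assumes "G2_form w"
  shows "\<exists>C. (\<forall>T. act3 (C T) w = dot T (Psi w)) \<and>
    (\<forall>S T l. (\<Sum>p\<in>UNIV. C S p l * T p) = (1/3) * raised_cross w S T l) \<and>
    (\<forall>S T. act3 (\<lambda>i j. mcomp (C T) (C S) i j - mcomp (C S) (C T) i j) w = dot (\<lambda>l. - (1/3) * raised_cross w S T l) (Psi w))"
proof -
  obtain L K where "G2_frame L K w" using G2_frame_exists[OF assms] .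
  note C = G2_frame.act3_cross_frame[OF this]
  show ?thesis by (intro exI conjI allI) (rule C)+
qed

text \<open>Swapping \<open>S\<close> and \<open>T\<close> reverses the commutator; injectivity of
  \<open>dot\<close> transfers the sign to its coefficients.\<close>

lemma raised_cross_swap:
  assumes w: "G2_form w"
  shows "raised_cross w T S l = - raised_cross w S T l"
proof -
  obtain C where C: "\<And>S T. act3 (\<lambda>i j. mcomp (C T) (C S) i j - mcomp (C S) (C T) i j) w = dot (\<lambda>l. - (1/3) * raised_cross w S T l) (Psi w)"
    using G2_cross_exists[OF w] by blast
  have "dot (\<lambda>l. - (1/3) * raised_cross w T S l) (Psi w) a b c = dot (\<lambda>l. (1/3) * raised_cross w S T l) (Psi w) a b c" for a b c
  proof -
    have "dot (\<lambda>l. - (1/3) * raised_cross w T S l) (Psi w) a b c = - dot (\<lambda>l. - (1/3) * raised_cross w S T l) (Psi w) a b c"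
      unfolding C[symmetric] gact_1[symmetric] gact_mat_linear by simp
    then show ?thesis unfolding dot_scale by simp
  qed
  then have "(\<lambda>l. - (1/3) * raised_cross w T S l) = (\<lambda>l. (1/3) * raised_cross w S T l)" by (rule dot_Psi_inject[OF w])
  from fun_cong[OF this, of l] show ?thesis by simp
qed

section \<open>Curvature and the identity for the torsion\<close>

context G2_field
begin

text \<open>Both orders of differentiating \<open>q\<close> along \<open>e i\<close> and
  \<open>e j\<close> are expanded by the equation for \<open>q\<close>. The connection matrices and
  their derivatives assemble into the curvature acting on \<open>q\<close>; the rest is the
  antisymmetrised covariant derivative of \<open>t\<close>.\<close>

lemma gact_curvature:
  assumes z: "z \<in> S" and r: "r * r = r"
    and q: "\<And>k a b c. Ck_on k S (\<lambda>y. q y a b c)" and t: "\<And>k l a b c. Ck_on k S (\<lambda>y. t y l a b c)"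
    and eq: "\<And>y l a b c. y \<in> S \<Longrightarrow> dd (e l) (\<lambda>y. q y a b c) y = gact r (\<Gamma> y l) (q y) a b c + t y l a b c"
  defines "D \<equiv> \<lambda>i j m k. dd (e i) (\<lambda>y. \<Gamma> y j m k) z"
  shows "gact r (\<lambda>m k. (D i j m k - D j i m k) + (mcomp (\<Gamma> z i) (\<Gamma> z j) m k - mcomp (\<Gamma> z j) (\<Gamma> z i) m k)) (q z) a b c +
     (dd (e i) (\<lambda>y. t y j a b c) z + gact r (\<Gamma> z j) (t z i) a b c) - (dd (e j) (\<lambda>y. t y i a b c) z + gact r (\<Gamma> z i) (t z j) a b c) = 0"
proof -
  have *: "dd (e i) (\<lambda>y. dd (e j) (\<lambda>y. q y a b c) y) z =
     gact r (D i j) (q z) a b c + (gact r (\<Gamma> z j) (gact r (\<Gamma> z i) (q z)) a b c + gact r (\<Gamma> z j) (t z i) a b c) + dd (e i) (\<lambda>y. t y j a b c) z" for i j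
  proof -
    have dG: "\<And>m k. (\<lambda>y. \<Gamma> y j m k) differentiable (at z)" by (rule diff_of_smooth[OF smooth_christoffel z])
    have dq: "\<And>a b c. (\<lambda>y. q y a b c) differentiable (at z)" by (rule diff_of_smooth[OF q z])
    have dt: "(\<lambda>y. t y j a b c) differentiable (at z)" by (rule diff_of_smooth[OF t z])
    have dg: "(\<lambda>y. gact r (\<Gamma> y j) (q y) a b c) differentiable (at z)"
      unfolding gact_def op1_def op2_def op3_def
      by (rule diff_of_smooth[OF _ z]) (intro Ck_on_add Ck_on_sum Ck_on_mult Ck_on_cmult S smooth_christoffel q)
    have "dd (e i) (\<lambda>y. dd (e j) (\<lambda>y. q y a b c) y) z = dd (e i) (\<lambda>y. gact r (\<Gamma> y j) (q y) a b c + t y j a b c) z"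
      by (rule dd_cong[OF S z]) (rule eq)
    also have "\<dots> = gact r (D i j) (q z) a b c + gact r (\<Gamma> z j) (\<lambda>a b c. dd (e i) (\<lambda>y. q y a b c) z) a b c + dd (e i) (\<lambda>y. t y j a b c) z"
      unfolding dd_add[OF dg dt] dd_gact[OF dG dq] D_def by (rule refl)
    also have "(\<lambda>a b c. dd (e i) (\<lambda>y. q y a b c) z) = (\<lambda>a b c. gact r (\<Gamma> z i) (q z) a b c + t z i a b c)"
      by (simp only: eq[OF z])
    finally show ?thesis unfolding gact_add .
  qed
  have c: "dd (e i) (\<lambda>y. dd (e j) (\<lambda>y. q y a b c) y) z = dd (e j) (\<lambda>y. dd (e i) (\<lambda>y. q y a b c) y) z"
    by (rule dd_commute[OF S z q e e])
  have "gact r (\<Gamma> z j) (gact r (\<Gamma> z i) (q z)) a b c - gact r (\<Gamma> z i) (gact r (\<Gamma> z j) (q z)) a b c =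
      gact r (\<lambda>m k. mcomp (\<Gamma> z i) (\<Gamma> z j) m k - mcomp (\<Gamma> z j) (\<Gamma> z i) m k) (q z) a b c"
    by (rule gact_commutator[OF r])
  then show ?thesis
    using c unfolding * gact_mat_linear(1) gact_mat_linear(2)[of r "D i j"] by linarith
qed

text \<open>R^m_ijk as a matrix in m and k for fixed i and j.\<close>

definition curv :: "'a \<Rightarrow> 7 \<Rightarrow> 7 \<Rightarrow> tensor2" where
  "curv z i j m k = (dd (e i) (\<lambda>y. \<Gamma> y j m k) z - dd (e j) (\<lambda>y. \<Gamma> y i m k) z) + (mcomp (\<Gamma> z i) (\<Gamma> z j) m k - mcomp (\<Gamma> z j) (\<Gamma> z i) m k)"

text \<open>\<open>gact_curvature\<close> with r = 0, the metric as \<open>q\<close> and t = 0: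
  curvature annihilates a parallel tensor. The third index is inert and is filled with
  \<open>undefined\<close>.\<close>

lemma curv_skew:
  assumes z: "z \<in> S"
  shows "(\<Sum>m\<in>UNIV. curv z i j m a * g z m b) + (\<Sum>m\<in>UNIV. curv z i j m b * g z m a) = 0"
proof -
  have "gact 0 (\<Gamma> z j) (\<lambda>a b c. 0) a b c = 0" for j a b c
    unfolding gact_def op1_def op2_def by simp
  then have "gact 0 (curv z i j) (\<lambda>a b c. g z a b) a b undefined = 0"
    using gact_curvature[OF z, where r = 0 and q = "\<lambda>y a b c. g y a b" and t = "\<lambda>y l a b c. 0" and i = i and j = j and a = a and b = b and c = undefined]
    unfolding curv_def[abs_def] gact_0 by (simp add: smooth_g Ck_on_const metric_compatible)
  then show ?thesis unfolding gact_0 g_sym[OF z, of a] .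
qed

lemma dd_Psi:
  assumes z: "z \<in> S" and D: "\<And>a b c. dd v (\<lambda>y. w y a b c) z = act3 A (w z) a b c + act3 B (w z) a b c"
  shows "dd v (\<lambda>y. Psi (w y) m a b c) z = (act3 A (Psi (w z) m) a b c - (\<Sum>n\<in>UNIV. A m n * Psi (w z) n a b c)) +
     (act3 B (Psi (w z) m) a b c - (\<Sum>n\<in>UNIV. B m n * Psi (w z) n a b c))"
proof -
  note td = tensor_differentiable_Psi[OF nd[OF z]]
  show ?thesis
    unfolding chain_w[OF z td] D tensor_deriv_linear(1)[OF td] Psi_natural[OF nd[OF z]] by (rule refl)
qed

text \<open>\<open>gact_curvature\<close> with r = 1 and \<open>t\<close> the torsion term. The
  cross product of the two torsion rows arises with coefficient 1/3 three times: from the commutator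
  of the matrices \<open>C\<close>, and from the upper index of \<open>Psi\<close> in each of the
  two derivatives. The curvature enters through its R^7 part.\<close>

lemma torsion_bianchi:
  assumes z: "z \<in> S"
  shows "(dd (e i) (\<lambda>y. T y j l) z - (\<Sum>m\<in>UNIV. \<Gamma> z i m l * T z j m)) - (dd (e j) (\<lambda>y. T y i l) z - (\<Sum>m\<in>UNIV. \<Gamma> z j m l * T z i m))
    = raised_cross (w z) (T z i) (T z j) l + (1/2) * lowered_dual (w z) (curv z i j) l"
proof -
  let ?P = "Psi (w z)"
  obtain L K where fr: "G2_frame L K (w z)" using G2_frame_exists[OF G2[OF z]] .
  obtain C where C1: "\<And>T. act3 (C T) (w z) = dot T ?P"
    and C2: "\<And>S T l. (\<Sum>p\<in>UNIV. C S p l * T p) = (1/3) * raised_cross (w z) S T l"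
    and C3: "\<And>S T. act3 (\<lambda>i j. mcomp (C T) (C S) i j - mcomp (C S) (C T) i j) (w z) = dot (\<lambda>l. - (1/3) * raised_cross (w z) S T l) ?P"
    using G2_cross_exists[OF G2[OF z]] by blast
  let ?t = "\<lambda>y l. dot (T y l) (Psi (w y))"
  have st: "Ck_on k S (\<lambda>y. ?t y l a b c)" for k l a b c
    unfolding dot_def by (intro Ck_on_sum Ck_on_mult S smooth_torsion smooth_Psi)
  have R: "act3 (curv z i j) (w z) a b c = dot (\<lambda>l. - (1/2) * lowered_dual (w z) (curv z i j) l) ?P a b c" for a b c
    by (simp only: G2_frame.act3_skew_frame[OF fr curv_skew[OF z]])
  have dt: "dd (e i) (\<lambda>y. ?t y j a b c) z = dot (\<lambda>l. dd (e i) (\<lambda>y. T y j l) z) ?P a b c +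
      (act3 (\<Gamma> z i) (?t z j) a b c - dot (\<lambda>l. \<Sum>m\<in>UNIV. \<Gamma> z i m l * T z j m) ?P a b c) +
      (act3 (C (T z i)) (act3 (C (T z j)) (w z)) a b c - dot (\<lambda>l. (1/3) * raised_cross (w z) (T z i) (T z j) l) ?P a b c)" for i j a b c
  proof -
    have D: "dd (e i) (\<lambda>y. w y a b c) z = act3 (\<Gamma> z i) (w z) a b c + act3 (C (T z i)) (w z) a b c" for a b c
      unfolding torsion_equation[OF z] C1 ..
    have "(\<Sum>m\<in>UNIV. T z j m * dd (e i) (\<lambda>y. Psi (w y) m a b c) z) =
      (act3 (\<Gamma> z i) (?t z j) a b c - dot (\<lambda>l. \<Sum>m\<in>UNIV. \<Gamma> z i m l * T z j m) ?P a b c) +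
      (act3 (C (T z i)) (?t z j) a b c - dot (\<lambda>l. \<Sum>m\<in>UNIV. C (T z i) m l * T z j m) ?P a b c)"
      unfolding dd_Psi[OF z D] distrib_left[of "T _ _ _"] sum.distrib dot_natural[where M = "\<Gamma> z i"] dot_natural[where M = "C (T z i)"] by (rule refl)
    then show ?thesis
      unfolding C2 C1[symmetric, of "T z j"]
      by (subst dd_dot) (simp_all only: diff_of_smooth[OF smooth_torsion z] diff_of_smooth[OF smooth_Psi z] C1)
  qed
  have cc: "act3 (C (T z i)) (act3 (C (T z j)) (w z)) a b c - act3 (C (T z j)) (act3 (C (T z i)) (w z)) a b c =
      dot (\<lambda>l. - (1/3) * raised_cross (w z) (T z i) (T z j) l) ?P a b c" for a b c
    unfolding C3[symmetric] by (rule act3_commutator)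
  have sw: "dot (\<lambda>l. (1/3) * raised_cross (w z) (T z j) (T z i) l) ?P a b c = - dot (\<lambda>l. (1/3) * raised_cross (w z) (T z i) (T z j) l) ?P a b c" for a b c
    unfolding raised_cross_swap[OF G2[OF z], where T = "T z j" and S = "T z i"] dot_scale dot_def by (simp add: sum_negf)
  have curvature: "act3 (curv z i j) (w z) a b c + (dd (e i) (\<lambda>y. ?t y j a b c) z + act3 (\<Gamma> z j) (?t z i) a b c)
     - (dd (e j) (\<lambda>y. ?t y i a b c) z + act3 (\<Gamma> z i) (?t z j) a b c) = 0" for a b c
    using gact_curvature[OF z, where r = 1 and q = w and t = ?t and i = i and j = j and a = a and b = b and c = c] smooth st torsion_equation
    unfolding gact_1 curv_def[abs_def] by simp
  have "dot (\<lambda>l. (dd (e i) (\<lambda>y. T y j l) z - (\<Sum>m\<in>UNIV. \<Gamma> z i m l * T z j m)) - (dd (e j) (\<lambda>y. T y i l) z - (\<Sum>m\<in>UNIV. \<Gamma> z j m l * T z i m))) ?P a b c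
    = dot (\<lambda>l. raised_cross (w z) (T z i) (T z j) l + (1/2) * lowered_dual (w z) (curv z i j) l) ?P a b c" for a b c
    using curvature[of a b c] cc[of a b c] sw[of a b c]
    unfolding dt R dot_diff dot_add dot_scale by linarith
  from fun_cong[OF dot_Psi_inject[OF G2[OF z] this], of l] show ?thesis .
qed

end

section \<open>Diffeomorphism invariance\<close>

text \<open>\<open>H\<close> is the difference of two torsion-free metric connections. With its
  upper index lowered it is symmetric in one pair of indices and skew in another, and alternating
  the two relations gives h = -h.\<close>

lemma levi_civita_unique:
  fixes H :: "7 \<Rightarrow> tensor2" and G :: "real^7^7"
  assumes G: "det G \<noteq> 0" and Gs: "\<And>i j. G $ i $ j = G $ j $ i"
    and sym: "\<And>l m a. H l m a = H a m l"
    and comp: "\<And>l i j. (\<Sum>m\<in>UNIV. H l m i * G $ m $ j) + (\<Sum>m\<in>UNIV. H l m j * G $ i $ m) = 0"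
  shows "H l m a = 0"
proof -
  define h where "h l i j = (\<Sum>m\<in>UNIV. H l m i * G $ m $ j)" for l i j
  have s: "h l i j = h i l j" for l i j unfolding h_def sym[of l] ..
  have k: "h l i j = - h l j i" for l i j
  proof -
    have "(\<Sum>m\<in>UNIV. H l m j * G $ i $ m) = h l j i"
      unfolding h_def by (intro sum.cong refl arg_cong2[where f = times] Gs)
    then show ?thesis using comp[of l i j] unfolding h_def by linarith
  qed
  have z: "h l i j = 0" for l i j
    using s[of l i j] k[of i l j] s[of i j l] k[of j i l] s[of j l i] k[of l j i] by linarith
  have "(\<chi> a m. H l m a) ** G = 0"
    using z unfolding h_def vec_eq_iff matrix_matrix_mult_def by simp
  then have "((\<chi> a m. H l m a) ** G) ** matrix_inv G = 0" by (simp add: matrix_matrix_mult_def vec_eq_iff)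
  then have "(\<chi> a m. H l m a) = 0"
    by (simp only: matrix_mul_assoc[symmetric] matrix_inv_right[OF G] matrix_mul_rid)
  then have "(\<chi> a m. H l m a) $ a $ m = 0" by simp
  then show ?thesis by simp
qed

lemma dd_sum_mult:
  fixes f h :: "7 \<Rightarrow> 'a::real_normed_vector \<Rightarrow> real"
  assumes "\<And>m. f m differentiable (at z)" "\<And>m. h m differentiable (at z)"
  shows "dd v (\<lambda>y. \<Sum>m\<in>UNIV. f m y * h m y) z = (\<Sum>m\<in>UNIV. f m z * dd v (h m) z) + (\<Sum>m\<in>UNIV. dd v (f m) z * h m z)"
  by (rule trans, rule dd_eq, (rule has_derivative_sum has_derivative_mult has_derivative_dd assms)+) (simp only: sum.distrib)

text \<open>\<open>u\<close> is the time direction and \<open>P\<close> the slice t = 0, the only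
  place where the velocity of a family is prescribed. The assumption \<open>slice\<close> expresses
  that the directions \<open>e l\<close> are tangent to \<open>P\<close>, so that values on
  \<open>P\<close> determine these derivatives.\<close>

locale G2_flow = G2_field S w e for S :: "'a::euclidean_space set" and w e +
  fixes u :: 'a and Y :: "7 \<Rightarrow> 'a \<Rightarrow> real" and P :: "'a set" and z :: 'a
  assumes u: "u \<in> Basis" and PS: "P \<subseteq> S" and zP: "z \<in> P"
    and smooth_Y: "\<And>k m. Ck_on k S (Y m)"
    and slice: "\<And>(f :: 'a \<Rightarrow> real) h l. f differentiable (at z) \<Longrightarrow> h differentiable (at z) \<Longrightarrow> (\<And>p. p \<in> P \<Longrightarrow> f p = h p) \<Longrightarrow>
       dd (e l) f z = dd (e l) h z"
    and flow: "\<And>p a b c. p \<in> P \<Longrightarrow> dd u (\<lambda>y. w y a b c) p =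
       (\<Sum>m\<in>UNIV. Y m p * dd (e m) (\<lambda>y. w y a b c) p) + act3 (\<lambda>m a. dd (e a) (Y m) p) (w p) a b c"
begin

abbreviation N where "N p \<equiv> (\<lambda>m a. dd (e a) (Y m) p)"

lemma zS: "z \<in> S"
  using PS zP by blast

text \<open>The velocity of \<open>w\<close> is transport along \<open>Y\<close> plus the action of
  \<open>N\<close>; the chain rule passes both to any differentiable function of the form.\<close>

lemma flow_natural:
  assumes p: "p \<in> P" and F: "tensor_differentiable F (w p)"
  shows "dd u (\<lambda>y. F (w y)) p = (\<Sum>m\<in>UNIV. Y m p * dd (e m) (\<lambda>y. F (w y)) p) + tensor_deriv F (w p) (act3 (N p) (w p))"
proof -
  have pS: "p \<in> S" using p PS by blast
  have "dd u (\<lambda>y. F (w y)) p = tensor_deriv F (w p) (\<lambda>a b c. (\<Sum>m\<in>UNIV. Y m p * dd (e m) (\<lambda>y. w y a b c) p) + act3 (N p) (w p) a b c)"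
    unfolding chain_w[OF pS F] flow[OF p] by (rule refl)
  then show ?thesis
    unfolding tensor_deriv_linear(1)[OF F] tensor_deriv_linear(4)[OF F, where x = "\<lambda>m. Y m p" and h = "\<lambda>m a b c. dd (e m) (\<lambda>y. w y a b c) p"]
      chain_w[OF pS F] .
qed

lemma smooth_N: "Ck_on k S (\<lambda>p. N p m a)"
  by (rule smooth_dd[OF smooth_Y e])

text \<open>The Lie derivative of the connection coefficients. They are not a tensor, so second
  derivatives of \<open>Y\<close> appear, as derivatives of \<open>N\<close>.\<close>

definition lie_christoffel :: "7 \<Rightarrow> tensor2" where
  "lie_christoffel l m a = ((\<Sum>p\<in>UNIV. dd (e l) (Y p) z * \<Gamma> z p m a) + (\<Sum>p\<in>UNIV. Y p z * dd (e p) (\<lambda>y. \<Gamma> y l m a) z)) +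
     (dd (e l) (\<lambda>y. N y m a) z + (mcomp (\<Gamma> z l) (N z) m a - mcomp (N z) (\<Gamma> z l) m a))"

text \<open>Derivatives along \<open>u\<close> and \<open>e l\<close> are taken in both orders. With
  L_Y the Lie derivative, the result reads (\<partial>_u \<Gamma>) q + \<partial>_u t = (L_Y
  \<Gamma>) q + L_Y t, for the metric and for the form alike.\<close>

lemma gact_lie:
  assumes r: "r * r = r"
    and q: "\<And>k a b c. Ck_on k S (\<lambda>y. q y a b c)" and t: "\<And>k l a b c. Ck_on k S (\<lambda>y. t y l a b c)"
    and eq: "\<And>y l a b c. y \<in> S \<Longrightarrow> dd (e l) (\<lambda>y. q y a b c) y = gact r (\<Gamma> y l) (q y) a b c + t y l a b c"
    and fl: "\<And>p a b c. p \<in> P \<Longrightarrow> dd u (\<lambda>y. q y a b c) p = (\<Sum>m\<in>UNIV. Y m p * dd (e m) (\<lambda>y. q y a b c) p) + gact r (N p) (q p) a b c"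
  shows "gact r (\<lambda>m a. dd u (\<lambda>y. \<Gamma> y l m a) z) (q z) a b c + dd u (\<lambda>y. t y l a b c) z =
    gact r (lie_christoffel l) (q z) a b c + ((\<Sum>m\<in>UNIV. dd (e l) (Y m) z * t z m a b c) +
       (\<Sum>m\<in>UNIV. Y m z * dd (e m) (\<lambda>y. t y l a b c) z) + gact r (N z) (t z l) a b c)"
proof -
  have dG: "\<And>l m k. (\<lambda>y. \<Gamma> y l m k) differentiable (at z)" by (rule diff_of_smooth[OF smooth_christoffel zS])
  have dN: "\<And>m k. (\<lambda>y. N y m k) differentiable (at z)" by (rule diff_of_smooth[OF smooth_N zS])
  have dY: "\<And>m. Y m differentiable (at z)" by (rule diff_of_smooth[OF smooth_Y zS])
  have dq: "\<And>a b c. (\<lambda>y. q y a b c) differentiable (at z)" by (rule diff_of_smooth[OF q zS])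
  have ddq: "(\<lambda>y. dd v (\<lambda>y. q y a b c) y) differentiable (at z)" if "v \<in> Basis" for v a b c
    by (rule diff_of_smooth[OF smooth_dd[OF q that] zS])
  have dt: "\<And>l. (\<lambda>y. t y l a b c) differentiable (at z)" by (rule diff_of_smooth[OF t zS])
  have sg: "(\<lambda>y. gact r (M y) (q y) a b c) differentiable (at z)" if "\<And>k i j. Ck_on k S (\<lambda>y. M y i j)" for M :: "'a \<Rightarrow> tensor2"
    unfolding gact_def op1_def op2_def op3_def
    by (rule diff_of_smooth[OF _ zS]) (intro Ck_on_add Ck_on_sum Ck_on_mult Ck_on_cmult S that q)
  have E: "dd v (\<lambda>y. dd (e l) (\<lambda>y. q y a b c) y) z =
     gact r (\<lambda>m a. dd v (\<lambda>y. \<Gamma> y l m a) z) (q z) a b c + gact r (\<Gamma> z l) (\<lambda>a b c. dd v (\<lambda>y. q y a b c) z) a b c + dd v (\<lambda>y. t y l a b c) z" for v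
  proof -
    have "dd v (\<lambda>y. dd (e l) (\<lambda>y. q y a b c) y) z = dd v (\<lambda>y. gact r (\<Gamma> y l) (q y) a b c + t y l a b c) z"
      by (rule dd_cong[OF S zS]) (rule eq)
    then show ?thesis unfolding dd_add[OF sg[OF smooth_christoffel] dt] dd_gact[OF dG dq] .
  qed
  let ?X = "\<lambda>m. gact r (\<Gamma> z l) (\<lambda>a b c. dd (e m) (\<lambda>y. q y a b c) z) a b c"
  have A1: "dd u (\<lambda>y. dd (e l) (\<lambda>y. q y a b c) y) z =
     gact r (\<lambda>m a. dd u (\<lambda>y. \<Gamma> y l m a) z) (q z) a b c + ((\<Sum>m\<in>UNIV. Y m z * ?X m) + gact r (\<Gamma> z l) (gact r (N z) (q z)) a b c) + dd u (\<lambda>y. t y l a b c) z"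
    unfolding E fl[OF zP] gact_add gact_sum[where x = "\<lambda>m. Y m z" and F = "\<lambda>m a b c. dd (e m) (\<lambda>y. q y a b c) z"] by (rule refl)
  have "dd u (\<lambda>y. dd (e l) (\<lambda>y. q y a b c) y) z = dd (e l) (\<lambda>y. dd u (\<lambda>y. q y a b c) y) z"
    by (rule dd_commute[OF S zS q e u])
  \<comment> \<open>The flow equation holds only on \<open>P\<close>, which need not be open, so
    \<open>slice\<close> takes the place of \<open>dd_cong\<close>.\<close>
  also have "\<dots> = dd (e l) (\<lambda>p. (\<Sum>m\<in>UNIV. Y m p * dd (e m) (\<lambda>y. q y a b c) p) + gact r (N p) (q p) a b c) z"
  proof (rule slice)
    show "dd u (\<lambda>y. q y a b c) differentiable (at z)" by (rule ddq[OF u])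
    show "(\<lambda>p. (\<Sum>m\<in>UNIV. Y m p * dd (e m) (\<lambda>y. q y a b c) p) + gact r (N p) (q p) a b c) differentiable (at z)"
      by (intro differentiable_add differentiable_sum ballI differentiable_mult dY ddq[OF e] sg smooth_N finite_class.finite_UNIV)
  qed (rule fl)
  also have "\<dots> = ((\<Sum>m\<in>UNIV. Y m z * dd (e l) (\<lambda>y. dd (e m) (\<lambda>y. q y a b c) y) z) + (\<Sum>m\<in>UNIV. dd (e l) (Y m) z * dd (e m) (\<lambda>y. q y a b c) z)) +
     (gact r (\<lambda>m a. dd (e l) (\<lambda>y. N y m a) z) (q z) a b c + gact r (N z) (\<lambda>a b c. dd (e l) (\<lambda>y. q y a b c) z) a b c)"
  proof -
    have "(\<lambda>p. \<Sum>m\<in>UNIV. Y m p * dd (e m) (\<lambda>y. q y a b c) p) differentiable (at z)"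
      by (intro differentiable_sum ballI differentiable_mult dY ddq[OF e] finite_class.finite_UNIV)
    from dd_add[OF this sg[OF smooth_N]] show ?thesis
      unfolding dd_gact[OF dN dq] dd_sum_mult[OF dY ddq[OF e]] .
  qed
  also have "(\<Sum>m\<in>UNIV. Y m z * dd (e l) (\<lambda>y. dd (e m) (\<lambda>y. q y a b c) y) z) =
     (\<Sum>m\<in>UNIV. Y m z * gact r (\<lambda>i a. dd (e m) (\<lambda>y. \<Gamma> y l i a) z) (q z) a b c) + (\<Sum>m\<in>UNIV. Y m z * ?X m) + (\<Sum>m\<in>UNIV. Y m z * dd (e m) (\<lambda>y. t y l a b c) z)"
  proof -
    have "dd (e l) (\<lambda>y. dd (e m) (\<lambda>y. q y a b c) y) z = dd (e m) (\<lambda>y. dd (e l) (\<lambda>y. q y a b c) y) z" for m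
      by (rule dd_commute[OF S zS q e e])
    then show ?thesis unfolding E by (simp only: distrib_left sum.distrib)
  qed
  also have "(\<Sum>m\<in>UNIV. dd (e l) (Y m) z * dd (e m) (\<lambda>y. q y a b c) z) =
     (\<Sum>m\<in>UNIV. dd (e l) (Y m) z * gact r (\<Gamma> z m) (q z) a b c) + (\<Sum>m\<in>UNIV. dd (e l) (Y m) z * t z m a b c)"
    unfolding eq[OF zS] distrib_left sum.distrib by (rule refl)
  also have "gact r (N z) (\<lambda>a b c. dd (e l) (\<lambda>y. q y a b c) z) a b c = gact r (N z) (gact r (\<Gamma> z l) (q z)) a b c + gact r (N z) (t z l) a b c"
    unfolding eq[OF zS] gact_add by (rule refl)
  finally have A2: "dd u (\<lambda>y. dd (e l) (\<lambda>y. q y a b c) y) z =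
    (\<Sum>m\<in>UNIV. Y m z * gact r (\<lambda>i a. dd (e m) (\<lambda>y. \<Gamma> y l i a) z) (q z) a b c) + (\<Sum>m\<in>UNIV. Y m z * ?X m) +
    (\<Sum>m\<in>UNIV. Y m z * dd (e m) (\<lambda>y. t y l a b c) z) +
    ((\<Sum>m\<in>UNIV. dd (e l) (Y m) z * gact r (\<Gamma> z m) (q z) a b c) + (\<Sum>m\<in>UNIV. dd (e l) (Y m) z * t z m a b c)) +
    (gact r (\<lambda>m a. dd (e l) (\<lambda>y. N y m a) z) (q z) a b c +
      (gact r (N z) (gact r (\<Gamma> z l) (q z)) a b c + gact r (N z) (t z l) a b c))" .
  have C: "gact r (N z) (gact r (\<Gamma> z l) (q z)) a b c - gact r (\<Gamma> z l) (gact r (N z) (q z)) a b c =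
     gact r (\<lambda>m a. mcomp (\<Gamma> z l) (N z) m a - mcomp (N z) (\<Gamma> z l) m a) (q z) a b c"
    by (rule gact_commutator[OF r])
  have "gact r (lie_christoffel l) (q z) a b c =
    ((\<Sum>m\<in>UNIV. dd (e l) (Y m) z * gact r (\<Gamma> z m) (q z) a b c) + (\<Sum>m\<in>UNIV. Y m z * gact r (\<lambda>i a. dd (e m) (\<lambda>y. \<Gamma> y l i a) z) (q z) a b c)) +
    (gact r (\<lambda>m a. dd (e l) (\<lambda>y. N y m a) z) (q z) a b c + gact r (\<lambda>m a. mcomp (\<Gamma> z l) (N z) m a - mcomp (N z) (\<Gamma> z l) m a) (q z) a b c)"
    unfolding lie_christoffel_def[abs_def] gact_mat_linear(1)
      gact_mat_linear(3)[where x = "\<lambda>p. dd (e l) (Y p) z" and F = "\<lambda>p. \<Gamma> z p"]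
      gact_mat_linear(3)[where x = "\<lambda>p. Y p z" and F = "\<lambda>p m a. dd (e p) (\<lambda>y. \<Gamma> y l m a) z"] by (rule refl)
  then show ?thesis using A1 A2 C by linarith
qed

text \<open>\<open>gact_lie\<close> with r = 0 and the metric as \<open>q\<close> shows that the
  difference of the two sides acts trivially on the metric. It is also symmetric in the lower
  indices, so \<open>levi_civita_unique\<close> makes it zero.\<close>

lemma dd_christoffel: "dd u (\<lambda>y. \<Gamma> y l m a) z = lie_christoffel l m a"
proof -
  let ?H = "\<lambda>l m a. dd u (\<lambda>y. \<Gamma> y l m a) z - lie_christoffel l m a"
  have "?H l m a = 0"
  proof (rule levi_civita_unique[where G = "g_expr (w z)" and H = ?H])
    show "det (g_expr (w z)) \<noteq> 0" by (rule nondeg_det_g[OF nd[OF zS]])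
    show "g z i j = g z j i" for i j by (rule g_sym[OF zS])
    fix l m a
    have G: "\<Gamma> z l m a = \<Gamma> z a m l" for l m a by (rule christoffel_sym[OF zS])
    have dG: "dd v (\<lambda>y. \<Gamma> y l m a) z = dd v (\<lambda>y. \<Gamma> y a m l) z" for v l m a
      by (rule dd_cong[OF S zS]) (rule christoffel_sym)
    have dN: "dd (e l) (\<lambda>y. N y m a) z = dd (e a) (\<lambda>y. N y m l) z"
      by (rule dd_commute[OF S zS smooth_Y e e])
    have G1: "(\<Sum>p\<in>UNIV. dd (e l) (Y p) z * \<Gamma> z p m a) = mcomp (\<Gamma> z a) (N z) m l" for l a
      unfolding mcomp_def G[where m = m and a = a] by (simp only: mult.commute)
    have G2: "(\<Sum>p\<in>UNIV. Y p z * dd (e p) (\<lambda>y. \<Gamma> y l m a) z) = (\<Sum>p\<in>UNIV. Y p z * dd (e p) (\<lambda>y. \<Gamma> y a m l) z)"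
      by (intro sum.cong refl arg_cong2[where f = times] dG)
    have G3: "mcomp (N z) (\<Gamma> z l) m a = mcomp (N z) (\<Gamma> z a) m l"
      unfolding mcomp_def by (intro sum.cong refl arg_cong2[where f = times] G)
    show "?H l m a = ?H a m l"
      unfolding lie_christoffel_def G1 using dG[where v = u and l = l and m = m and a = a] dN G2 G3 by linarith
  next
    fix l i j
    have td: "tensor_differentiable (\<lambda>w. g_expr w $ i $ j) (w p)" if "p \<in> P" for p i j
      using that PS by (intro tensor_differentiable_g nd) blast
    have z0: "gact 0 M (\<lambda>a b c. 0) a b c = 0" for M a b c
      unfolding gact_def op1_def op2_def by simp
    have "gact 0 (\<lambda>m a. dd u (\<lambda>y. \<Gamma> y l m a) z) (\<lambda>a b c. g z a b) i j undefined + dd u (\<lambda>y. 0) z =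
      gact 0 (lie_christoffel l) (\<lambda>a b c. g z a b) i j undefined + ((\<Sum>m\<in>UNIV. dd (e l) (Y m) z * 0) +
       (\<Sum>m\<in>UNIV. Y m z * dd (e m) (\<lambda>y. 0) z) + gact 0 (N z) (\<lambda>a b c. 0) i j undefined)"
    proof (rule gact_lie)
      show "dd (e l) (\<lambda>y. g y a b) y = gact 0 (\<Gamma> y l) (\<lambda>a b c. g y a b) a b c + 0" if "y \<in> S" for y l a b and c :: 7
        unfolding gact_0 using metric_compatible[OF that] by simp
      show "dd u (\<lambda>y. g y a b) p = (\<Sum>m\<in>UNIV. Y m p * dd (e m) (\<lambda>y. g y a b) p) + gact 0 (N p) (\<lambda>a b c. g p a b) a b c" if "p \<in> P" for p a b and c :: 7
      proof -
        have n: "nondeg (w p)" using that PS nd by blast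
        show ?thesis unfolding gact_0 flow_natural[OF that td[OF that]] g_expr_natural[OF n] by (rule refl)
      qed
    qed (simp_all add: smooth_g Ck_on_const)
    then have "gact 0 (\<lambda>m a. ?H l m a) (\<lambda>a b c. g z a b) i j undefined = 0"
      unfolding z0 gact_mat_linear(2) by simp
    then show "(\<Sum>m\<in>UNIV. ?H l m i * g z m j) + (\<Sum>m\<in>UNIV. ?H l m j * g z i m) = 0"
      unfolding gact_0 .
  qed
  then show ?thesis by simp
qed

text \<open>In \<open>gact_lie\<close> with r = 1 and the form as \<open>q\<close>, the connection
  terms cancel by \<open>dd_christoffel\<close>. The derivatives of \<open>Psi\<close> cancel by
  \<open>flow_natural\<close>, and injectivity of \<open>dot\<close> compares the coefficients that
  remain.\<close>

lemma dd_torsion: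
  "dd u (\<lambda>y. T y l j) z = (\<Sum>m\<in>UNIV. Y m z * dd (e m) (\<lambda>y. T y l j) z) + (\<Sum>m\<in>UNIV. dd (e l) (Y m) z * T z m j)
     + (\<Sum>m\<in>UNIV. dd (e j) (Y m) z * T z l m)"
proof -
  let ?P = "Psi (w z)" and ?t = "\<lambda>y l. dot (T y l) (Psi (w y))"
  have dT: "\<And>l m. (\<lambda>y. T y l m) differentiable (at z)" by (rule diff_of_smooth[OF smooth_torsion zS])
  have dP: "\<And>m a b c. (\<lambda>y. Psi (w y) m a b c) differentiable (at z)" by (rule diff_of_smooth[OF smooth_Psi zS])
  have st: "Ck_on k S (\<lambda>y. ?t y l a b c)" for k l a b c
    unfolding dot_def by (intro Ck_on_sum Ck_on_mult S smooth_torsion smooth_Psi)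
  let ?Q = "\<lambda>l m a b c. \<Sum>r\<in>UNIV. T z l r * dd (e m) (\<lambda>y. Psi (w y) r a b c) z"
  have main: "dd u (\<lambda>y. ?t y l a b c) z = (\<Sum>m\<in>UNIV. dd (e l) (Y m) z * ?t z m a b c) +
       (\<Sum>m\<in>UNIV. Y m z * dd (e m) (\<lambda>y. ?t y l a b c) z) + act3 (N z) (?t z l) a b c" for a b c
  proof -
    have "gact 1 (\<lambda>m a. dd u (\<lambda>y. \<Gamma> y l m a) z) (w z) a b c + dd u (\<lambda>y. ?t y l a b c) z =
      gact 1 (lie_christoffel l) (w z) a b c + ((\<Sum>m\<in>UNIV. dd (e l) (Y m) z * ?t z m a b c) +
       (\<Sum>m\<in>UNIV. Y m z * dd (e m) (\<lambda>y. ?t y l a b c) z) + gact 1 (N z) (?t z l) a b c)"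
      by (rule gact_lie) (simp_all add: smooth st gact_1 torsion_equation flow)
    then show ?thesis unfolding dd_christoffel gact_1 by simp
  qed
  have Pu: "(\<Sum>r\<in>UNIV. T z l r * dd u (\<lambda>y. Psi (w y) r a b c) z) = (\<Sum>m\<in>UNIV. Y m z * ?Q l m a b c) +
      (act3 (N z) (?t z l) a b c - dot (\<lambda>j. \<Sum>m\<in>UNIV. N z m j * T z l m) ?P a b c)" for a b c
  proof -
    have "(\<Sum>r\<in>UNIV. T z l r * (\<Sum>m\<in>UNIV. Y m z * dd (e m) (\<lambda>y. Psi (w y) r a b c) z)) = (\<Sum>m\<in>UNIV. Y m z * ?Q l m a b c)"
      by (rule sum_swap_mult)
    then show ?thesis
      unfolding flow_natural[OF zP tensor_differentiable_Psi[OF nd[OF zS]]] Psi_natural[OF nd[OF zS]] distrib_left[of "T _ _ _"] sum.distrib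
        dot_natural[where M = "N z"] by (simp only:)
  qed
  have tm: "(\<Sum>m\<in>UNIV. Y m z * dd (e m) (\<lambda>y. ?t y l a b c) z) =
      dot (\<lambda>j. \<Sum>m\<in>UNIV. Y m z * dd (e m) (\<lambda>y. T y l j) z) ?P a b c + (\<Sum>m\<in>UNIV. Y m z * ?Q l m a b c)" for a b c
  proof -
    have "(\<Sum>m\<in>UNIV. Y m z * dot (\<lambda>j. dd (e m) (\<lambda>y. T y l j) z) ?P a b c) = dot (\<lambda>j. \<Sum>m\<in>UNIV. Y m z * dd (e m) (\<lambda>y. T y l j) z) ?P a b c"
      unfolding dot_def sum_distrib_left sum_distrib_right by (subst sum.swap) (simp only: mult.assoc)
    then show ?thesis unfolding dd_dot[OF dT dP] distrib_left sum.distrib by (simp only:)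
  qed
  have ty: "(\<Sum>m\<in>UNIV. dd (e l) (Y m) z * ?t z m a b c) = dot (\<lambda>j. \<Sum>m\<in>UNIV. dd (e l) (Y m) z * T z m j) ?P a b c" for a b c
    unfolding dot_def sum_distrib_left sum_distrib_right by (subst sum.swap) (simp only: mult.assoc)
  have "dot (\<lambda>j. dd u (\<lambda>y. T y l j) z) ?P a b c = dot (\<lambda>j. (\<Sum>m\<in>UNIV. Y m z * dd (e m) (\<lambda>y. T y l j) z) + (\<Sum>m\<in>UNIV. dd (e l) (Y m) z * T z m j)
     + (\<Sum>m\<in>UNIV. dd (e j) (Y m) z * T z l m)) ?P a b c" for a b c
    using main[of a b c] unfolding tm ty unfolding dd_dot[OF dT dP] Pu dot_add by linarith
  from fun_cong[OF dot_Psi_inject[OF G2[OF zS] this], of j] show ?thesis .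
qed

end

section \<open>Passage to charts and to time times a chart\<close>

lemma pd_eq_dd: "pd i f x = dd (axis i 1) f x"
  unfolding pd_def ..

lemma dd_slice:
  assumes "f differentiable (at (t, x))"
  shows "dd (0, v) f (t, x) = dd v (\<lambda>y. f (t, y)) x"
proof -
  have "((\<lambda>y. (t, y)) has_derivative (\<lambda>v. (0, v))) (at x)"
    by (intro has_derivative_Pair has_derivative_const has_derivative_ident)
  from has_derivative_compose[where g = f, OF this has_derivative_dd[OF assms]] show ?thesis by (simp add: dd_eq)
qed

text \<open>Extends a function of position constantly in the first factor. A basis vector either
  lies in that factor, where the derivative vanishes, or in the second, where the induction
  hypothesis applies.\<close>

lemma Ck_on_snd:
  fixes f :: "'b::euclidean_space \<Rightarrow> real" and U :: "'b set" and I :: "'a::euclidean_space set"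
  shows "Ck_on k U f \<Longrightarrow> open U \<Longrightarrow> open I \<Longrightarrow> Ck_on k (I \<times> U) (\<lambda>z. f (snd z))"
proof (induction k arbitrary: f)
  case 0
  then show ?case by (auto intro!: continuous_on_compose2[of U f] continuous_intros)
next
  case (Suc k)
  have d: "((\<lambda>z. f (snd z)) has_derivative (\<lambda>v. dd (snd v) f (snd z))) (at z)" if "z \<in> I \<times> U" for z
  proof -
    have "f differentiable (at (snd z))" using Suc.prems that by auto
    from has_derivative_compose[OF has_derivative_snd[OF has_derivative_ident] has_derivative_dd[OF this]]
    show ?thesis .
  qed
  have "Ck_on k (I \<times> U) (\<lambda>z. dd b (\<lambda>z. f (snd z)) z)" if b: "b \<in> Basis" for b
  proof (rule Ck_on_cong)
    show "open (I \<times> U)" using Suc.prems by (simp add: open_Times)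
    show "Ck_on k (I \<times> U) (\<lambda>z. dd (snd b) f (snd z))"
    proof (cases "snd b = 0")
      case True
      have "dd 0 f (snd z) = 0" if "z \<in> I \<times> U" for z
      proof -
        have "f differentiable (at (snd z))" using Suc.prems that by auto
        then show ?thesis using linear_0[OF linear_frechet_derivative] by blast
      qed
      then show ?thesis unfolding True
        using Ck_on_cong[OF \<open>open (I \<times> U)\<close>, of "\<lambda>z. 0" "\<lambda>z. dd 0 f (snd z)" k] Ck_on_const by fastforce
    next
      case False
      then have "snd b \<in> Basis" using b by (auto simp: Basis_prod_def)
      then show ?thesis using Suc.IH[of "dd (snd b) f"] Suc.prems by simp
    qed
  qed (simp add: dd_eq[OF d])
  moreover have "\<forall>z\<in>I \<times> U. (\<lambda>z. f (snd z)) differentiable (at z)"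
    using d unfolding differentiable_def by blast
  ultimately show ?case by simp
qed

lemma christoffel_along_cong:
  assumes "open U" "x \<in> U" "\<And>y. y \<in> U \<Longrightarrow> w y = w' y"
  shows "christoffel_along e w x = christoffel_along e w' x"
proof -
  have "dd v (\<lambda>y. g_expr (w y) $ i $ j) x = dd v (\<lambda>y. g_expr (w' y) $ i $ j) x" for v i j
    by (rule dd_cong[OF assms(1,2)]) (simp only: assms(3))
  then show ?thesis unfolding christoffel_along_def[abs_def] assms(3)[OF assms(2)] by (simp only:)
qed

lemma torsion_along_cong:
  assumes "open U" "x \<in> U" "\<And>y. y \<in> U \<Longrightarrow> w y = w' y"
  shows "torsion_along e w x = torsion_along e w' x"
proof -
  have "dd v (\<lambda>y. w y a b c) x = dd v (\<lambda>y. w' y a b c) x" for v a b c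
    by (rule dd_cong[OF assms(1,2)]) (simp only: assms(3))
  moreover have "christoffel_along e w x m i = christoffel_along e w' x m i" for m i
    by (rule fun_cong[OF fun_cong[OF christoffel_along_cong[OF assms]]])
  ultimately show ?thesis
    unfolding torsion_along_def[abs_def] cov_along_def[abs_def] assms(3)[OF assms(2)] by (simp only:)
qed

locale G2_chart = G2_field U w "\<lambda>i. axis i 1" for U :: "(real^7) set" and w
begin

lemma metric_eq: "y \<in> U \<Longrightarrow> metric_field w y = g_expr (w y)"
  unfolding metric_field_def by (rule metric_G2[OF G2])

lemma ginv_eq: "y \<in> U \<Longrightarrow> ginv (w y) i j = matrix_inv (g_expr (w y)) $ i $ j"
  unfolding ginv_def by (simp only: metric_G2[OF G2])

lemma christoffel_eq:
  assumes x: "x \<in> U"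
  shows "christoffel (metric_field w) x m i j = christoffel_along (\<lambda>i. axis i 1) w x m i j"
proof -
  have "pd k (\<lambda>y. metric_field w y $ i $ j) x = dd (axis k 1) (\<lambda>y. g_expr (w y) $ i $ j) x" for k i j
    unfolding pd_eq_dd by (rule dd_cong[OF S x]) (simp only: metric_eq)
  then show ?thesis unfolding christoffel_def christoffel_along_def metric_eq[OF x] by (simp only:)
qed

lemma nabla3_eq:
  assumes x: "x \<in> U"
  shows "nabla3 (metric_field w) w x l a b c = cov_along (\<lambda>i. axis i 1) w x l a b c"
  unfolding nabla3_def cov_along_def act3_def christoffel_eq[OF x] pd_eq_dd sum.distrib by (rule refl)

text \<open>Existence in the definite description is \<open>cov_eq_dot\<close>, uniqueness is the
  injectivity of \<open>dot\<close>.\<close>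

lemma torsion_eq:
  assumes x: "x \<in> U"
  shows "torsion w x = T x"
proof -
  have c: "(\<Sum>m\<in>UNIV. \<Sum>n\<in>UNIV. s l m * ginv (w x) m n * psi (w x) n a b c) = dot (s l) (Psi (w x)) a b c" for s l a b c
    unfolding dot_def Psi_def ginv_eq[OF x] psi_G2[OF G2[OF x]] sum_distrib_left by (simp only: mult.assoc)
  show ?thesis unfolding torsion_def c nabla3_eq[OF x]
  proof (rule the_equality)
    show "\<forall>l a b c. cov_along (\<lambda>i. axis i 1) w x l a b c = dot (T x l) (Psi (w x)) a b c"
      by (simp only: cov_eq_dot[OF x] simp_thms)
  next
    fix s assume s: "\<forall>l a b c. cov_along (\<lambda>i. axis i 1) w x l a b c = dot (s l) (Psi (w x)) a b c"
    have "s l = T x l" for l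
    proof (rule dot_Psi_inject[OF G2[OF x]])
      show "dot (s l) (Psi (w x)) a b c = dot (T x l) (Psi (w x)) a b c" for a b c
        using s unfolding cov_eq_dot[OF x] by metis
    qed
    then show "s = T x" by (rule ext)
  qed
qed

lemma pd_torsion:
  assumes x: "x \<in> U"
  shows "pd i (\<lambda>y. torsion w y j l) x = dd (axis i 1) (\<lambda>y. T y j l) x"
  unfolding pd_eq_dd by (rule dd_cong[OF S x]) (simp only: torsion_eq)

lemma riem_eq:
  assumes x: "x \<in> U"
  shows "riem (metric_field w) x i j a b = (\<Sum>m\<in>UNIV. curv x i j m a * g_expr (w x) $ m $ b)"
proof -
  have d: "pd i (\<lambda>y. christoffel (metric_field w) y m j k) x = dd (axis i 1) (\<lambda>y. christoffel_along (\<lambda>i. axis i 1) w y m j k) x" for i m j k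
    unfolding pd_eq_dd by (rule dd_cong[OF S x]) (simp only: christoffel_eq)
  have "riem_up (metric_field w) x m i j k = curv x i j m k" for m k
    unfolding riem_up_def curv_def mcomp_def d christoffel_eq[OF x] sum_subtractf by (rule refl)
  then show ?thesis unfolding riem_def metric_eq[OF x] by (simp only:)
qed

text \<open>Antisymmetrising the covariant derivative cancels the Christoffel terms that act on the
  first index of the torsion; those on the second index are already in
  \<open>torsion_bianchi\<close>.\<close>

lemma bianchi:
  assumes x: "x \<in> U"
  shows "nabla2 (metric_field w) (torsion w) x i j l - nabla2 (metric_field w) (torsion w) x j i l
    = (\<Sum>a\<in>UNIV. \<Sum>b\<in>UNIV. \<Sum>m\<in>UNIV. \<Sum>n\<in>UNIV.
         torsion w x i a * torsion w x j b * ginv (w x) a m * ginv (w x) b n * w x m n l)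
    + (1/2) * (\<Sum>a\<in>UNIV. \<Sum>b\<in>UNIV. \<Sum>m\<in>UNIV. \<Sum>n\<in>UNIV.
         riem (metric_field w) x i j a b * ginv (w x) a m * ginv (w x) b n * w x m n l)"
proof -
  have n: "nabla2 (metric_field w) (torsion w) x i j l =
      dd (axis i 1) (\<lambda>y. T y j l) x - (\<Sum>m\<in>UNIV. christoffel_along (\<lambda>i. axis i 1) w x m i j * T x m l) - (\<Sum>m\<in>UNIV. \<Gamma> x i m l * T x j m)" for i j
    unfolding nabla2_def pd_torsion[OF x] christoffel_eq[OF x] torsion_eq[OF x] sum.distrib by simp
  have "(\<Sum>m\<in>UNIV. christoffel_along (\<lambda>i. axis i 1) w x m i j * T x m l) = (\<Sum>m\<in>UNIV. christoffel_along (\<lambda>i. axis i 1) w x m j i * T x m l)"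
    by (intro sum.cong refl arg_cong2[where f = times] christoffel_sym[OF x])
  then have "nabla2 (metric_field w) (torsion w) x i j l - nabla2 (metric_field w) (torsion w) x j i l =
      raised_cross (w x) (T x i) (T x j) l + (1/2) * lowered_dual (w x) (curv x i j) l"
    using torsion_bianchi[OF x, where i = i and j = j and l = l] unfolding n by linarith
  then show ?thesis
    unfolding raised_cross_def lowered_dual_def ginv_eq[OF x] riem_eq[OF x] torsion_eq[OF x] .
qed

end

lemma G2_chart_of_structure:
  assumes A: "smooth_manifold A" and \<phi>: "G2_structure A \<phi>" and \<kappa>: "\<kappa> \<in> A"
  shows "G2_chart (chart_img \<kappa>) (\<phi> \<kappa>)"
proof
  show "open (chart_img \<kappa>)" using A \<kappa> unfolding smooth_manifold_def is_chart_def by blast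
  show "axis i 1 \<in> (Basis :: (real^7) set)" for i by simp
  show "Ck_on k (chart_img \<kappa>) (\<lambda>z. \<phi> \<kappa> z a b c)" for k a b c
    using \<phi> \<kappa> unfolding G2_structure_def smooth_3form_def smooth_on_def by blast
  show "alt3 (\<phi> \<kappa> z)" if "z \<in> chart_img \<kappa>" for z
    using \<phi> \<kappa> that unfolding G2_structure_def smooth_3form_def alt3_def by blast
  show "G2_form (\<phi> \<kappa> z)" if "z \<in> chart_img \<kappa>" for z
    using \<phi> \<kappa> that unfolding G2_structure_def by blast
qed

text \<open>The family becomes one field on the interval times a chart, with the spatial unit
  vectors as \<open>e\<close> and the unit time vector as \<open>u\<close>. The vector field is
  extended constantly in time, and \<open>dd_torsion\<close> at (0, x) is the claim.\<close>

lemma DT_lie_derivative: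
  assumes A: "smooth_manifold A" and \<phi>: "G2_structure A \<phi>" and Y: "smooth_vector_field A Y"
  shows "DT_eq A \<phi> (\<lambda>\<kappa>. lie3 (Y \<kappa>) (\<phi> \<kappa>)) (\<lambda>\<kappa>. lie2 (Y \<kappa>) (torsion (\<phi> \<kappa>)))"
  unfolding DT_eq_def
proof (intro allI impI ballI)
  fix \<Phi> \<kappa> x i j
  assume var: "G2_variation A \<phi> (\<lambda>\<kappa>. lie3 (Y \<kappa>) (\<phi> \<kappa>)) \<Phi>" and \<kappa>: "\<kappa> \<in> A" and x: "x \<in> chart_img \<kappa>"
  let ?U = "chart_img \<kappa>"
  obtain \<epsilon> where \<epsilon>: "\<epsilon> > 0" and G: "\<And>t. t \<in> {-\<epsilon><..<\<epsilon>} \<Longrightarrow> G2_structure A (\<Phi> t)"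
    and sm: "\<And>a b c. smooth_on ({-\<epsilon><..<\<epsilon>} \<times> ?U) (\<lambda>(t, x). \<Phi> t \<kappa> x a b c)"
    using var \<kappa> unfolding G2_variation_def by blast
  have \<Phi>0: "y \<in> ?U \<Longrightarrow> \<Phi> 0 \<kappa> y a b c = \<phi> \<kappa> y a b c" for y a b c
    using var \<kappa> unfolding G2_variation_def by blast
  have \<Phi>0': "\<Phi> 0 \<kappa> y = \<phi> \<kappa> y" if "y \<in> ?U" for y by (intro ext \<Phi>0 that)
  have vel: "y \<in> ?U \<Longrightarrow> ((\<lambda>t. \<Phi> t \<kappa> y a b c) has_real_derivative lie3 (Y \<kappa>) (\<phi> \<kappa>) y a b c) (at 0)" for y a b c
    using var \<kappa> unfolding G2_variation_def by blast
  let ?I = "{-\<epsilon><..<\<epsilon>}" and ?e = "\<lambda>i. (0 :: real, axis i 1 :: real^7)" and ?u = "(1 :: real, 0 :: real^7)"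
  let ?W = "\<lambda>z :: real \<times> (real^7). \<Phi> (fst z) \<kappa> (snd z)" and ?Y = "\<lambda>m (z :: real \<times> (real^7)). Y \<kappa> (snd z) $ m"
  have I0: "0 \<in> ?I" using \<epsilon> by simp
  have chart: "G2_chart ?U (\<Phi> t \<kappa>)" if "t \<in> ?I" for t by (rule G2_chart_of_structure[OF A G[OF that] \<kappa>])
  interpret c: G2_chart ?U "\<phi> \<kappa>" by (rule G2_chart_of_structure[OF A \<phi> \<kappa>])
  have sY: "Ck_on k ?U (\<lambda>y. Y \<kappa> y $ m)" for k m
    by (rule Ck_on_compose_linear[OF c.S bounded_linear_vec_nth])
      (use Y \<kappa> in \<open>auto simp: smooth_vector_field_def smooth_on_def\<close>)
  interpret f: G2_field "?I \<times> ?U" ?W ?e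
  proof
    show "open (?I \<times> ?U)" using c.S by (simp add: open_Times)
    show "?e i \<in> Basis" for i by (simp add: Basis_prod_def)
    show "Ck_on k (?I \<times> ?U) (\<lambda>z. ?W z a b c)" for k a b c
      using sm[of a b c] unfolding smooth_on_def case_prod_beta by blast
    show "alt3 (?W z)" if "z \<in> ?I \<times> ?U" for z
      using G2_field.alt[OF G2_chart.axioms(1)[OF chart]] that by auto
    show "G2_form (?W z)" if "z \<in> ?I \<times> ?U" for z
      using G2_field.G2[OF G2_chart.axioms(1)[OF chart]] that by auto
  qed
  have dW: "dd (?e m) (\<lambda>z. ?W z a b c) (t, y) = dd (axis m 1) (\<lambda>y. \<Phi> t \<kappa> y a b c) y" if "t \<in> ?I" "y \<in> ?U" for m a b c t y
  proof -
    have "(\<lambda>z. ?W z a b c) differentiable (at (t, y))" by (rule f.diff_of_smooth[OF f.smooth]) (use that in simp)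
    from dd_slice[OF this] show ?thesis unfolding fst_conv snd_conv .
  qed
  have sY': "Ck_on k (?I \<times> ?U) (?Y m)" for k m
    by (rule Ck_on_snd[OF sY c.S open_greaterThanLessThan])
  have dY: "dd (?e a) (?Y m) (0, y) = pd a (\<lambda>y. Y \<kappa> y $ m) y" if "y \<in> ?U" for a m y
  proof -
    have "?Y m differentiable (at (0, y))"
      by (rule f.diff_of_smooth[OF sY']) (use that I0 in simp)
    from dd_slice[OF this] show ?thesis unfolding pd_eq_dd fst_conv snd_conv .
  qed
  interpret l: G2_flow "?I \<times> ?U" ?W ?e ?u ?Y "{0} \<times> ?U" "(0, x)"
  proof
    show "?u \<in> Basis" by (simp add: Basis_prod_def)
    show "{0} \<times> ?U \<subseteq> ?I \<times> ?U" using I0 by auto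
    show "(0, x) \<in> {0} \<times> ?U" using x by simp
    show "Ck_on k (?I \<times> ?U) (?Y m)" for k m by (rule sY')
    show "dd (?e l) f (0, x) = dd (?e l) h (0, x)"
      if "f differentiable (at (0, x))" "h differentiable (at (0, x))" "\<And>p. p \<in> {0} \<times> ?U \<Longrightarrow> f p = h p"
      for f h :: "real \<times> (real^7) \<Rightarrow> real" and l
      unfolding dd_slice[OF that(1)] dd_slice[OF that(2)] by (rule dd_cong[OF c.S x]) (simp add: that(3))
    show "dd ?u (\<lambda>z. ?W z a b c) p = (\<Sum>m\<in>UNIV. ?Y m p * dd (?e m) (\<lambda>z. ?W z a b c) p) + act3 (\<lambda>m a. dd (?e a) (?Y m) p) (?W p) a b c"
      if p: "p \<in> {0} \<times> ?U" for p a b c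
    proof -
      obtain y where y: "p = (0, y)" "y \<in> ?U" using p by auto
      have "(\<lambda>z. ?W z a b c) differentiable (at ((0, y) + 0 *\<^sub>R ?u))"
        using f.diff_of_smooth[OF f.smooth, of "(0, y)"] y I0 by simp
      from has_real_derivative_line[OF this]
      have "((\<lambda>t. \<Phi> t \<kappa> y a b c) has_real_derivative dd ?u (\<lambda>z. ?W z a b c) (0, y)) (at 0)" by simp
      then have 1: "dd ?u (\<lambda>z. ?W z a b c) p = lie3 (Y \<kappa>) (\<phi> \<kappa>) y a b c"
        using DERIV_unique vel[OF y(2)] unfolding y(1) by blast
      have 2: "dd (?e m) (\<lambda>z. ?W z a b c) p = pd m (\<lambda>y. \<phi> \<kappa> y a b c) y" for m
        unfolding y(1) dW[OF I0 y(2)] pd_eq_dd by (rule dd_cong[OF c.S y(2)]) (rule \<Phi>0)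
      have 3: "dd (?e a) (?Y m) p = pd a (\<lambda>y. Y \<kappa> y $ m) y" for a m
        unfolding y(1) by (rule dY[OF y(2)])
      show ?thesis
        unfolding 1 2 3 unfolding lie3_def act3_def y(1) fst_conv snd_conv \<Phi>0[OF y(2)] sum.distrib by simp
    qed
  qed
  have tors: "torsion (\<Phi> t \<kappa>) y a b = torsion_along ?e ?W (t, y) a b" if t: "t \<in> ?I" and y: "y \<in> ?U" for t y a b
  proof -
    have ty: "(t, y) \<in> ?I \<times> ?U" using t y by simp
    have dg: "dd (?e m) (\<lambda>z. g_expr (?W z) $ i $ j) (t, y) = dd (axis m 1) (\<lambda>y. g_expr (\<Phi> t \<kappa> y) $ i $ j) y" for m i j
      using dd_slice[OF f.diff_of_smooth[OF f.smooth_g ty]] unfolding fst_conv snd_conv .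
    have "christoffel_along ?e ?W (t, y) m i = christoffel_along (\<lambda>i. axis i 1) (\<Phi> t \<kappa>) y m i" for m i
      by (rule ext) (simp only: christoffel_along_def dg fst_conv snd_conv)
    then have "torsion_along ?e ?W (t, y) = torsion_along (\<lambda>i. axis i 1) (\<Phi> t \<kappa>) y"
      unfolding torsion_along_def[abs_def] cov_along_def[abs_def] dW[OF t y] fst_conv snd_conv by (simp only:)
    then show ?thesis by (simp only: G2_chart.torsion_eq[OF chart[OF t] y])
  qed
  \<comment> \<open>The two forms agree on the chart image; it is open, so their derivatives and
    hence their torsions agree there.\<close>
  have tors0: "torsion (\<phi> \<kappa>) y = torsion (\<Phi> 0 \<kappa>) y" if y: "y \<in> ?U" for y
    unfolding c.torsion_eq[OF y] G2_chart.torsion_eq[OF chart[OF I0] y]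
    by (rule torsion_along_cong[OF c.S y]) (simp only: \<Phi>0')
  have dT: "dd (?e m) (\<lambda>z. torsion_along ?e ?W z i j) (0, x) = pd m (\<lambda>y. torsion (\<phi> \<kappa>) y i j) x" for m
  proof -
    have "dd (?e m) (\<lambda>z. torsion_along ?e ?W z i j) (0, x) = dd (axis m 1) (\<lambda>y. torsion_along ?e ?W (0, y) i j) x"
      by (rule dd_slice) (rule f.diff_of_smooth[OF f.smooth_torsion l.zS])
    also have "\<dots> = pd m (\<lambda>y. torsion (\<phi> \<kappa>) y i j) x"
      unfolding pd_eq_dd by (rule dd_cong[OF c.S x]) (simp only: tors0 tors[OF I0])
    finally show ?thesis .
  qed
  have D: "dd ?u (\<lambda>z. torsion_along ?e ?W z i j) (0, x) = lie2 (Y \<kappa>) (torsion (\<phi> \<kappa>)) x i j"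
    unfolding l.dd_torsion dT dY[OF x] lie2_def tors0[OF x] tors[OF I0 x] snd_conv sum.distrib by (rule refl)
  have "(\<lambda>z. torsion_along ?e ?W z i j) differentiable (at ((0, x) + 0 *\<^sub>R ?u))"
    using f.diff_of_smooth[OF f.smooth_torsion l.zS] by simp
  from has_real_derivative_line[OF this]
  have d: "((\<lambda>t. torsion_along ?e ?W (t, x) i j) has_real_derivative lie2 (Y \<kappa>) (torsion (\<phi> \<kappa>)) x i j) (at 0)"
    by (simp add: D)
  \<comment> \<open>Only times in the interval are constrained, so the two functions of t are
    compared near 0.\<close>
  have ev: "eventually (\<lambda>t. torsion (\<Phi> t \<kappa>) x i j = torsion_along ?e ?W (t, x) i j) (nhds 0)"
    by (rule eventually_nhds[THEN iffD2], intro exI[of _ ?I] conjI) (use \<epsilon> x tors in auto)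
  show "((\<lambda>t. torsion (\<Phi> t \<kappa>) x i j) has_real_derivative lie2 (Y \<kappa>) (torsion (\<phi> \<kappa>)) x i j) (at 0)"
    by (rule DERIV_cong_ev[OF refl ev refl, THEN iffD2, OF d])
qed

theorem theorem4p2:
  fixes A :: "'m::{t2_space, second_countable_topology} chart set"
    and \<phi> :: "'m chart \<Rightarrow> real^7 \<Rightarrow> tensor3"
  assumes "smooth_manifold A"
    and "G2_structure A \<phi>"
  shows "(\<forall>Y. smooth_vector_field A Y \<longrightarrow>
            DT_eq A \<phi> (\<lambda>\<kappa>. lie3 (Y \<kappa>) (\<phi> \<kappa>)) (\<lambda>\<kappa>. lie2 (Y \<kappa>) (torsion (\<phi> \<kappa>))))
     \<longleftrightarrow>
         (\<forall>\<kappa>\<in>A. \<forall>x\<in>chart_img \<kappa>. \<forall>i j l.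
            nabla2 (metric_field (\<phi> \<kappa>)) (torsion (\<phi> \<kappa>)) x i j l
              - nabla2 (metric_field (\<phi> \<kappa>)) (torsion (\<phi> \<kappa>)) x j i l
            = (\<Sum>a\<in>UNIV. \<Sum>b\<in>UNIV. \<Sum>m\<in>UNIV. \<Sum>n\<in>UNIV.
                 torsion (\<phi> \<kappa>) x i a * torsion (\<phi> \<kappa>) x j b
                   * ginv (\<phi> \<kappa> x) a m * ginv (\<phi> \<kappa> x) b n * \<phi> \<kappa> x m n l)
            + (1/2) * (\<Sum>a\<in>UNIV. \<Sum>b\<in>UNIV. \<Sum>m\<in>UNIV. \<Sum>n\<in>UNIV.
                 riem (metric_field (\<phi> \<kappa>)) x i j a b
                   * ginv (\<phi> \<kappa> x) a m * ginv (\<phi> \<kappa> x) b n * \<phi> \<kappa> x m n l))"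
  (is "?invariance \<longleftrightarrow> ?identity")
proof -
  have invariance: ?invariance using DT_lie_derivative[OF assms] by blast
  have identity: ?identity
    by (intro ballI allI) (rule G2_chart.bianchi[OF G2_chart_of_structure[OF assms]])
  show ?thesis by (rule iffI; rule identity invariance)
qed

end
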